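(* Let $\alpha>-1$ and let $\varphi\ge0$ be in $L^\infty(\omega_\alpha)$. The following conditions are equivalent: (1) the Toeplitz operator $T_\varphi$ is invertible on $L_h^2(\omega_\alpha)$; (2) the Berezin transform $\widetilde{\varphi}$ is invertible in $L^\infty(\omega_\alpha)$, where $$\widetilde{\varphi}(z)=\frac{1}{\|R^\alpha_z\|^2_{L^2(\omega_\alpha)}}\int_{\mathbb{D}}\varphi(\lambda)|R^\alpha_z(\lambda)|^2\omega_\alpha(\lambda)\,dA(\lambda),\qquad \|R^\alpha_z\|^2_{L^2(\omega_\alpha)}=R^\alpha_z(z)=\frac{2}{(1-|z|^2)^{2+\alpha}}-1;$$ (3) there exists $r>0$ such that, with $G:=\{z\in\mathbb{D}:\varphi(z)>r\}$, $\chi_G\,dA$ is a reverse Carleson measure for $L_h^2(\omega_\alpha)$; (4) there exists a constant $C>0$ such that $$\int_{\mathbb{D}}|f(z)|^2\varphi(z)\omega_\alpha(z)\,dA(z)\ge C\int_{\mathbb{D}}|f(z)|^2\omega_\alpha(z)\,dA(z)$$ for all $f\in L_h^2(\omega_\alpha)$.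
   Context: $\mathbb{D}$ is the open unit disk in $\mathbb{C}$, $dA$ is Lebesgue area measure on $\mathbb{D}$ normalized so that $\mathbb{D}$ has measure $1$. For $\alpha>-1$, $\omega_\alpha(z)=(1+\alpha)(1-|z|^2)^\alpha$. $L^\infty(\omega_\alpha)$ is the algebra of essentially bounded measurable functions on $\mathbb{D}$. $L_h^2(\omega_\alpha)$ is the Hilbert space of complex-valued harmonic functions on $\mathbb{D}$ with $\|f\|^2_{L^2(\omega_\alpha)}=\int_{\mathbb{D}}|f|^2\omega_\alpha\,dA<\infty$; its reproducing kernel is $R_z^\alpha(\lambda)=K_z^\alpha(\lambda)+\overline{K_z^\alpha(\lambda)}-1$ with $K_z^\alpha(\lambda)=(1-\overline{z}\lambda)^{-(2+\alpha)}$. For bounded $\varphi$, $T_\varphi f$ is the orthogonal projection of $\varphi f$ from $L^2(\omega_\alpha)$ onto $L_h^2(\omega_\alpha)$, i.e. $T_\varphi f(z)=\int_{\mathbb{D}}f(\lambda)\overline{R_z^\alpha(\lambda)}\varphi(\lambda)\omega_\alpha(\lambda)\,dA(\lambda)$. For a measurable $G\subset\mathbb{D}$, $\chi_G\,dA$ is a reverse Carleson measure for $L_h^2(\omega_\alpha)$ if there is a constant $C>0$ such that $\int_{\mathbb{D}}|f|^2\omega_\alpha\,dA\le C\int_G|f|^2\omega_\alpha\,dA$ for all $f\in L_h^2(\omega_\alpha)$. *)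

theory Defs
  imports "HOL-Analysis.Analysis"
begin

abbreviation unit_disk :: "complex set" where
  "unit_disk \<equiv> ball 0 1"

definition disk_area :: "complex measure" where
  "disk_area = density (lebesgue_on unit_disk) (\<lambda>_. ennreal (1 / pi))"

definition weight :: "real \<Rightarrow> complex \<Rightarrow> real" where
  "weight \<alpha> z = (1 + \<alpha>) * (1 - (cmod z)\<^sup>2) powr \<alpha>"

definition weighted_area :: "real \<Rightarrow> complex measure" where
  "weighted_area \<alpha> = density disk_area (\<lambda>z. ennreal (weight \<alpha> z))"

text \<open>Elements of \<open>L\<^sup>\<infinity>\<close> and \<open>L\<^sup>2\<close> are represented by functions rather than by classes modulo
  null sets; equalities in \<open>L\<^sup>\<infinity>\<close> are therefore stated almost everywhere.\<close>

definition Linf :: "real \<Rightarrow> (complex \<Rightarrow> complex) set" where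
  "Linf \<alpha> = {f. f \<in> borel_measurable (weighted_area \<alpha>) \<and>
                (\<exists>B. AE z in weighted_area \<alpha>. cmod (f z) \<le> B)}"

definition invertible_in_Linf :: "real \<Rightarrow> (complex \<Rightarrow> complex) \<Rightarrow> bool" where
  "invertible_in_Linf \<alpha> f \<longleftrightarrow>
     f \<in> Linf \<alpha> \<and> (\<exists>g\<in>Linf \<alpha>. AE z in weighted_area \<alpha>. f z * g z = 1)"

definition wnorm :: "real \<Rightarrow> (complex \<Rightarrow> complex) \<Rightarrow> real" where
  "wnorm \<alpha> f = sqrt (LINT z|weighted_area \<alpha>. (cmod (f z))\<^sup>2)"

definition winner :: "real \<Rightarrow> (complex \<Rightarrow> complex) \<Rightarrow> (complex \<Rightarrow> complex) \<Rightarrow> complex" where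
  "winner \<alpha> f g = (LINT z|weighted_area \<alpha>. f z * cnj (g z))"

text \<open>Twice continuously real-differentiable with vanishing Laplacian; \<open>fx\<close>, \<open>fy\<close>, \<open>fxx\<close>, \<dots> are the
  partial derivatives with respect to the real and imaginary parts of the variable.\<close>

definition harmonic_on :: "complex set \<Rightarrow> (complex \<Rightarrow> complex) \<Rightarrow> bool" where
  "harmonic_on S f \<longleftrightarrow> open S \<and>
     (\<exists>fx fy fxx fxy fyx fyy.
        (\<forall>z\<in>S. (f has_derivative (\<lambda>h. Re h *\<^sub>R fx z + Im h *\<^sub>R fy z)) (at z) \<and>
               (fx has_derivative (\<lambda>h. Re h *\<^sub>R fxx z + Im h *\<^sub>R fxy z)) (at z) \<and>
               (fy has_derivative (\<lambda>h. Re h *\<^sub>R fyx z + Im h *\<^sub>R fyy z)) (at z)) \<and>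
        continuous_on S fxx \<and> continuous_on S fxy \<and>
        continuous_on S fyx \<and> continuous_on S fyy \<and>
        (\<forall>z\<in>S. fxx z + fyy z = 0))"

text \<open>A function on the disk is extended by \<open>0\<close> to the whole plane, so that elements of
  \<open>L\<^sub>h\<^sup>2(\<omega>\<^sub>\<alpha>)\<close> which agree on the disk are equal.\<close>

definition Lh2 :: "real \<Rightarrow> (complex \<Rightarrow> complex) set" where
  "Lh2 \<alpha> = {f. harmonic_on unit_disk f \<and>
               integrable (weighted_area \<alpha>) (\<lambda>z. (cmod (f z))\<^sup>2) \<and>
               (\<forall>z. z \<notin> unit_disk \<longrightarrow> f z = 0)}"

definition bounded_operator_Lh2 ::
    "real \<Rightarrow> ((complex \<Rightarrow> complex) \<Rightarrow> complex \<Rightarrow> complex) \<Rightarrow> bool" where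
  "bounded_operator_Lh2 \<alpha> T \<longleftrightarrow>
     (\<forall>f\<in>Lh2 \<alpha>. T f \<in> Lh2 \<alpha>) \<and>
     (\<forall>f\<in>Lh2 \<alpha>. \<forall>g\<in>Lh2 \<alpha>. T (\<lambda>z. f z + g z) = (\<lambda>z. T f z + T g z)) \<and>
     (\<forall>c. \<forall>f\<in>Lh2 \<alpha>. T (\<lambda>z. c * f z) = (\<lambda>z. c * T f z)) \<and>
     (\<exists>B. \<forall>f\<in>Lh2 \<alpha>. wnorm \<alpha> (T f) \<le> B * wnorm \<alpha> f)"

definition invertible_on_Lh2 ::
    "real \<Rightarrow> ((complex \<Rightarrow> complex) \<Rightarrow> complex \<Rightarrow> complex) \<Rightarrow> bool" where
  "invertible_on_Lh2 \<alpha> T \<longleftrightarrow>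
     bounded_operator_Lh2 \<alpha> T \<and>
     (\<exists>S. bounded_operator_Lh2 \<alpha> S \<and> (\<forall>f\<in>Lh2 \<alpha>. S (T f) = f \<and> T (S f) = f))"

text \<open>Orthogonal projection of \<open>L\<^sup>2(\<omega>\<^sub>\<alpha>)\<close> onto \<open>L\<^sub>h\<^sup>2(\<omega>\<^sub>\<alpha>)\<close>. For square-integrable \<open>g\<close> the
  description denotes: the subspace is closed, and its elements are continuous, so they are
  determined by their values almost everywhere.\<close>

definition proj_Lh2 :: "real \<Rightarrow> (complex \<Rightarrow> complex) \<Rightarrow> complex \<Rightarrow> complex" where
  "proj_Lh2 \<alpha> g = (THE h. h \<in> Lh2 \<alpha> \<and> (\<forall>k\<in>Lh2 \<alpha>. winner \<alpha> (\<lambda>z. g z - h z) k = 0))"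

definition toeplitz :: "real \<Rightarrow> (complex \<Rightarrow> complex) \<Rightarrow> (complex \<Rightarrow> complex) \<Rightarrow> complex \<Rightarrow> complex" where
  "toeplitz \<alpha> \<phi> f = proj_Lh2 \<alpha> (\<lambda>z. \<phi> z * f z)"

text \<open>For \<open>z, w\<close> in the disk \<open>1 - cnj z * w\<close> has positive real part, so the principal branch is
  the holomorphic one with value \<open>1\<close> at \<open>w = 0\<close>.\<close>

definition bergman_kernel :: "real \<Rightarrow> complex \<Rightarrow> complex \<Rightarrow> complex" where
  "bergman_kernel \<alpha> z w = (1 - cnj z * w) powr (- complex_of_real (2 + \<alpha>))"

definition harmonic_kernel :: "real \<Rightarrow> complex \<Rightarrow> complex \<Rightarrow> complex" where
  "harmonic_kernel \<alpha> z w = bergman_kernel \<alpha> z w + cnj (bergman_kernel \<alpha> z w) - 1"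

definition berezin :: "real \<Rightarrow> (complex \<Rightarrow> complex) \<Rightarrow> complex \<Rightarrow> complex" where
  "berezin \<alpha> \<phi> z =
     (LINT w|weighted_area \<alpha>. \<phi> w * complex_of_real ((cmod (harmonic_kernel \<alpha> z w))\<^sup>2)) /
     complex_of_real ((wnorm \<alpha> (harmonic_kernel \<alpha> z))\<^sup>2)"

definition reverse_carleson :: "real \<Rightarrow> complex set \<Rightarrow> bool" where
  "reverse_carleson \<alpha> G \<longleftrightarrow>
     G \<in> sets (lebesgue_on unit_disk) \<and>
     (\<exists>C>0. \<forall>f\<in>Lh2 \<alpha>. (LINT z|weighted_area \<alpha>. (cmod (f z))\<^sup>2)
                        \<le> C * (LINT z:G|weighted_area \<alpha>. (cmod (f z))\<^sup>2))"

end

theory Submission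
  imports Defs "HOL-Complex_Analysis.Complex_Analysis"
begin

text \<open>The Berezin transform is compared with averages over pseudohyperbolic disks: since the kernel
  of a smaller parameter still has a known norm, most of the mass of \<open>|R\<^sub>z|\<^sup>2\<close> lies in a fixed disk
  about \<open>z\<close>, so a lower bound on the Berezin transform forces \<open>{\<phi> > r}\<close> to have positive density in
  all of these disks. As harmonic functions are not log-subharmonic, the passage from density to a
  reverse Carleson inequality uses compactness: normalised harmonic functions on the disk, given
  by their Taylor coefficients, cannot concentrate away from sets of positive measure, because the
  zero set of a nonzero harmonic function is null. Integrating this local estimate over all
  centres against \<open>dA(a) / (1 - |a|\<^sup>2)\<^sup>2\<close> gives the global one. The Toeplitz operator is inverted by
  minimising a quadratic functional, which also yields the orthogonal projection.\<close>

unbundle no fps_syntax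

section \<open>Lebesgue measure on the complex plane\<close>

text \<open>Compactness yields a constant for one disk, while the estimate is needed uniformly in
  the centre. Pseudohyperbolic disks are Euclidean disks, and on each of fixed radius the weight is
  comparable to its value at the centre; so translations and dilations, which preserve harmonicity
  and scale all masses alike, carry the unweighted estimate for the unit disk to every centre. The
  compactness argument needs control on a larger disk. This costs an error term,
  \<open>1 / M\<close> times the mass of the larger disk, with \<open>M\<close> at choice. After
  averaging over the centres both sides are comparable to the global norm, and \<open>M\<close> is
  chosen so that the error is half of the left side; it is absorbed because the norm is finite.
  Coercivity, the lower bound for the integral of |f|^2 \<phi>, joins the conditions. It is
  equivalent to invertibility of the operator; tested on kernels it bounds the Berezin transform
  below; it follows from the reverse Carleson inequality because \<phi> exceeds r on G. The density
  argument closes the cycle from the Berezin transform to the reverse Carleson inequality.\<close>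

lemma lborel_complex_pair:
  "distr (lborel \<Otimes>\<^sub>M lborel) borel (\<lambda>(x, y). Complex x y) = lborel"
proof (rule lborel_eqI[symmetric])
  have m: "(\<lambda>(x, y). Complex x y) \<in> borel_measurable (lborel \<Otimes>\<^sub>M lborel)"
    unfolding Complex_eq case_prod_beta by measurable
  fix l u :: complex assume le: "\<And>b. b \<in> Basis \<Longrightarrow> l \<bullet> b \<le> u \<bullet> b"
  have "(\<lambda>(x, y). Complex x y) -` box l u = {Re l<..<Re u} \<times> {Im l<..<Im u}"
    by (auto simp: box_def Basis_complex_def)
  then show "emeasure (distr (lborel \<Otimes>\<^sub>M lborel) borel (\<lambda>(x, y). Complex x y)) (box l u) =
      ennreal (\<Prod>b\<in>Basis. (u - l) \<bullet> b)"
    using m le[of 1] le[of \<i>]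
    by (simp add: emeasure_distr space_pair_measure lborel.emeasure_pair_measure_Times
        Basis_complex_def ennreal_mult)
qed simp

text \<open>Links the plane to \<open>real^2\<close>, where orthogonal maps are known to preserve
  the measure of sets.\<close>

lemma lborel_complex_vec:
  "distr lborel borel (\<lambda>v::real^2. Complex (v $ 1) (v $ 2)) = lborel"
proof (rule lborel_eqI[symmetric])
  have m: "(\<lambda>v::real^2. Complex (v $ 1) (v $ 2)) \<in> borel_measurable lborel"
    unfolding Complex_eq by measurable
  fix l u :: complex assume le: "\<And>b. b \<in> Basis \<Longrightarrow> l \<bullet> b \<le> u \<bullet> b"
  have B: "(Basis :: (real^2) set) = {axis 1 1, axis 2 1}"
    by (auto simp: Basis_vec_def UNIV_2)
  have "(\<lambda>v::real^2. Complex (v $ 1) (v $ 2)) -` box l u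
      = box (vector [Re l, Im l]) (vector [Re u, Im u])"
    by (auto simp: box_def Basis_complex_def B inner_axis vector_2)
  then show "emeasure (distr lborel borel (\<lambda>v::real^2. Complex (v $ 1) (v $ 2))) (box l u) =
      ennreal (\<Prod>b\<in>Basis. (u - l) \<bullet> b)"
    using m le[of 1] le[of \<i>]
    by (simp add: emeasure_distr emeasure_lborel_box_eq B inner_axis vector_2
        Basis_complex_def axis_eq_axis)
qed simp

text \<open>A rotation acts on \<open>real^2\<close> as an orthogonal transformation, and those
  preserve Lebesgue measure. It is enough to test boxes, but the preimage of a box is a rotated box,
  so invariance is needed for bounded measurable sets.\<close>

lemma lborel_complex_rotation:
  assumes "cmod e = 1"
  shows "distr lborel borel (\<lambda>z. e * z) = lborel"
proof (rule lborel_eqI[symmetric])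
  define J where "J = (\<lambda>v::real^2. Complex (v $ 1) (v $ 2))"
  define J' where "J' = (\<lambda>z. vector [Re z, Im z] :: real^2)"
  have J: "J (J' z) = z" "J' (J v) = v" for z v
    by (simp_all add: J_def J'_def vector_2 vec_eq_iff forall_2)
  have mJ: "J \<in> borel_measurable borel"
    unfolding J_def Complex_eq by measurable
  have dJ: "distr lborel borel J = lborel"
    using lborel_complex_vec by (simp add: J_def)
  have normJ': "norm (J' z) = cmod z" for z
    by (simp add: J'_def norm_vec_def L2_set_def UNIV_2 vector_2 cmod_def)
  have linJ: "linear J'" "linear J"
    by (auto intro!: linearI simp: J'_def J_def vec_eq_iff forall_2 vector_2 complex_eq_iff)
  have normJ: "cmod (J v) = norm v" for v
    using normJ'[of "J v"] by (simp add: J)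
  \<comment> \<open>\<open>R\<close> is the inverse rotation: its image of a set is the preimage
    under multiplication by \<open>e\<close>, because \<open>e * cnj e = 1\<close>.\<close>
  define R where "R = (\<lambda>v. J' (cnj e * J v))"
  have "linear (\<lambda>z. cnj e * z)" by (auto intro!: linearI simp: algebra_simps)
  then have "linear R"
    unfolding R_def using linear_compose[OF linear_compose[OF linJ(2)] linJ(1)]
    by (simp add: o_def)
  then have R: "orthogonal_transformation R"
    by (simp add: orthogonal_transformation R_def normJ' normJ norm_mult assms)
  have ee: "e * cnj e = 1" "cnj e * e = 1"
    using assms complex_norm_square[of e] by (simp_all add: mult.commute)
  fix l u :: complex assume le: "\<And>b. b \<in> Basis \<Longrightarrow> l \<bullet> b \<le> u \<bullet> b"
  have bd: "bounded (J -` box l u)"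
  proof -
    have "J -` box l u \<subseteq> J' ` box l u"
      using J by (metis vimage_eq image_eqI subsetI)
    moreover have "bounded (J' ` box l u)"
      using linJ(1) by (intro bounded_linear_image bounded_box)
        (simp add: linear_conv_bounded_linear)
    ultimately show ?thesis by (rule bounded_subset[rotated])
  qed
  have mb: "J -` box l u \<in> sets borel"
    using measurable_sets[OF mJ, of "box l u"] by simp
  have S: "J -` box l u \<in> lmeasurable"
    using bd mb by (intro bounded_set_imp_lmeasurable) auto
  have img: "R ` (J -` box l u) = J -` ((\<lambda>z. e * z) -` box l u)"
  proof (intro set_eqI iffI)
    fix v assume "v \<in> R ` (J -` box l u)"
    then show "v \<in> J -` ((\<lambda>z. e * z) -` box l u)"
      using ee by (auto simp: R_def J mult.assoc[symmetric])
  next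
    fix v assume v: "v \<in> J -` ((\<lambda>z. e * z) -` box l u)"
    have "v = R (J' (e * J v))"
      using ee by (simp add: R_def J mult.assoc[symmetric])
    moreover have "J' (e * J v) \<in> J -` box l u" using v by (simp add: J)
    ultimately show "v \<in> R ` (J -` box l u)" by blast
  qed
  have me: "(\<lambda>z::complex. e * z) \<in> borel_measurable borel" by measurable
  have m2: "(\<lambda>z. e * z) -` box l u \<in> sets borel"
    using measurable_sets[OF me, of "box l u"] by simp
  have m3: "J -` ((\<lambda>z. e * z) -` box l u) \<in> sets borel"
    using measurable_sets[OF mJ, of "(\<lambda>z. e * z) -` box l u"] m2 by simp
  have "emeasure (distr lborel borel (\<lambda>z. e * z)) (box l u)
      = emeasure lborel ((\<lambda>z. e * z) -` box l u)"
    by (simp add: emeasure_distr me)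
  also have "\<dots> = emeasure (distr lborel borel J) ((\<lambda>z. e * z) -` box l u)"
    by (simp add: dJ)
  also have "\<dots> = emeasure lborel (R ` (J -` box l u))"
    using m2 mJ by (simp add: emeasure_distr img)
  also have "\<dots> = emeasure lebesgue (R ` (J -` box l u))"
    using m3 img by (simp add: emeasure_completion)
  also have "\<dots> = emeasure lebesgue (J -` box l u)"
    using measure_orthogonal_image[OF R S] measurable_orthogonal_image[OF R S] S
    by (simp add: emeasure_eq_measure2)
  also have "\<dots> = emeasure (distr lborel borel J) (box l u)"
    using mJ mb by (simp add: emeasure_distr emeasure_completion)
  also have "\<dots> = ennreal (\<Prod>b\<in>Basis. (u - l) \<bullet> b)"
    unfolding dJ using le by (simp add: emeasure_lborel_box)
  finally show "emeasure (distr lborel borel (\<lambda>z. e * z)) (box l u) =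
      ennreal (\<Prod>b\<in>Basis. (u - l) \<bullet> b)" .
qed simp

section \<open>The weighted area measure\<close>

lemma weight_pos: "\<alpha> > -1 \<Longrightarrow> cmod z < 1 \<Longrightarrow> weight \<alpha> z > 0"
proof -
  assume "\<alpha> > -1" "cmod z < 1"
  moreover from this have "(cmod z)\<^sup>2 < 1" by (simp add: abs_square_less_1)
  ultimately show ?thesis unfolding weight_def by (intro mult_pos_pos) auto
qed

lemma weight_nonneg: "\<alpha> > -1 \<Longrightarrow> weight \<alpha> z \<ge> 0"
  unfolding weight_def by auto

lemma ball_borel[measurable]: "ball (c::complex) r \<in> sets borel"
  by simp

lemma weight_borel[measurable]: "weight \<alpha> \<in> borel_measurable borel"
  unfolding weight_def[abs_def] by measurable

lemma space_weighted_area[simp]: "space (weighted_area \<alpha>) = unit_disk"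
  by (simp add: weighted_area_def disk_area_def)

lemma sets_weighted_area[simp]: "sets (weighted_area \<alpha>) = sets (lebesgue_on unit_disk)"
  by (simp add: weighted_area_def disk_area_def)

lemma borel_imp_measurable_weighted_area:
  "f \<in> borel_measurable borel \<Longrightarrow> f \<in> borel_measurable (weighted_area \<alpha>)"
proof -
  assume f: "f \<in> borel_measurable borel"
  have "f \<in> borel_measurable (lebesgue_on unit_disk)"
    by (intro measurable_restrict_space1 measurable_completion) (use f in simp)
  then show ?thesis
    by (simp cong: measurable_cong_sets)
qed

lemma ident_measurable_weighted_area:
  "(\<lambda>z. z) \<in> weighted_area \<alpha> \<rightarrow>\<^sub>M borel"
  by (rule borel_imp_measurable_weighted_area) simp

lemma continuous_imp_measurable_weighted_area:
  fixes f :: "complex \<Rightarrow> 'b::topological_space"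
  assumes "continuous_on unit_disk f"
  shows "f \<in> borel_measurable (weighted_area \<alpha>)"
proof -
  have "f \<in> borel_measurable (restrict_space borel unit_disk)"
    using assms by (rule borel_measurable_continuous_on_restrict)
  moreover have "(\<lambda>z. z) \<in> weighted_area \<alpha> \<rightarrow>\<^sub>M restrict_space borel unit_disk"
    by (rule measurable_restrict_space2) (auto simp: ident_measurable_weighted_area)
  ultimately show ?thesis
    using measurable_comp by (fastforce simp: o_def)
qed

text \<open>Working with Lebesgue densities is easiest for Borel functions, for which the completion
  in the definition of the weighted area is immaterial.\<close>

definition wdensity :: "real \<Rightarrow> complex \<Rightarrow> real" where
  "wdensity \<alpha> z = indicator unit_disk z * weight \<alpha> z / pi"

lemma wdensity_borel[measurable]: "wdensity \<alpha> \<in> borel_measurable borel"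
  unfolding wdensity_def[abs_def] by measurable

lemma wdensity_nonneg: "\<alpha> > -1 \<Longrightarrow> wdensity \<alpha> z \<ge> 0"
  by (simp add: wdensity_def weight_nonneg)

lemma nn_integral_weighted_area_lebesgue:
  assumes "\<alpha> > -1" and "F \<in> borel_measurable (lebesgue_on unit_disk)"
  shows "(\<integral>\<^sup>+z. F z \<partial>weighted_area \<alpha>)
    = (\<integral>\<^sup>+z. ennreal (wdensity \<alpha> z) * F z \<partial>lebesgue)"
proof -
  have m: "(\<lambda>z. ennreal (weight \<alpha> z)) \<in> borel_measurable (lebesgue_on unit_disk)"
    by (intro measurable_restrict_space1 measurable_completion) simp
  have "(\<integral>\<^sup>+z. F z \<partial>weighted_area \<alpha>)
      = (\<integral>\<^sup>+z. ennreal (1/pi) * (ennreal (weight \<alpha> z) * F z) \<partial>lebesgue_on unit_disk)"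
    unfolding weighted_area_def disk_area_def using assms m
    by (simp add: nn_integral_density)
  also have "\<dots> = (\<integral>\<^sup>+z. ennreal (wdensity \<alpha> z) * F z \<partial>lebesgue)"
    by (subst nn_integral_restrict_space)
       (auto intro!: nn_integral_cong split: split_indicator
         simp: wdensity_def mult.assoc[symmetric] ennreal_mult'[symmetric])
  finally show ?thesis .
qed

lemma nn_integral_weighted_area:
  assumes "\<alpha> > -1" and F: "F \<in> borel_measurable borel"
  shows "(\<integral>\<^sup>+z. F z \<partial>weighted_area \<alpha>)
    = (\<integral>\<^sup>+z. ennreal (wdensity \<alpha> z) * F z \<partial>lborel)"
proof -
  have "F \<in> borel_measurable (lebesgue_on unit_disk)"
    by (intro measurable_restrict_space1 measurable_completion) (use F in simp)
  then show ?thesis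
    using assms by (simp add: nn_integral_weighted_area_lebesgue nn_integral_completion)
qed

text \<open>Pushing forward along the identity to the Borel sets forgets the completion, so that
  Bochner integrals of Borel functions can be computed with a density of
  \<open>lborel\<close>.\<close>

lemma distr_weighted_area:
  assumes "\<alpha> > -1"
  shows "distr (weighted_area \<alpha>) borel (\<lambda>z. z) = density lborel (\<lambda>z. ennreal (wdensity \<alpha> z))"
proof (rule measure_eqI)
  fix A assume "A \<in> sets (distr (weighted_area \<alpha>) borel (\<lambda>z. z))"
  then have A[measurable]: "A \<in> sets borel" by simp
  have "emeasure (distr (weighted_area \<alpha>) borel (\<lambda>z. z)) A
      = (\<integral>\<^sup>+z. indicator A z \<partial>distr (weighted_area \<alpha>) borel (\<lambda>z. z))"
    by simp
  also have "\<dots> = (\<integral>\<^sup>+z. indicator A z \<partial>weighted_area \<alpha>)"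
    by (subst nn_integral_distr[OF ident_measurable_weighted_area]) auto
  also have "\<dots> = emeasure (density lborel (\<lambda>z. ennreal (wdensity \<alpha> z))) A"
    using assms by (simp add: nn_integral_weighted_area emeasure_density)
  finally show "emeasure (distr (weighted_area \<alpha>) borel (\<lambda>z. z)) A
      = emeasure (density lborel (\<lambda>z. ennreal (wdensity \<alpha> z))) A" .
qed simp

section \<open>Rotation invariance, orthogonality of monomials and radial moments\<close>

lemma rotation_wdensity:
  assumes "\<alpha> > -1" "cmod e = 1"
  shows "distr (density lborel (\<lambda>z. ennreal (wdensity \<alpha> z))) borel (\<lambda>z. e * z)
    = density lborel (\<lambda>z. ennreal (wdensity \<alpha> z))"
proof -
  have "density (distr lborel borel (\<lambda>z. e * z)) (\<lambda>z. ennreal (wdensity \<alpha> z))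
      = distr (density lborel (\<lambda>z. ennreal (wdensity \<alpha> (e * z)))) borel (\<lambda>z. e * z)"
    by (rule density_distr) auto
  moreover have "wdensity \<alpha> (e * z) = wdensity \<alpha> z" for z
    using assms by (simp add: wdensity_def weight_def norm_mult indicator_def)
  ultimately show ?thesis
    by (simp add: lborel_complex_rotation assms)
qed

lemma integral_rotation:
  fixes F :: "complex \<Rightarrow> complex"
  assumes "\<alpha> > -1" "cmod e = 1" and F[measurable]: "F \<in> borel_measurable borel"
  shows "(LINT z|weighted_area \<alpha>. F (e * z)) = (LINT z|weighted_area \<alpha>. F z)"
proof -
  let ?D = "density lborel (\<lambda>z. ennreal (wdensity \<alpha> z))"
  have *: "(LINT z|weighted_area \<alpha>. G z) = (LINT z|?D. G z)"
    if G: "G \<in> borel_measurable borel" for G :: "complex \<Rightarrow> complex"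
    using integral_distr[OF ident_measurable_weighted_area G, of \<alpha>] distr_weighted_area[OF assms(1)]
    by simp
  have "(LINT z|weighted_area \<alpha>. F (e * z)) = (LINT z|?D. F (e * z))"
    by (rule *) measurable
  also have "\<dots> = (LINT z|distr ?D borel (\<lambda>z. e * z). F z)"
    by (rule integral_distr[symmetric]) auto
  also have "\<dots> = (LINT z|weighted_area \<alpha>. F z)"
    using assms by (simp add: rotation_wdensity *)
  finally show ?thesis .
qed

text \<open>Rotation by the angle pi / (m - n) multiplies the integrand by -1 and leaves the
  weighted measure and the ball unchanged, so the integral equals its own negative.\<close>

lemma monomials_orthogonal:
  assumes "\<alpha> > -1" "m \<noteq> n"
  shows "(LINT z|weighted_area \<alpha>. indicator (ball 0 r) z * (z ^ m * cnj z ^ n)) = 0"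
proof -
  define e where "e = cis (pi / (real m - real n))"
  define I where "I = (LINT z|weighted_area \<alpha>. indicator (ball 0 r) z * (z ^ m * cnj z ^ n))"
  have "e ^ m * cnj e ^ n = cis (real m * (pi / (real m - real n)) - real n * (pi / (real m - real n)))"
    by (simp add: e_def cis_cnj Complex.DeMoivre cis_mult)
  also have "real m * (pi / (real m - real n)) - real n * (pi / (real m - real n)) = pi"
    unfolding left_diff_distrib[symmetric] using assms by simp
  finally have e: "e ^ m * cnj e ^ n = - 1" by simp
  have "I = (LINT z|weighted_area \<alpha>. indicator (ball 0 r) (e * z) * ((e * z) ^ m * cnj (e * z) ^ n))"
    unfolding I_def using assms
    by (intro integral_rotation[symmetric] borel_measurable_times borel_measurable_indicator
        borel_measurable_power borel_measurable_continuous_onI continuous_intros) (auto simp: e_def)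
  also have "\<dots> = (LINT z|weighted_area \<alpha>. - (indicator (ball 0 r) z * (z ^ m * cnj z ^ n)))"
  proof (rule Bochner_Integration.integral_cong)
    fix z
    have "(e * z) ^ m * cnj (e * z) ^ n = (e ^ m * cnj e ^ n) * (z ^ m * cnj z ^ n)"
      by (simp add: power_mult_distrib)
    moreover have "indicator (ball 0 r) (e * z) = (indicator (ball 0 r) z :: complex)"
      by (simp add: indicator_def norm_mult e_def)
    ultimately show "indicator (ball 0 r) (e * z) * ((e * z) ^ m * cnj (e * z) ^ n)
        = - (indicator (ball 0 r) z * (z ^ m * cnj z ^ n))" by (simp add: e)
  qed simp
  also have "\<dots> = - I" by (simp add: I_def)
  finally show ?thesis by (simp add: I_def)
qed

text \<open>The part of the disk with |z|^2 > x has area pi (1 - x) for 0 \<le> x < 1, so |z|^2 is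
  uniformly distributed on the unit interval with total mass pi. This takes the place of polar
  coordinates; a measure on the line is determined by its values on the rays \<open>{x<..}\<close>
  if these are finite.\<close>

lemma distr_cmod_square:
  "distr (density lborel (indicator unit_disk)) borel (\<lambda>z::complex. (cmod z)\<^sup>2)
    = density lborel (\<lambda>t. ennreal pi * indicator {0<..<1} t)"
proof (rule measure_eqI_lessThan)
  have ball: "emeasure lborel (ball 0 r :: complex set) = ennreal (pi * r\<^sup>2)" 
    "emeasure lborel (cball 0 r :: complex set) = ennreal (pi * r\<^sup>2)" if "r \<ge> 0" for r
    using that unit_ball_vol_even[of 1] by (auto simp: emeasure_ball emeasure_cball)
  fix x :: real
  have L: "emeasure (distr (density lborel (indicator unit_disk)) borel (\<lambda>z::complex. (cmod z)\<^sup>2)) {x<..}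
      = emeasure lborel (unit_disk \<inter> {z::complex. x < (cmod z)\<^sup>2})"
  proof -
    have "emeasure (distr (density lborel (indicator unit_disk)) borel (\<lambda>z::complex. (cmod z)\<^sup>2)) {x<..}
        = emeasure (density lborel (indicator unit_disk)) {z::complex. x < (cmod z)\<^sup>2}"
      by (subst emeasure_distr) (auto simp: vimage_def)
    also have "\<dots> = emeasure lborel (unit_disk \<inter> {z::complex. x < (cmod z)\<^sup>2})"
      by (subst emeasure_density) (auto simp: indicator_inter_arith[symmetric])
    finally show ?thesis .
  qed
  have R: "emeasure (density lborel (\<lambda>t. ennreal pi * indicator {0<..<1} t)) {x<..}
      = ennreal pi * emeasure lborel ({0<..<1} \<inter> {x<..})"
    by (subst emeasure_density) (auto simp: mult.assoc indicator_inter_arith[symmetric] nn_integral_cmult)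
  have "emeasure lborel (unit_disk \<inter> {z::complex. x < (cmod z)\<^sup>2})
      = ennreal pi * emeasure lborel ({0<..<1} \<inter> {x<..})"
  proof -
    consider "x < 0" | "0 \<le> x" "x < 1" | "1 \<le> x" by linarith
    then show ?thesis
    proof cases
      case 1
      then have "unit_disk \<inter> {z::complex. x < (cmod z)\<^sup>2} = unit_disk"
        by (auto intro: less_le_trans)
      moreover have "{0<..<1} \<inter> {x<..} = {0<..<1}" using 1 by auto
      ultimately show ?thesis by (simp add: ball)
    next
      case 2
      have "unit_disk \<inter> {z::complex. x < (cmod z)\<^sup>2} = unit_disk - cball 0 (sqrt x)"
      proof -
        have "x < (cmod z)\<^sup>2 \<longleftrightarrow> z \<notin> cball 0 (sqrt x)" for z
        proof -
          have "x < (cmod z)\<^sup>2 \<longleftrightarrow> sqrt x < sqrt ((cmod z)\<^sup>2)"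
            by (rule real_sqrt_less_iff[symmetric])
          then show ?thesis by (simp add: not_le)
        qed
        then show ?thesis by blast
      qed
      moreover have "cball 0 (sqrt x) \<subseteq> (unit_disk :: complex set)"
      proof -
        have "sqrt x < 1" using 2 real_sqrt_less_iff[of x 1] by simp
        then show ?thesis by (metis cball_subset_ball_iff dist_self add_0 linorder_not_le)
      qed
      ultimately have "emeasure lborel (unit_disk \<inter> {z::complex. x < (cmod z)\<^sup>2})
          = ennreal (pi * 1\<^sup>2) - ennreal (pi * (sqrt x)\<^sup>2)"
        using 2 by (simp add: emeasure_Diff ball)
      also have "\<dots> = ennreal (pi * (1 - x))"
        using 2 by (simp add: ennreal_minus algebra_simps)
      also have "{0<..<1} \<inter> {x<..} = {x<..<1}" using 2 by auto
      then have "ennreal (pi * (1 - x)) = ennreal pi * emeasure lborel ({0<..<1} \<inter> {x<..})"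
        using 2 by (simp add: ennreal_mult)
      finally show ?thesis .
    next
      case 3
      have "unit_disk \<inter> {z::complex. x < (cmod z)\<^sup>2} = {}"
      proof -
        have "\<not> x < (cmod z)\<^sup>2" if "cmod z < 1" for z
          using that 3 power_le_one[of "cmod z" 2] by simp
        then show ?thesis by auto
      qed
      moreover have "{0<..<1} \<inter> {x<..} = {}" using 3 by auto
      ultimately show ?thesis by simp
    qed
  qed
  with L R show "emeasure (distr (density lborel (indicator unit_disk)) borel (\<lambda>z::complex. (cmod z)\<^sup>2)) {x<..}
      = emeasure (density lborel (\<lambda>t. ennreal pi * indicator {0<..<1} t)) {x<..}" by simp
  have "emeasure lborel (unit_disk \<inter> {z::complex. x < (cmod z)\<^sup>2}) \<le> emeasure lborel (unit_disk :: complex set)"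
    by (intro emeasure_mono) auto
  also have "\<dots> < \<infinity>" using ball(1)[of 1] by simp
  finally show "emeasure (distr (density lborel (indicator unit_disk)) borel (\<lambda>z::complex. (cmod z)\<^sup>2)) {x<..} < \<infinity>"
    using L by simp
qed auto

lemma nn_integral_radial:
  fixes F :: "real \<Rightarrow> ennreal"
  assumes [measurable]: "F \<in> borel_measurable borel"
  shows "(\<integral>\<^sup>+z. indicator unit_disk z * F ((cmod z)\<^sup>2) \<partial>lborel)
    = ennreal pi * (\<integral>\<^sup>+t. indicator {0<..<1} t * F t \<partial>lborel)"
proof -
  have "(\<integral>\<^sup>+z. indicator unit_disk z * F ((cmod z)\<^sup>2) \<partial>lborel)
      = (\<integral>\<^sup>+t. F t \<partial>distr (density lborel (indicator unit_disk)) borel (\<lambda>z::complex. (cmod z)\<^sup>2))"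
    by (simp add: nn_integral_distr nn_integral_density)
  also have "\<dots> = ennreal pi * (\<integral>\<^sup>+t. indicator {0<..<1} t * F t \<partial>lborel)"
    by (simp add: distr_cmod_square nn_integral_density mult.assoc nn_integral_cmult)
  finally show ?thesis .
qed

text \<open>With t = |z|^2 the moment becomes 1 + \<alpha> times the Beta integral of t^n (1 -
  t)^\<alpha>, and the Gamma quotient reduces to a factorial over a Pochhammer symbol.\<close>

lemma nn_integral_moment:
  assumes "\<alpha> > -1"
  shows "(\<integral>\<^sup>+z. ennreal ((cmod z) ^ (2 * n)) \<partial>weighted_area \<alpha>)
    = ennreal (fact n / pochhammer (2 + \<alpha>) n)"
proof -
  \<comment> \<open>The exponents keep the form x - 1 to match the Beta integral with parameters n +
    1 and 1 + \<alpha>.\<close>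
  define G where "G t = (1 + \<alpha>) * (t powr (real n + 1 - 1) * (1 - t) powr (1 + \<alpha> - 1))" for t
  have Gm[measurable]: "G \<in> borel_measurable borel" unfolding G_def[abs_def] by measurable
  have G0: "G t \<ge> 0" for t using assms by (simp add: G_def)
  have B: "(G has_integral (1 + \<alpha>) * Beta (real n + 1) (1 + \<alpha>)) {0..1}"
    unfolding G_def[abs_def]
    by (intro has_integral_mult_right has_integral_Beta_real) (use assms in auto)
  have "(\<integral>\<^sup>+z. ennreal ((cmod z) ^ (2 * n)) \<partial>weighted_area \<alpha>)
      = (\<integral>\<^sup>+z. ennreal (wdensity \<alpha> z) * ennreal ((cmod z) ^ (2 * n)) \<partial>lborel)"
    using assms by (intro nn_integral_weighted_area) auto
  \<comment> \<open>The origin is discarded as a null set because \<open>0 powr 0\<close> is 0 while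
    \<open>0 ^ 0\<close> is 1; for n = 0 the two integrands differ there.\<close>
  also have "\<dots> = (\<integral>\<^sup>+z. ennreal (1/pi) * (indicator (unit_disk - {0}) z * ennreal (G ((cmod z)\<^sup>2))) \<partial>lborel)"
  proof (intro nn_integral_cong_AE AE_I')
    have "ennreal (wdensity \<alpha> z) * ennreal ((cmod z) ^ (2 * n))
        = ennreal (1/pi) * (indicator (unit_disk - {0}) z * ennreal (G ((cmod z)\<^sup>2)))" if "z \<noteq> 0" for z
    proof -
      have "(cmod z)\<^sup>2 powr real n = cmod z ^ (2 * n)"
        using that by (subst powr_realpow) (auto simp: power_mult)
      then show ?thesis
        using that assms by (auto simp: G_def wdensity_def weight_def indicator_def ennreal_mult'[symmetric])
    qed
    then show "{z \<in> space lborel. \<not> ennreal (wdensity \<alpha> z) * ennreal ((cmod z) ^ (2 * n))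
        = ennreal (1/pi) * (indicator (unit_disk - {0}) z * ennreal (G ((cmod z)\<^sup>2)))} \<subseteq> {0}" by auto
  qed (simp add: finite_imp_null_set_lborel)
  also have "\<dots> = (\<integral>\<^sup>+z. ennreal (1/pi) * (indicator unit_disk z * ennreal (G ((cmod z)\<^sup>2))) \<partial>lborel)"
    by (intro nn_integral_cong_AE AE_I'[of "{0}"] finite_imp_null_set_lborel) (auto simp: indicator_def)
  also have "\<dots> = ennreal (1/pi) * (\<integral>\<^sup>+z. indicator unit_disk z * ennreal (G ((cmod z)\<^sup>2)) \<partial>lborel)"
    by (intro nn_integral_cmult) simp
  also have "\<dots> = ennreal (1/pi) * (ennreal pi * (\<integral>\<^sup>+t. indicator {0<..<1} t * ennreal (G t) \<partial>lborel))"
    by (subst nn_integral_radial) auto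
  also have "\<dots> = (\<integral>\<^sup>+t. indicator {0<..<1} t * ennreal (G t) \<partial>lborel)"
    by (simp add: mult.assoc[symmetric] ennreal_mult'[symmetric])
  also have "\<dots> = (\<integral>\<^sup>+t. ennreal (G t) * indicator {0..1} t \<partial>lborel)"
    by (intro nn_integral_cong_AE AE_I'[of "{0,1}"] finite_imp_null_set_lborel) (auto simp: indicator_def)
  also have "\<dots> = (\<integral>\<^sup>+t. ennreal (indicator {0..1} t * G t) \<partial>lborel)"
    by (intro nn_integral_cong) (auto simp: indicator_def)
  also have "\<dots> = ennreal ((1 + \<alpha>) * Beta (real n + 1) (1 + \<alpha>))"
    using nn_integral_has_integral_lebesgue[OF G0 B] by (simp add: nn_integral_completion)
  also have "(1 + \<alpha>) * Beta (real n + 1) (1 + \<alpha>) = fact n / pochhammer (2 + \<alpha>) n"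
  proof -
    have npos: "x \<notin> \<int>\<^sub>\<le>\<^sub>0" if "x > 0" for x :: real
      using that by (auto elim!: nonpos_Ints_cases)
    have "1 + \<alpha> + 1 = 2 + \<alpha>" by simp
    then have "Gamma (2 + \<alpha>) = (1 + \<alpha>) * Gamma (1 + \<alpha>)"
      using Gamma_plus1[OF npos[of "1 + \<alpha>"]] assms by simp
    moreover have "pochhammer (2 + \<alpha>) n = Gamma (2 + \<alpha> + n) / Gamma (2 + \<alpha>)"
      using assms by (intro pochhammer_Gamma npos) auto
    moreover have "Gamma (real n + 1) = fact n" using Gamma_fact[of n, where 'a=real] by (simp add: add_ac)
    moreover have "Gamma (2 + \<alpha>) > 0" using assms by (intro Gamma_real_pos) auto
    moreover have "real n + 1 + (1 + \<alpha>) = 2 + \<alpha> + n" by simp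
    ultimately show ?thesis
      unfolding Beta_def by (simp only:) (simp add: mult_ac)
  qed
  finally show ?thesis .
qed

lemma emeasure_weighted_area: "\<alpha> > -1 \<Longrightarrow> emeasure (weighted_area \<alpha>) unit_disk = 1"
  using nn_integral_moment[of \<alpha> 0] by simp

lemma finite_measure_weighted_area: "\<alpha> > -1 \<Longrightarrow> finite_measure (weighted_area \<alpha>)"
  by (intro finite_measureI) (simp add: emeasure_weighted_area)

section \<open>Reproducing kernels\<close>

lemma integrable_weighted_area_bounded:
  fixes f :: "complex \<Rightarrow> 'b::{banach, second_countable_topology}"
  assumes "\<alpha> > -1" "f \<in> borel_measurable (weighted_area \<alpha>)"
    "\<And>z. z \<in> unit_disk \<Longrightarrow> norm (f z) \<le> B"
  shows "integrable (weighted_area \<alpha>) f"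
proof -
  interpret finite_measure "weighted_area \<alpha>" using assms by (simp add: finite_measure_weighted_area)
  show ?thesis using assms by (intro integrable_const_bound[where B=B]) auto
qed

lemma measurable_cnj[measurable (raw)]:
  "f \<in> borel_measurable M \<Longrightarrow> (\<lambda>x. cnj (f x)) \<in> borel_measurable M"
  by (rule measurable_compose[where g = cnj])
    (auto intro!: borel_measurable_continuous_onI continuous_intros)

lemma integral_const_weighted_area:
  fixes c :: "'b::{banach, second_countable_topology}"
  assumes "\<alpha> > -1"
  shows "(LINT z|weighted_area \<alpha>. c) = c"
  using emeasure_weighted_area[OF assms] by (simp add: measure_def)

text \<open>For \<open>r = 1\<close> these are the squared norms of the monomials; with
  \<open>r < 1\<close> coefficients can be read off from a series that converges absolutely only
  inside the disk.\<close>

definition moment :: "real \<Rightarrow> real \<Rightarrow> nat \<Rightarrow> real" where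
  "moment \<alpha> r n = (LINT z|weighted_area \<alpha>. indicator (ball 0 r) z * cmod z ^ (2 * n))"

lemma integral_monomial:
  assumes "\<alpha> > -1"
  shows "(LINT z|weighted_area \<alpha>. indicator (ball 0 r) z * (z ^ m * cnj z ^ n))
    = (if m = n then complex_of_real (moment \<alpha> r n) else 0)"
proof (cases "m = n")
  case True
  have "(LINT z|weighted_area \<alpha>. indicator (ball 0 r) z * (z ^ n * cnj z ^ n))
      = (LINT z|weighted_area \<alpha>. complex_of_real (indicator (ball 0 r) z * cmod z ^ (2 * n)))"
  proof (rule Bochner_Integration.integral_cong)
    fix z
    have "z ^ n * cnj z ^ n = complex_of_real (cmod z ^ (2 * n))"
      by (simp add: power_mult_distrib[symmetric] complex_norm_square[symmetric] power_mult)
    then show "indicator (ball 0 r) z * (z ^ n * cnj z ^ n)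
        = complex_of_real (indicator (ball 0 r) z * cmod z ^ (2 * n))"
      by (simp add: indicator_def)
  qed simp
  then show ?thesis using True by (simp only: moment_def integral_complex_of_real refl if_True)
qed (simp add: monomials_orthogonal assms)

lemma indicator_ball_measurable:
  "(indicator (ball 0 r) :: complex \<Rightarrow> 'b::{real_normed_algebra_1}) \<in> borel_measurable (weighted_area \<alpha>)"
  by (intro borel_imp_measurable_weighted_area borel_measurable_indicator) simp

lemma power_measurable_weighted_area:
  "(\<lambda>z::complex. z ^ n) \<in> borel_measurable (weighted_area \<alpha>)"
  "(\<lambda>z::complex. cnj z ^ n) \<in> borel_measurable (weighted_area \<alpha>)"
  by (auto intro!: continuous_imp_measurable_weighted_area continuous_intros)

text \<open>On the ball of radius \<open>r\<close> the n-th term is dominated by \<open>B\<close>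
  times the n-th term of the convergent majorant, so sum and integral commute. The kernel uses
  \<open>r = 1\<close>, general harmonic functions use \<open>r < 1\<close>.\<close>

lemma integral_power_series:
  fixes a :: "nat \<Rightarrow> complex"
  assumes "\<alpha> > -1" "0 < r" and a: "summable (\<lambda>n. cmod (a n) * r ^ n)"
    and p[measurable]: "p \<in> borel_measurable (weighted_area \<alpha>)"
    and pB: "\<And>z. z \<in> unit_disk \<Longrightarrow> cmod (p z) \<le> B"
  shows "(\<lambda>n. a n * (LINT z|weighted_area \<alpha>. indicator (ball 0 r) z * (z ^ n * p z)))
    sums (LINT z|weighted_area \<alpha>. indicator (ball 0 r) z * ((\<Sum>n. a n * z ^ n) * p z))"
proof -
  note [measurable] = indicator_ball_measurable power_measurable_weighted_area
  have B0: "B \<ge> 0" using order_trans[OF norm_ge_zero pB[of 0]] by simp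
  define f where "f n z = indicator (ball 0 r) z * (a n * z ^ n * p z)" for n z
  have f[measurable]: "f n \<in> borel_measurable (weighted_area \<alpha>)" for n
    unfolding f_def by measurable
  have bound: "cmod (f n z) \<le> B * (cmod (a n) * r ^ n)" if "z \<in> unit_disk" for n z
  proof -
    have "cmod z ^ n * cmod (p z) \<le> r ^ n * B" if "cmod z < r"
      using that pB[OF \<open>z \<in> unit_disk\<close>] assms by (intro mult_mono power_mono) auto
    then have "cmod (a n) * (cmod z ^ n * cmod (p z)) \<le> cmod (a n) * (r ^ n * B)" if "cmod z < r"
      using that by (intro mult_left_mono) auto
    then show ?thesis
      using B0 assms by (auto simp: f_def norm_mult norm_power indicator_def mult_ac)
  qed
  have int: "integrable (weighted_area \<alpha>) (f n)" for n
    by (rule integrable_weighted_area_bounded[OF assms(1) f bound])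
  have sB: "summable (\<lambda>n. B * (cmod (a n) * r ^ n))" using a by (rule summable_mult)
  have summ: "summable (\<lambda>n. cmod (f n z))" if "z \<in> unit_disk" for z
    using bound[OF that] by (intro summable_comparison_test[OF _ sB]) auto
  have "(\<lambda>n. LINT z|weighted_area \<alpha>. f n z) sums (LINT z|weighted_area \<alpha>. (\<Sum>n. f n z))"
  proof (rule sums_integral[OF int])
    show "AE z in weighted_area \<alpha>. summable (\<lambda>n. cmod (f n z))"
      using summ by (intro AE_I2) simp
    have "(LINT z|weighted_area \<alpha>. cmod (f n z)) \<le> B * (cmod (a n) * r ^ n)" for n
    proof -
      have "(LINT z|weighted_area \<alpha>. cmod (f n z)) \<le> (LINT z|weighted_area \<alpha>. B * (cmod (a n) * r ^ n))"
        using int[of n] bound assms(1)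
        by (intro integral_mono integrable_norm integrable_weighted_area_bounded[where B="B * (cmod (a n) * r ^ n)"])
          (auto intro!: mult_nonneg_nonneg simp: B0 less_imp_le[OF assms(2)])
      then show ?thesis by (simp only: integral_const_weighted_area[OF assms(1)])
    qed
    then show "summable (\<lambda>n. LINT z|weighted_area \<alpha>. cmod (f n z))"
      by (intro summable_comparison_test[OF _ sB]) auto
  qed
  moreover have "(LINT z|weighted_area \<alpha>. f n z)
      = a n * (LINT z|weighted_area \<alpha>. indicator (ball 0 r) z * (z ^ n * p z))" for n
    unfolding f_def by (subst integral_mult_right_zero[symmetric]) (simp add: mult_ac)
  moreover have "(LINT z|weighted_area \<alpha>. (\<Sum>n. f n z))
      = (LINT z|weighted_area \<alpha>. indicator (ball 0 r) z * ((\<Sum>n. a n * z ^ n) * p z))"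
  proof (rule Bochner_Integration.integral_cong)
    fix z assume "z \<in> space (weighted_area \<alpha>)"
    show "(\<Sum>n. f n z) = indicator (ball 0 r) z * ((\<Sum>n. a n * z ^ n) * p z)"
    proof (cases "z \<in> ball 0 r")
      case True
      have "summable (\<lambda>n. a n * z ^ n)"
        using True by (intro summable_norm_cancel[OF summable_comparison_test[OF _ a]])
          (auto simp: norm_mult norm_power intro!: mult_left_mono power_mono)
      then show ?thesis using True by (simp add: f_def suminf_mult2[symmetric])
    qed (simp add: f_def)
  qed simp
  ultimately show ?thesis by simp
qed

lemma power_series_measurable:
  fixes a :: "nat \<Rightarrow> complex"
  shows "(\<lambda>z. \<Sum>n. a n * z ^ n) \<in> borel_measurable (weighted_area \<alpha>)"
  by (intro borel_measurable_suminf borel_measurable_times power_measurable_weighted_area) simp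

text \<open>Orthogonality leaves one term of the series. The factor z^m amounts to pairing with an
  antiholomorphic monomial, where only constants interact; this separates the two halves of a
  harmonic function.\<close>

lemma power_series_coefficient:
  assumes "\<alpha> > -1" "0 < r" and a: "summable (\<lambda>n. cmod (a n) * r ^ n)"
  shows "(LINT z|weighted_area \<alpha>. indicator (ball 0 r) z * ((\<Sum>n. a n * z ^ n) * cnj z ^ m))
      = a m * moment \<alpha> r m"
    and "(LINT z|weighted_area \<alpha>. indicator (ball 0 r) z * ((\<Sum>n. a n * z ^ n) * z ^ m))
      = (if m = 0 then a 0 * moment \<alpha> r 0 else 0)"
proof -
  note T = integral_power_series[OF assms, where B=1]
  have "(\<lambda>n. a n * (LINT z|weighted_area \<alpha>. indicator (ball 0 r) z * (z ^ n * cnj z ^ m)))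
    sums (LINT z|weighted_area \<alpha>. indicator (ball 0 r) z * ((\<Sum>n. a n * z ^ n) * cnj z ^ m))"
    by (rule T) (auto simp: power_measurable_weighted_area norm_power power_le_one)
  moreover have "(\<lambda>n. a n * (LINT z|weighted_area \<alpha>. indicator (ball 0 r) z * (z ^ n * cnj z ^ m)))
    = (\<lambda>n. if n = m then a m * moment \<alpha> r m else 0)"
    by (auto simp: integral_monomial assms)
  ultimately show "(LINT z|weighted_area \<alpha>. indicator (ball 0 r) z * ((\<Sum>n. a n * z ^ n) * cnj z ^ m))
      = a m * moment \<alpha> r m"
    using sums_unique2[OF _ sums_single[of m "\<lambda>_. a m * moment \<alpha> r m"]] by simp
  have "(\<lambda>n. a n * (LINT z|weighted_area \<alpha>. indicator (ball 0 r) z * (z ^ n * z ^ m)))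
    sums (LINT z|weighted_area \<alpha>. indicator (ball 0 r) z * ((\<Sum>n. a n * z ^ n) * z ^ m))"
    by (rule T) (auto simp: power_measurable_weighted_area norm_power power_le_one)
  moreover have "(\<lambda>n. a n * (LINT z|weighted_area \<alpha>. indicator (ball 0 r) z * (z ^ n * z ^ m)))
    = (\<lambda>n. if n = 0 then (if m = 0 then a 0 * moment \<alpha> r 0 else 0) else 0)"
    using integral_monomial[OF assms(1), of r _ 0] by (auto simp: power_add[symmetric])
  ultimately show "(LINT z|weighted_area \<alpha>. indicator (ball 0 r) z * ((\<Sum>n. a n * z ^ n) * z ^ m))
      = (if m = 0 then a 0 * moment \<alpha> r 0 else 0)"
    using sums_unique2[OF _ sums_single[of 0 "\<lambda>_. if m = 0 then a 0 * moment \<alpha> r 0 else 0"]] by simp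
qed

section \<open>The kernels as power series and their norms\<close>

definition bergman_coeff :: "real \<Rightarrow> nat \<Rightarrow> real" where
  "bergman_coeff \<alpha> n = pochhammer (2 + \<alpha>) n / fact n"

lemma bergman_coeff_pos: "\<alpha> > -1 \<Longrightarrow> bergman_coeff \<alpha> n > 0"
  unfolding bergman_coeff_def by (intro divide_pos_pos pochhammer_pos) auto

text \<open>That the kernel coefficients are the reciprocals of the squared norms of the monomials
  is the reason why the series reproduces holomorphic functions.\<close>

lemma moment_1:
  assumes "\<alpha> > -1"
  shows "moment \<alpha> 1 n = 1 / bergman_coeff \<alpha> n"
proof -
  have "moment \<alpha> 1 n = (LINT z|weighted_area \<alpha>. cmod z ^ (2 * n))"
    unfolding moment_def by (rule Bochner_Integration.integral_cong) auto
  also have "\<dots> = enn2real (\<integral>\<^sup>+z. ennreal (cmod z ^ (2 * n)) \<partial>weighted_area \<alpha>)"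
    by (intro integral_eq_nn_integral borel_imp_measurable_weighted_area) auto
  also have "\<dots> = 1 / bergman_coeff \<alpha> n"
    using assms bergman_coeff_pos[OF assms, of n]
    by (simp add: nn_integral_moment bergman_coeff_def enn2real_ennreal zero_le_divide_iff zero_less_divide_iff)
  finally show ?thesis .
qed

text \<open>Binomial series with exponent -(2 + \<alpha>); the sign of the generalised binomial
  coefficient and that of the argument cancel.\<close>

lemma bergman_kernel_sums:
  assumes "cmod (cnj z * w) < 1"
  shows "(\<lambda>n. (bergman_coeff \<alpha> n * cnj z ^ n) * w ^ n) sums bergman_kernel \<alpha> z w"
proof -
  have "(\<lambda>n. (- complex_of_real (2 + \<alpha>) gchoose n) * (- (cnj z * w)) ^ n) sums bergman_kernel \<alpha> z w"
    unfolding bergman_kernel_def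
    using gen_binomial_complex[of "- (cnj z * w)" "- complex_of_real (2 + \<alpha>)"] assms
    by (simp add: norm_mult)
  moreover have "(- complex_of_real (2 + \<alpha>) gchoose n) * (- (cnj z * w)) ^ n
      = (bergman_coeff \<alpha> n * cnj z ^ n) * w ^ n" for n
  proof -
    have "(- complex_of_real (2 + \<alpha>) gchoose n)
        = (-1) ^ n * complex_of_real (bergman_coeff \<alpha> n)"
      by (simp add: gbinomial_pochhammer bergman_coeff_def pochhammer_of_real[symmetric]
          del: of_real_add)
    moreover have "(- (cnj z * w)) ^ n = (-1) ^ n * (cnj z ^ n * w ^ n)"
      by (metis mult_minus1 power_mult_distrib)
    ultimately show ?thesis by (simp add: mult_ac power_mult_distrib[symmetric])
  qed
  ultimately show ?thesis by simp
qed

lemma bergman_kernel_real: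
  assumes "\<bar>t\<bar> < 1"
  shows "(\<lambda>n. bergman_coeff \<alpha> n * t ^ n) sums ((1 - t) powr (- (2 + \<alpha>)))"
proof -
  have "(\<lambda>n. complex_of_real (bergman_coeff \<alpha> n * t ^ n)) sums bergman_kernel \<alpha> 1 (of_real t)"
    using bergman_kernel_sums[of 1 "of_real t" \<alpha>] assms by simp
  also have "bergman_kernel \<alpha> 1 (of_real t) = complex_of_real ((1 - t) powr (- (2 + \<alpha>)))"
    unfolding bergman_kernel_def using assms powr_of_real[of "1 - t" "- (2 + \<alpha>)"] by simp
  finally show ?thesis by (simp only: sums_of_real_iff)
qed

lemma bergman_kernel_diag:
  assumes "cmod z < 1"
  shows "bergman_kernel \<alpha> z z = complex_of_real (1 / (1 - (cmod z)\<^sup>2) powr (2 + \<alpha>))"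
proof -
  have "1 - cnj z * z = complex_of_real (1 - (cmod z)\<^sup>2)"
    using complex_norm_square[of z] by (simp add: mult.commute)
  moreover have "1 - (cmod z)\<^sup>2 \<ge> 0" using assms by (simp add: abs_square_le_1)
  ultimately show ?thesis
    unfolding bergman_kernel_def using powr_of_real[of "1 - (cmod z)\<^sup>2" "- (2 + \<alpha>)"]
    unfolding powr_minus_divide[symmetric] by simp
qed

lemma harmonic_kernel_diag:
  assumes "cmod z < 1"
  shows "harmonic_kernel \<alpha> z z = complex_of_real (2 / (1 - (cmod z)\<^sup>2) powr (2 + \<alpha>) - 1)"
  unfolding harmonic_kernel_def using assms by (simp add: bergman_kernel_diag)

lemma bergman_kernel_facts:
  assumes "\<alpha> > -1" "cmod z < 1"
  defines "a \<equiv> (\<lambda>n. bergman_coeff \<alpha> n * cnj z ^ n)"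
  shows "summable (\<lambda>n. cmod (a n) * 1 ^ n)"
    and "\<And>w. w \<in> unit_disk \<Longrightarrow> bergman_kernel \<alpha> z w = (\<Sum>n. a n * w ^ n)"
    and "bergman_kernel \<alpha> z \<in> borel_measurable (weighted_area \<alpha>)"
    and "\<And>w. w \<in> unit_disk \<Longrightarrow> cmod (bergman_kernel \<alpha> z w) \<le> (1 - cmod z) powr (- (2 + \<alpha>))"
proof -
  \<comment> \<open>As the coefficients \<open>bergman_coeff\<close> are positive, the sum of the
    absolute values is the binomial series at the real point \<open>cmod z\<close>; it bounds the
    kernel on the whole disk.\<close>
  have s: "(\<lambda>n. cmod (a n)) sums ((1 - cmod z) powr (- (2 + \<alpha>)))"
    using bergman_kernel_real[of "cmod z" \<alpha>] assms bergman_coeff_pos[OF assms(1)]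
    by (simp add: a_def norm_mult norm_power less_imp_le)
  then show "summable (\<lambda>n. cmod (a n) * 1 ^ n)" by (simp add: sums_iff)
  have lt: "cmod (cnj z * w) < 1" if "w \<in> unit_disk" for w
    using that assms mult_strict_mono'[of "cmod z" 1 "cmod w" 1] by (simp add: norm_mult)
  show K: "bergman_kernel \<alpha> z w = (\<Sum>n. a n * w ^ n)" if "w \<in> unit_disk" for w
    using bergman_kernel_sums[OF lt[OF that], of \<alpha>] by (simp add: a_def sums_iff)
  show "bergman_kernel \<alpha> z \<in> borel_measurable (weighted_area \<alpha>)"
    using power_series_measurable[of a \<alpha>] K by (subst measurable_cong) auto
  show "cmod (bergman_kernel \<alpha> z w) \<le> (1 - cmod z) powr (- (2 + \<alpha>))" if w: "w \<in> unit_disk" for w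
  proof -
    have le: "cmod (a n * w ^ n) \<le> cmod (a n)" for n
      using w by (auto simp: norm_mult norm_power intro!: mult_left_le power_le_one)
    have "summable (\<lambda>n. cmod (a n * w ^ n))"
      by (rule summable_comparison_test[of _ "\<lambda>n. cmod (a n)"]) (use s le in \<open>auto simp: sums_iff\<close>)
    then have "cmod (\<Sum>n. a n * w ^ n) \<le> (\<Sum>n. cmod (a n))"
      using s le by (intro order_trans[OF summable_norm suminf_le]) (auto simp: sums_iff)
    then show ?thesis using s by (simp add: K[OF w] sums_iff)
  qed
qed

text \<open>These integrals occur in the expansion of |K + cnj K - 1|^2. The first two see only the
  constant term 1 of K, the third is the reproducing property applied to K itself.\<close>

lemma bergman_kernel_integrals:
  assumes "\<alpha> > -1" "cmod z < 1"
  defines "K \<equiv> bergman_kernel \<alpha> z"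
  shows "(LINT w|weighted_area \<alpha>. K w) = 1"
    and "(LINT w|weighted_area \<alpha>. K w * K w) = 1"
    and "(LINT w|weighted_area \<alpha>. K w * cnj (K w)) = bergman_kernel \<alpha> z z"
proof -
  define a where "a n = bergman_coeff \<alpha> n * cnj z ^ n" for n
  note F = bergman_kernel_facts[OF assms(1,2), folded a_def K_def]
  have c: "bergman_coeff \<alpha> n * moment \<alpha> 1 n = 1" for n
    using bergman_coeff_pos[OF assms(1), of n] by (simp add: moment_1 assms)
  have one: "moment \<alpha> 1 0 = 1" using c[of 0] by (simp add: bergman_coeff_def)
  have a0: "a 0 = 1" by (simp add: a_def bergman_coeff_def)
  have E: "(LINT w|weighted_area \<alpha>. indicator (ball 0 1) w * ((\<Sum>n. a n * w ^ n) * p w))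
      = (LINT w|weighted_area \<alpha>. K w * p w)" for p
    by (rule Bochner_Integration.integral_cong) (auto simp: F)
  note C = power_series_coefficient[OF assms(1) zero_less_one F(1), unfolded E]
  show "(LINT w|weighted_area \<alpha>. K w) = 1"
    using C(2)[of 0] by (simp add: one a0)
  have T: "(\<lambda>n. a n * (LINT z|weighted_area \<alpha>. indicator (ball 0 1) z * (z ^ n * p z)))
    sums (LINT z|weighted_area \<alpha>. K z * p z)"
    if "p = K \<or> p = (\<lambda>w. cnj (K w))" for p
    unfolding E[symmetric]
    using that F(3,4) by (intro integral_power_series[OF assms(1) zero_less_one F(1)]) (auto intro: measurable_cnj)
  have E2: "(LINT w|weighted_area \<alpha>. indicator (ball 0 1) w * (w ^ n * p w))
      = (LINT w|weighted_area \<alpha>. p w * w ^ n)" for p n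
    by (rule Bochner_Integration.integral_cong) auto
  have "(\<lambda>n. a n * (LINT z|weighted_area \<alpha>. indicator (ball 0 1) z * (z ^ n * K z)))
      = (\<lambda>n. if n = 0 then 1 else 0)"
    using C(2) by (auto simp: E2 one a0)
  then show "(LINT w|weighted_area \<alpha>. K w * K w) = 1"
    using sums_unique2[OF T[of K] ] sums_single[of 0 "\<lambda>_. 1::complex"] by simp
  have "(LINT w|weighted_area \<alpha>. cnj (K w) * w ^ n) = z ^ n" for n
  proof -
    have "(LINT w|weighted_area \<alpha>. cnj (K w) * w ^ n)
        = cnj (LINT w|weighted_area \<alpha>. K w * cnj w ^ n)"
      by (simp add: Bochner_Integration.integral_cnj[symmetric])
    also have "\<dots> = z ^ n"
      using c[of n] unfolding C(1) a_def
      by (simp add: mult.commute mult.left_commute of_real_mult[symmetric] del: of_real_mult)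
    finally show ?thesis .
  qed
  then have "(\<lambda>n. a n * (LINT z|weighted_area \<alpha>. indicator (ball 0 1) z * (z ^ n * cnj (K z))))
      = (\<lambda>n. a n * z ^ n)" by (simp add: E2)
  then have "(\<lambda>n. a n * z ^ n) sums (LINT w|weighted_area \<alpha>. K w * cnj (K w))"
    using T[of "\<lambda>w. cnj (K w)"] by simp
  moreover have "(\<lambda>n. a n * z ^ n) sums bergman_kernel \<alpha> z z"
    unfolding a_def using assms mult_strict_mono'[of "cmod z" 1 "cmod z" 1]
    by (intro bergman_kernel_sums) (simp add: norm_mult)
  ultimately show "(LINT w|weighted_area \<alpha>. K w * cnj (K w)) = bergman_kernel \<alpha> z z"
    by (rule sums_unique2)
qed

lemma integral_bergman_kernel_square:
  assumes "\<alpha> > -1" "cmod z < 1"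
  shows "(LINT w|weighted_area \<alpha>. (cmod (bergman_kernel \<alpha> z w))\<^sup>2)
      = 1 / (1 - (cmod z)\<^sup>2) powr (2 + \<alpha>)"
proof -
  have "complex_of_real (LINT w|weighted_area \<alpha>. (cmod (bergman_kernel \<alpha> z w))\<^sup>2)
      = (LINT w|weighted_area \<alpha>. complex_of_real ((cmod (bergman_kernel \<alpha> z w))\<^sup>2))"
    by (rule integral_complex_of_real[symmetric])
  also have "\<dots> = bergman_kernel \<alpha> z z"
    using bergman_kernel_integrals(3)[OF assms] by (simp only: complex_norm_square)
  finally show ?thesis using assms by (simp only: bergman_kernel_diag of_real_eq_iff)
qed

lemma wnorm_square: "(wnorm \<alpha> f)\<^sup>2 = (LINT z|weighted_area \<alpha>. (cmod (f z))\<^sup>2)"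
  unfolding wnorm_def by (simp add: integral_nonneg_AE)

text \<open>In the expansion of |K + cnj K - 1|^2 the mixed term gives twice the diagonal value of
  the Bergman kernel, and the remaining integrals contribute 1 + 1 - 2 - 2 + 1 = -1.\<close>

lemma wnorm_harmonic_kernel:
  assumes "\<alpha> > -1" "cmod z < 1"
  shows "complex_of_real ((wnorm \<alpha> (harmonic_kernel \<alpha> z))\<^sup>2) = harmonic_kernel \<alpha> z z"
proof -
  define K where "K = bergman_kernel \<alpha> z"
  note F = bergman_kernel_facts[OF assms, folded K_def]
  note I = bergman_kernel_integrals[OF assms, folded K_def]
  let ?N = "weighted_area \<alpha>"
  define B where "B = (1 - cmod z) powr (- (2 + \<alpha>))"
  have FB: "w \<in> unit_disk \<Longrightarrow> cmod (K w) \<le> B" for w using F(4) by (simp add: B_def)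
  have FBB: "w \<in> unit_disk \<Longrightarrow> cmod (K w) * cmod (K w) \<le> B * B" for w
    using FB[of w] by (intro mult_mono) (auto intro: order_trans[OF norm_ge_zero])
  note [measurable] = F(3)
  have i: "integrable ?N K" "integrable ?N (\<lambda>w. cnj (K w))"
    by (rule integrable_weighted_area_bounded[OF assms(1), where B=B]; (measurable)?; use FB in simp)+
  have ii: "integrable ?N (\<lambda>w. K w * K w)" "integrable ?N (\<lambda>w. K w * cnj (K w))"
    "integrable ?N (\<lambda>w. cnj (K w * K w))"
    by (rule integrable_weighted_area_bounded[OF assms(1), where B="B*B"];
        (measurable)?; use FBB in \<open>simp add: norm_mult\<close>)+
  have iii: "integrable ?N (\<lambda>w. 1::complex)"
    by (rule integrable_weighted_area_bounded[OF assms(1), where B=1]) auto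
  have "complex_of_real ((wnorm \<alpha> (harmonic_kernel \<alpha> z))\<^sup>2)
      = (LINT w|?N. complex_of_real ((cmod (harmonic_kernel \<alpha> z w))\<^sup>2))"
    unfolding wnorm_square by (rule integral_complex_of_real[symmetric])
  also have "\<dots> = (LINT w|?N. K w * K w + cnj (K w * K w) + 2 * (K w * cnj (K w)) - 2 * K w - 2 * cnj (K w) + 1)"
    unfolding complex_norm_square harmonic_kernel_def K_def[symmetric]
    by (simp add: algebra_simps)
  also have "\<dots> = 1 + cnj 1 + 2 * bergman_kernel \<alpha> z z - 2 * 1 - 2 * cnj 1 + 1"
    using i ii iii
    by (simp add: I integral_const_weighted_area[OF assms(1)] integral_cnj[symmetric]
        emeasure_weighted_area[OF assms(1)] measure_def
        del: complex_cnj_mult) (simp add: K_def)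
  also have "\<dots> = harmonic_kernel \<alpha> z z"
    using assms by (simp add: harmonic_kernel_def bergman_kernel_diag)
  finally show ?thesis .
qed

section \<open>Harmonic functions\<close>

text \<open>Both mixed partial derivatives are limits of the same second difference quotient.\<close>

lemma mixed_partials_real:
  fixes u ux uy uxy uyx :: "real \<Rightarrow> real \<Rightarrow> real"
  assumes e: "e > 0"
    and ux: "\<And>x y. \<bar>x - a\<bar> < e \<Longrightarrow> \<bar>y - b\<bar> < e \<Longrightarrow> ((\<lambda>s. u s y) has_real_derivative ux x y) (at x)"
    and uy: "\<And>x y. \<bar>x - a\<bar> < e \<Longrightarrow> \<bar>y - b\<bar> < e \<Longrightarrow> ((\<lambda>t. u x t) has_real_derivative uy x y) (at y)"
    and uxy: "\<And>x y. \<bar>x - a\<bar> < e \<Longrightarrow> \<bar>y - b\<bar> < e \<Longrightarrow> ((\<lambda>t. ux x t) has_real_derivative uxy x y) (at y)"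
    and uyx: "\<And>x y. \<bar>x - a\<bar> < e \<Longrightarrow> \<bar>y - b\<bar> < e \<Longrightarrow> ((\<lambda>s. uy s y) has_real_derivative uyx x y) (at x)"
    and c1: "\<And>\<epsilon>. \<epsilon> > 0 \<Longrightarrow> \<exists>d>0. \<forall>x y. \<bar>x - a\<bar> < d \<longrightarrow> \<bar>y - b\<bar> < d \<longrightarrow> \<bar>uxy x y - uxy a b\<bar> < \<epsilon>"
    and c2: "\<And>\<epsilon>. \<epsilon> > 0 \<Longrightarrow> \<exists>d>0. \<forall>x y. \<bar>x - a\<bar> < d \<longrightarrow> \<bar>y - b\<bar> < d \<longrightarrow> \<bar>uyx x y - uyx a b\<bar> < \<epsilon>"
  shows "uxy a b = uyx a b"
proof (rule ccontr)
  assume ne: "uxy a b \<noteq> uyx a b"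
  define \<epsilon> where "\<epsilon> = \<bar>uxy a b - uyx a b\<bar> / 2"
  have "\<epsilon> > 0" using ne by (simp add: \<epsilon>_def)
  obtain d1 where d1: "d1 > 0" "\<And>x y. \<bar>x - a\<bar> < d1 \<Longrightarrow> \<bar>y - b\<bar> < d1 \<Longrightarrow> \<bar>uxy x y - uxy a b\<bar> < \<epsilon>"
    using c1[OF \<open>\<epsilon> > 0\<close>] by blast
  obtain d2 where d2: "d2 > 0" "\<And>x y. \<bar>x - a\<bar> < d2 \<Longrightarrow> \<bar>y - b\<bar> < d2 \<Longrightarrow> \<bar>uyx x y - uyx a b\<bar> < \<epsilon>"
    using c2[OF \<open>\<epsilon> > 0\<close>] by blast
  define h where "h = min e (min d1 d2) / 2"
  have h: "h > 0" "h < e" "h < d1" "h < d2" using e d1 d2 by (auto simp: h_def min_def)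
  have "\<exists>x>a. x < a + h \<and> (u (a + h) (b + h) - u (a + h) b) - (u a (b + h) - u a b)
      = (a + h - a) * (ux x (b + h) - ux x b)"
    using h by (intro MVT2 DERIV_diff ux) auto
  then obtain x where x: "a < x" "x < a + h"
    "(u (a + h) (b + h) - u (a + h) b) - (u a (b + h) - u a b) = h * (ux x (b + h) - ux x b)" by auto
  have "\<exists>y>b. y < b + h \<and> ux x (b + h) - ux x b = (b + h - b) * uxy x y"
    using h x by (intro MVT2 uxy) auto
  then obtain y where y: "b < y" "y < b + h" "ux x (b + h) - ux x b = h * uxy x y" by auto
  have "\<exists>y>b. y < b + h \<and> (u (a + h) (b + h) - u a (b + h)) - (u (a + h) b - u a b)
      = (b + h - b) * (uy (a + h) y - uy a y)"
    using h by (intro MVT2 DERIV_diff uy) auto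
  then obtain y' where y': "b < y'" "y' < b + h"
    "(u (a + h) (b + h) - u a (b + h)) - (u (a + h) b - u a b) = h * (uy (a + h) y' - uy a y')" by auto
  have "\<exists>x>a. x < a + h \<and> uy (a + h) y' - uy a y' = (a + h - a) * uyx x y'"
    using h y' by (intro MVT2 uyx) auto
  then obtain x' where x': "a < x'" "x' < a + h" "uy (a + h) y' - uy a y' = h * uyx x' y'" by auto
  have "h * (h * uxy x y) = h * (h * uyx x' y')"
    using x(3) y(3) y'(3) x'(3) by (simp add: algebra_simps)
  then have "uxy x y = uyx x' y'" using h by simp
  moreover have "\<bar>uxy x y - uxy a b\<bar> < \<epsilon>"
    by (rule d1(2)) (use x y h in \<open>simp_all add: abs_less_iff\<close>)
  moreover have "\<bar>uyx x' y' - uyx a b\<bar> < \<epsilon>"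
    by (rule d2(2)) (use x' y' h in \<open>simp_all add: abs_less_iff\<close>)
  ultimately have "\<bar>uxy a b - uyx a b\<bar> < 2 * \<epsilon>"
    unfolding abs_less_iff by linarith
  then show False by (simp add: \<epsilon>_def)
qed

lemma has_derivative_horizontal_line:
  assumes "(f has_derivative (\<lambda>h. Re h *\<^sub>R p + Im h *\<^sub>R q)) (at (Complex x y))"
  shows "((\<lambda>s. f (Complex s y)) has_vector_derivative p) (at x)"
    and "((\<lambda>t. f (Complex x t)) has_vector_derivative q) (at y)"
proof -
  have "((\<lambda>s. Complex s y) has_derivative (\<lambda>h. complex_of_real h)) (at x)"
    unfolding Complex_eq by (auto intro!: derivative_eq_intros)
  then have "((\<lambda>s. f (Complex s y)) has_derivative
      (\<lambda>s. Re (complex_of_real s) *\<^sub>R p + Im (complex_of_real s) *\<^sub>R q)) (at x)"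
    by (rule has_derivative_compose) (rule assms)
  then show "((\<lambda>s. f (Complex s y)) has_vector_derivative p) (at x)"
    by (simp add: has_vector_derivative_def)
  have "((\<lambda>t. Complex x t) has_derivative (\<lambda>h. \<i> * complex_of_real h)) (at y)"
    unfolding Complex_eq by (auto intro!: derivative_eq_intros)
  then have "((\<lambda>t. f (Complex x t)) has_derivative
      (\<lambda>s. Re (\<i> * complex_of_real s) *\<^sub>R p + Im (\<i> * complex_of_real s) *\<^sub>R q)) (at y)"
    by (rule has_derivative_compose) (rule assms)
  then show "((\<lambda>t. f (Complex x t)) has_vector_derivative q) (at y)"
    by (simp add: has_vector_derivative_def)
qed

text \<open>The mean value theorem behind the real version is about real functions, so the identity
  is proved after composition with a bounded linear functional and then used for \<open>Re\<close>
  and \<open>Im\<close>.\<close>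

lemma mixed_partials_complex:
  fixes f fx fy fxx fxy fyx fyy :: "complex \<Rightarrow> complex"
  assumes S: "open S" "z \<in> S"
    and d: "\<And>z. z \<in> S \<Longrightarrow> (f has_derivative (\<lambda>h. Re h *\<^sub>R fx z + Im h *\<^sub>R fy z)) (at z)"
      "\<And>z. z \<in> S \<Longrightarrow> (fx has_derivative (\<lambda>h. Re h *\<^sub>R fxx z + Im h *\<^sub>R fxy z)) (at z)"
      "\<And>z. z \<in> S \<Longrightarrow> (fy has_derivative (\<lambda>h. Re h *\<^sub>R fyx z + Im h *\<^sub>R fyy z)) (at z)"
    and c: "continuous_on S fxy" "continuous_on S fyx"
  shows "fxy z = fyx z"
proof -
  obtain r where r: "r > 0" "ball z r \<subseteq> S" using S openE by blast
  have inb: "Complex x y \<in> ball z d" if "\<bar>x - Re z\<bar> < d / 2" "\<bar>y - Im z\<bar> < d / 2" for x y d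
  proof -
    have "cmod (Complex x y - z) \<le> \<bar>x - Re z\<bar> + \<bar>y - Im z\<bar>"
      using cmod_le[of "Complex x y - z"] by simp
    then show ?thesis using that by (simp add: dist_norm norm_minus_commute[of z])
  qed
  have inS: "Complex x y \<in> S" if "\<bar>x - Re z\<bar> < r / 2" "\<bar>y - Im z\<bar> < r / 2" for x y
    using inb[OF that] r by blast
  have "L (fxy z) = L (fyx z)" if "bounded_linear L" for L :: "complex \<Rightarrow> real"
  proof -
    have D: "((\<lambda>s. L (g s)) has_real_derivative L g') (at t)"
      if "(g has_vector_derivative g') (at t)" for g g' t
      using bounded_linear.has_vector_derivative[OF \<open>bounded_linear L\<close> that]
      by (simp add: has_real_derivative_iff_has_vector_derivative)
    have C: "\<exists>d>0. \<forall>x y. \<bar>x - Re z\<bar> < d \<longrightarrow> \<bar>y - Im z\<bar> < d \<longrightarrow> \<bar>L (g (Complex x y)) - L (g (Complex (Re z) (Im z)))\<bar> < \<epsilon>"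
      if "continuous_on S g" "\<epsilon> > 0" for g \<epsilon>
    proof -
      have "isCont g z" using that(1) S by (simp add: continuous_on_eq_continuous_at)
      then have "isCont (\<lambda>w. L (g w)) z" by (rule bounded_linear.isCont[OF \<open>bounded_linear L\<close>])
      then obtain d where d: "d > 0" "\<And>w. dist w z < d \<Longrightarrow> dist (L (g w)) (L (g z)) < \<epsilon>"
        using \<open>\<epsilon> > 0\<close> by (metis continuous_at_eps_delta)
      show ?thesis
        using d(1) d(2)[OF inb[of _ d, unfolded mem_ball dist_commute[of z]]]
        by (intro exI[of _ "d / 2"]) (auto simp: dist_real_def)
    qed
    have "L (fxy (Complex (Re z) (Im z))) = L (fyx (Complex (Re z) (Im z)))"
      by (rule mixed_partials_real[of "r / 2" "Re z" "Im z" "\<lambda>x y. L (f (Complex x y))"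
            "\<lambda>x y. L (fx (Complex x y))" "\<lambda>x y. L (fy (Complex x y))"
            "\<lambda>x y. L (fxy (Complex x y))" "\<lambda>x y. L (fyx (Complex x y))"])
        (use r C[OF c(1)] C[OF c(2)] in \<open>auto intro!: D has_derivative_horizontal_line d inS\<close>)
    then show ?thesis by simp
  qed
  from this[OF bounded_linear_Re] this[OF bounded_linear_Im] show ?thesis
    by (simp add: complex_eq_iff)
qed

text \<open>\<open>p\<close> and \<open>q\<close> are twice the Wirtinger z-derivatives of f and of
  its conjugate. Vanishing Laplacian and equal mixed partials make them holomorphic; convexity gives
  primitives \<open>P\<close> and \<open>Q\<close>, and 2 f - P - cnj Q has zero differential, hence
  is constant.\<close>

lemma harmonic_on_imp_holomorphic_parts:
  assumes f: "harmonic_on S f" and S: "convex S"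
  obtains g h where "g holomorphic_on S" "h holomorphic_on S"
    "\<And>z. z \<in> S \<Longrightarrow> f z = g z + cnj (h z)"
proof -
  obtain fx fy fxx fxy fyx fyy where "open S"
    and d: "\<And>z. z \<in> S \<Longrightarrow> (f has_derivative (\<lambda>h. Re h *\<^sub>R fx z + Im h *\<^sub>R fy z)) (at z)"
      "\<And>z. z \<in> S \<Longrightarrow> (fx has_derivative (\<lambda>h. Re h *\<^sub>R fxx z + Im h *\<^sub>R fxy z)) (at z)"
      "\<And>z. z \<in> S \<Longrightarrow> (fy has_derivative (\<lambda>h. Re h *\<^sub>R fyx z + Im h *\<^sub>R fyy z)) (at z)"
    and c: "continuous_on S fxy" "continuous_on S fyx"
    and lap: "\<And>z. z \<in> S \<Longrightarrow> fxx z + fyy z = 0"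
    using f unfolding harmonic_on_def by blast
  have sym: "fxy z = fyx z" if "z \<in> S" for z
    by (rule mixed_partials_complex[OF \<open>open S\<close> that d c])
  define p where "p z = fx z - \<i> * fy z" for z
  define q where "q z = cnj (fx z + \<i> * fy z)" for z
  have p: "(p has_field_derivative fxx z - \<i> * fyx z) (at z)" if "z \<in> S" for z
  proof -
    have "fyy z = - fxx z" using lap[OF that] by (simp add: add_eq_0_iff)
    have "(p has_derivative (\<lambda>h. (Re h *\<^sub>R fxx z + Im h *\<^sub>R fxy z) - \<i> * (Re h *\<^sub>R fyx z + Im h *\<^sub>R fyy z))) (at z)"
      unfolding p_def by (intro has_derivative_diff has_derivative_mult_right d that)
    also have "(\<lambda>h. (Re h *\<^sub>R fxx z + Im h *\<^sub>R fxy z) - \<i> * (Re h *\<^sub>R fyx z + Im h *\<^sub>R fyy z))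
        = (*) ((fxx z - \<i> * fyx z))"
      by (auto simp: fun_eq_iff complex_eq_iff sym[OF that] \<open>fyy z = - fxx z\<close> algebra_simps)
    finally show ?thesis by (simp only: has_field_derivative_def)
  qed
  have q: "(q has_field_derivative cnj (fxx z + \<i> * fyx z)) (at z)" if "z \<in> S" for z
  proof -
    have "fyy z = - fxx z" using lap[OF that] by (simp add: add_eq_0_iff)
    have "(q has_derivative (\<lambda>h. cnj ((Re h *\<^sub>R fxx z + Im h *\<^sub>R fxy z) + \<i> * (Re h *\<^sub>R fyx z + Im h *\<^sub>R fyy z)))) (at z)"
      unfolding q_def by (intro has_derivative_cnj has_derivative_add has_derivative_mult_right d that)
    also have "(\<lambda>h. cnj ((Re h *\<^sub>R fxx z + Im h *\<^sub>R fxy z) + \<i> * (Re h *\<^sub>R fyx z + Im h *\<^sub>R fyy z)))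
        = (*) (cnj (fxx z + \<i> * fyx z))"
      by (auto simp: fun_eq_iff complex_eq_iff sym[OF that] \<open>fyy z = - fxx z\<close> algebra_simps)
    finally show ?thesis by (simp only: has_field_derivative_def)
  qed
  have "p holomorphic_on S" "q holomorphic_on S"
    using p q \<open>open S\<close> by (auto simp: holomorphic_on_open)
  then obtain P Q where P: "\<And>z. z \<in> S \<Longrightarrow> (P has_field_derivative p z) (at z)"
    and Q: "\<And>z. z \<in> S \<Longrightarrow> (Q has_field_derivative q z) (at z)"
    using holomorphic_convex_primitive'[OF S \<open>open S\<close>] \<open>open S\<close> at_within_open by metis
  define k where "k z = 2 * f z - (P z + cnj (Q z))" for z
  have k0: "(k has_derivative (\<lambda>h. 0)) (at z within S)" if "z \<in> S" for z
  proof -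
    have "(k has_derivative (\<lambda>h. 2 * (Re h *\<^sub>R fx z + Im h *\<^sub>R fy z) - (p z * h + cnj (q z * h)))) (at z)"
      unfolding k_def using P[OF that] Q[OF that]
      by (intro has_derivative_diff has_derivative_add has_derivative_mult_right has_derivative_cnj d that)
        (simp_all add: has_field_derivative_def)
    also have "(\<lambda>h. 2 * (Re h *\<^sub>R fx z + Im h *\<^sub>R fy z) - (p z * h + cnj (q z * h))) = (\<lambda>h. 0)"
      by (auto simp: fun_eq_iff complex_eq_iff p_def q_def algebra_simps)
    finally show ?thesis by (rule has_derivative_at_withinI)
  qed
  obtain C where C: "\<And>z. z \<in> S \<Longrightarrow> k z = C"
    using has_derivative_zero_constant[OF S k0] by blast
  show thesis
  proof
    show "(\<lambda>z. (P z + C) / 2) holomorphic_on S" "(\<lambda>z. Q z / 2) holomorphic_on S"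
    proof -
      have "P holomorphic_on S" "Q holomorphic_on S"
        using P Q \<open>open S\<close> by (auto simp: holomorphic_on_open)
      then show "(\<lambda>z. (P z + C) / 2) holomorphic_on S" "(\<lambda>z. Q z / 2) holomorphic_on S"
        by (auto intro!: holomorphic_intros)
    qed
    show "f z = (P z + C) / 2 + cnj (Q z / 2)" if "z \<in> S" for z
    proof -
      have "2 * f z = P z + C + cnj (Q z)" using C[OF that] by (simp add: k_def algebra_simps)
      then show ?thesis by (simp add: add_divide_distrib[symmetric] mult.commute)
    qed
  qed
qed

text \<open>The differential of G + cnj H is k -> A k + cnj (B k); its values at 1 and at \<i> are
  the two partials. This is applied to f and to both first partials, and the Laplacian vanishes
  because \<i> squared is -1.\<close>

lemma harmonic_on_holomorphic_parts:
  assumes "open S" "g holomorphic_on S" "h holomorphic_on S"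
    and f: "\<And>z. z \<in> S \<Longrightarrow> f z = g z + cnj (h z)"
  shows "harmonic_on S f"
proof -
  have D: "(u has_derivative (\<lambda>k. Re k *\<^sub>R (A + cnj B) + Im k *\<^sub>R (\<i> * A + cnj (\<i> * B)))) (at z)"
    if "z \<in> S" "\<And>w. w \<in> S \<Longrightarrow> u w = G w + cnj (H w)"
      "(G has_field_derivative A) (at z)" "(H has_field_derivative B) (at z)" for u G H A B z
  proof -
    have "((\<lambda>w. G w + cnj (H w)) has_derivative (\<lambda>k. A * k + cnj (B * k))) (at z)"
      using that by (intro derivative_intros has_derivative_cnj) (auto simp: has_field_derivative_def)
    also have "(\<lambda>k. A * k + cnj (B * k)) = (\<lambda>k. Re k *\<^sub>R (A + cnj B) + Im k *\<^sub>R (\<i> * A + cnj (\<i> * B)))"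
      by (auto simp: fun_eq_iff complex_eq_iff algebra_simps)
    finally show ?thesis
      using that assms(1) by (auto intro: has_derivative_transform_within_open[where s=S])
  qed
  have g: "(g has_field_derivative deriv g z) (at z)" "(deriv g has_field_derivative deriv (deriv g) z) (at z)"
    "(h has_field_derivative deriv h z) (at z)" "(deriv h has_field_derivative deriv (deriv h) z) (at z)"
    if "z \<in> S" for z
    using that assms by (auto intro!: holomorphic_derivI[where S=S] holomorphic_deriv)
  have i: "((\<lambda>z. \<i> * deriv g z) has_field_derivative \<i> * deriv (deriv g) z) (at z)"
    "((\<lambda>z. \<i> * deriv h z) has_field_derivative \<i> * deriv (deriv h) z) (at z)" if "z \<in> S" for z
    using g[OF that] by (auto intro!: derivative_eq_intros)
  have c: "continuous_on S (deriv (deriv g))" "continuous_on S (deriv (deriv h))"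
    using assms by (auto intro!: holomorphic_on_imp_continuous_on holomorphic_deriv)
  let ?g = "deriv (deriv g)" and ?h = "deriv (deriv h)"
  show ?thesis unfolding harmonic_on_def
  proof (intro conjI exI ballI \<open>open S\<close>)
    fix z assume "z \<in> S"
    show "(f has_derivative (\<lambda>k. Re k *\<^sub>R (deriv g z + cnj (deriv h z)) + Im k *\<^sub>R (\<i> * deriv g z + cnj (\<i> * deriv h z)))) (at z)"
      by (rule D[OF \<open>z \<in> S\<close> f]) (use g \<open>z \<in> S\<close> in auto)
    show "((\<lambda>z. deriv g z + cnj (deriv h z)) has_derivative (\<lambda>k. Re k *\<^sub>R (?g z + cnj (?h z)) + Im k *\<^sub>R (\<i> * ?g z + cnj (\<i> * ?h z)))) (at z)"
      by (rule D[OF \<open>z \<in> S\<close> refl]) (use g \<open>z \<in> S\<close> in auto)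
    show "((\<lambda>z. \<i> * deriv g z + cnj (\<i> * deriv h z)) has_derivative
        (\<lambda>k. Re k *\<^sub>R (\<i> * ?g z + cnj (\<i> * ?h z)) + Im k *\<^sub>R (\<i> * (\<i> * ?g z) + cnj (\<i> * (\<i> * ?h z))))) (at z)"
      by (rule D[OF \<open>z \<in> S\<close> refl]) (use i \<open>z \<in> S\<close> in auto)
    show "(?g z + cnj (?h z)) + (\<i> * (\<i> * ?g z) + cnj (\<i> * (\<i> * ?h z))) = 0"
      by (simp flip: mult.assoc)
  qed (intro continuous_intros c)+
qed

lemma harmonic_on_continuous:
  assumes "harmonic_on S f"
  shows "continuous_on S f"
proof -
  obtain fx fy where "\<And>z. z \<in> S \<Longrightarrow> (f has_derivative (\<lambda>h. Re h *\<^sub>R fx z + Im h *\<^sub>R fy z)) (at z)"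
    using assms unfolding harmonic_on_def by blast
  then show ?thesis
    by (intro continuous_at_imp_continuous_on ballI) (rule has_derivative_continuous)
qed

lemma harmonic_on_power_series:
  assumes "harmonic_on unit_disk f"
  obtains a b where "b 0 = 0"
    and "\<And>r. 0 \<le> r \<Longrightarrow> r < 1 \<Longrightarrow> summable (\<lambda>n. cmod (a n) * r ^ n)"
    and "\<And>r. 0 \<le> r \<Longrightarrow> r < 1 \<Longrightarrow> summable (\<lambda>n. cmod (b n) * r ^ n)"
    and "\<And>z. z \<in> unit_disk \<Longrightarrow> f z = (\<Sum>n. a n * z ^ n) + cnj (\<Sum>n. b n * z ^ n)"
proof -
  obtain g h where g: "g holomorphic_on unit_disk" and h: "h holomorphic_on unit_disk"
    and f: "\<And>z. z \<in> unit_disk \<Longrightarrow> f z = g z + cnj (h z)"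
    using harmonic_on_imp_holomorphic_parts[OF assms] by (auto simp: convex_ball)
  \<comment> \<open>Constants belong to both halves; moving the value of \<open>h\<close> at 0 into
    the holomorphic half yields \<open>b 0 = 0\<close>.\<close>
  define c where "c = cnj (h 0)"
  define g' where "g' z = g z + c" for z
  define h' where "h' z = h z - cnj c" for z
  have hol: "g' holomorphic_on unit_disk" "h' holomorphic_on unit_disk"
    using g h unfolding g'_def h'_def by (auto intro!: holomorphic_intros)
  define a where "a n = (deriv ^^ n) g' 0 / fact n" for n
  define b where "b n = (deriv ^^ n) h' 0 / fact n" for n
  have A: "(\<lambda>n. a n * z ^ n) sums g' z" "(\<lambda>n. b n * z ^ n) sums h' z" if "z \<in> unit_disk" for z
    using holomorphic_power_series[OF hol(1) that] holomorphic_power_series[OF hol(2) that]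
    by (simp_all add: a_def b_def)
  have S: "summable (\<lambda>n. cmod (d n) * r ^ n)"
    if "0 \<le> r" "r < 1" "\<And>z. z \<in> unit_disk \<Longrightarrow> summable (\<lambda>n. d n * z ^ n)" for d :: "nat \<Rightarrow> complex" and r
  proof -
    \<comment> \<open>Convergence at the larger radius (1 + r) / 2 gives absolute convergence at
      r.\<close>
    have "summable (\<lambda>n. norm (d n * complex_of_real r ^ n))"
      by (rule powser_insidea[where x="complex_of_real ((1 + r) / 2)"])
        (use that in \<open>auto simp del: of_real_add of_real_divide\<close>)
    then show ?thesis using that by (simp add: norm_mult norm_power)
  qed
  show thesis
  proof (rule that)
    show "b 0 = 0" by (simp add: b_def h'_def c_def)
    show "summable (\<lambda>n. cmod (a n) * r ^ n)" "summable (\<lambda>n. cmod (b n) * r ^ n)" if "0 \<le> r" "r < 1" for r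
      using S[OF that] A by (auto simp: sums_iff)
    show "f z = (\<Sum>n. a n * z ^ n) + cnj (\<Sum>n. b n * z ^ n)" if "z \<in> unit_disk" for z
      using A[OF that] f[OF that] by (simp add: sums_iff g'_def h'_def)
  qed
qed

lemma harmonic_on_summable:
  fixes a b :: "nat \<Rightarrow> complex"
  assumes "r > 0" 
    and a: "\<And>z. z \<in> ball 0 r \<Longrightarrow> summable (\<lambda>n. a n * z ^ n)"
    and b: "\<And>z. z \<in> ball 0 r \<Longrightarrow> summable (\<lambda>n. b n * z ^ n)"
    and f: "\<And>z. z \<in> ball 0 r \<Longrightarrow> f z = (\<Sum>n. a n * z ^ n) + cnj (\<Sum>n. b n * z ^ n)"
  shows "harmonic_on (ball 0 r) f"
proof (rule harmonic_on_holomorphic_parts[OF open_ball _ _ f])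
  have "(\<lambda>z. \<Sum>n. d n * z ^ n) holomorphic_on ball 0 r"
    if "\<And>z. z \<in> ball 0 r \<Longrightarrow> summable (\<lambda>n. d n * z ^ n)" for d :: "nat \<Rightarrow> complex"
    by (rule power_series_holomorphic[of 0 r d]) (use that in \<open>auto intro: summable_sums\<close>)
  then show "(\<lambda>z. \<Sum>n. a n * z ^ n) holomorphic_on ball 0 r" "(\<lambda>z. \<Sum>n. b n * z ^ n) holomorphic_on ball 0 r"
    using a b by auto
qed

section \<open>Zero sets of harmonic functions\<close>

lemma countable_isolated_reals:
  fixes T :: "real set"
  assumes "\<And>t. t \<in> T \<Longrightarrow> \<exists>e>0. \<forall>s\<in>T. \<bar>s - t\<bar> < e \<longrightarrow> s = t"
  shows "countable T"
proof -
  \<comment> \<open>Each point is isolated by an interval with rational endpoints, and distinct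
    points receive distinct intervals.\<close>
  have "\<exists>p::rat \<times> rat. of_rat (fst p) < t \<and> t < of_rat (snd p) \<and>
      (\<forall>s\<in>T. of_rat (fst p) < s \<and> s < of_rat (snd p) \<longrightarrow> s = t)" if "t \<in> T" for t
  proof -
    have "\<exists>e>0. \<forall>s\<in>T. \<bar>s - t\<bar> < e \<longrightarrow> s = t" using assms that by blast
    then obtain e where e: "e > 0" "\<And>s. s \<in> T \<Longrightarrow> \<bar>s - t\<bar> < e \<Longrightarrow> s = t" by auto
    obtain p where p: "t - e < of_rat p" "of_rat p < t"
      using of_rat_dense[of "t - e" t] e by auto
    obtain q where q: "t < of_rat q" "of_rat q < t + e"
      using of_rat_dense[of t "t + e"] e by auto
    show ?thesis using p q e(2) by (intro exI[of _ "(p, q)"]) (auto simp: abs_less_iff)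
  qed
  then obtain P :: "real \<Rightarrow> rat \<times> rat" where
    P: "\<And>t. t \<in> T \<Longrightarrow> of_rat (fst (P t)) < t \<and> t < of_rat (snd (P t)) \<and>
      (\<forall>s\<in>T. of_rat (fst (P t)) < s \<and> s < of_rat (snd (P t)) \<longrightarrow> s = t)" by metis
  have "inj_on P T" by (rule inj_onI) (metis P)
  moreover have "countable (P ` T)" by simp
  ultimately show ?thesis by (rule countable_image_inj_on[rotated])
qed

lemma countable_simple_zeros:
  fixes \<phi> :: "real \<Rightarrow> complex"
  assumes "\<And>t. t \<in> T \<Longrightarrow> (\<phi> has_vector_derivative d t) (at t)"
    and "\<And>t. t \<in> T \<Longrightarrow> d t \<noteq> 0" and "\<And>t. t \<in> T \<Longrightarrow> \<phi> t = 0"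
  shows "countable T"
proof (rule countable_isolated_reals)
  fix t assume t: "t \<in> T"
  have *: "\<exists>e>0. \<forall>s\<in>T. \<bar>s - t\<bar> < e \<longrightarrow> s = t"
    if L: "bounded_linear L" and nz: "L (d t) \<noteq> 0" for L :: "complex \<Rightarrow> real"
  proof -
    have "((\<lambda>s. L (\<phi> s)) has_real_derivative L (d t)) (at t)"
      using bounded_linear.has_vector_derivative[OF L assms(1)[OF t]]
      by (simp add: has_real_derivative_iff_has_vector_derivative)
    then have "((\<lambda>s. (L (\<phi> s) - L (\<phi> t)) / (s - t)) \<longlongrightarrow> L (d t)) (at t)"
      by (simp add: has_field_derivative_iff)
    then have "\<forall>\<^sub>F s in at t. (L (\<phi> s) - L (\<phi> t)) / (s - t) \<noteq> 0"
      using nz by (rule tendsto_imp_eventually_ne)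
    then obtain e where e: "e > 0"
      "\<And>s. s \<noteq> t \<Longrightarrow> dist s t < e \<Longrightarrow> (L (\<phi> s) - L (\<phi> t)) / (s - t) \<noteq> 0"
      unfolding eventually_at by auto
    have "s = t" if "s \<in> T" "\<bar>s - t\<bar> < e" for s
      using e(2)[of s] that assms(3)[OF t] assms(3)[OF \<open>s \<in> T\<close>] by (auto simp: dist_real_def)
    then show ?thesis using e(1) by blast
  qed
  \<comment> \<open>A nonzero complex derivative has a nonzero real or imaginary part, and a zero of
    a real function with nonzero derivative is isolated.\<close>
  have "Re (d t) \<noteq> 0 \<or> Im (d t) \<noteq> 0" using assms(2)[OF t] by (simp add: complex_eq_iff)
  then show "\<exists>e>0. \<forall>s\<in>T. \<bar>s - t\<bar> < e \<longrightarrow> s = t"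
    using *[OF bounded_linear_Re] *[OF bounded_linear_Im] by blast
qed

text \<open>Countable sections are null, so Tonelli makes the set null. The disjunction serves both
  families of lines parallel to an axis.\<close>

lemma null_set_by_lines:
  assumes Y: "Y \<in> sets borel"
    and "(\<forall>x. countable {y. Complex x y \<in> Y}) \<or> (\<forall>y. countable {x. Complex x y \<in> Y})"
  shows "Y \<in> null_sets lborel"
proof -
  let ?J = "\<lambda>(x, y). Complex x y"
  have J: "?J \<in> borel_measurable (lborel \<Otimes>\<^sub>M lborel)"
    unfolding Complex_eq case_prod_beta by measurable
  have "emeasure lborel Y = emeasure (distr (lborel \<Otimes>\<^sub>M lborel) borel ?J) Y"
    by (simp add: lborel_complex_pair)
  also have "\<dots> = emeasure (lborel \<Otimes>\<^sub>M lborel) (?J -` Y)"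
    using J Y by (simp add: emeasure_distr space_pair_measure)
  also have "\<dots> = 0"
  proof -
    have m: "?J -` Y \<in> sets (lborel \<Otimes>\<^sub>M lborel)"
      using measurable_sets[OF J Y] by (simp add: space_pair_measure)
    from assms(2) show ?thesis
    proof
      assume c: "\<forall>x. countable {y. Complex x y \<in> Y}"
      have "emeasure lborel (Pair x -` ?J -` Y) = 0" for x
        using c by (intro emeasure_lborel_countable) (simp add: vimage_def)
      then show ?thesis by (simp add: lborel.emeasure_pair_measure_alt[OF m])
    next
      assume c: "\<forall>y. countable {x. Complex x y \<in> Y}"
      have "emeasure lborel ((\<lambda>x. (x, y)) -` ?J -` Y) = 0" for y
        using c by (intro emeasure_lborel_countable) (simp add: vimage_def)
      then show ?thesis by (simp add: lborel_pair.emeasure_pair_measure_alt2[OF m])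
    qed
  qed
  finally show ?thesis using Y by (simp add: null_sets_def)
qed

text \<open>Needed for the countability of the zeros of a nonconstant holomorphic function on the
  ball, which is exhausted by the closed balls of radius r - 1 / (n + 1).\<close>

lemma fsigma_ball: "fsigma (ball c r :: 'a::euclidean_space set)"
proof -
  have "ball c r = (\<Union>n. cball c (r - 1 / Suc n))"
  proof (intro set_eqI iffI)
    fix x assume "x \<in> ball c r"
    then obtain n where "1 / Suc n < r - dist c x"
      using reals_Archimedean[of "r - dist c x"] by (auto simp: inverse_eq_divide)
    then show "x \<in> (\<Union>n. cball c (r - 1 / Suc n))" by (intro UN_I[of n]) auto
  next
    fix x assume "x \<in> (\<Union>n. cball c (r - 1 / Suc n))"
    then obtain n where "dist c x \<le> r - 1 / Suc n" by auto
    moreover have "1 / real (Suc n) > 0" by simp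
    ultimately show "x \<in> ball c r" unfolding mem_ball by linarith
  qed
  then show ?thesis by (metis closed_cball fsigma.intros)
qed

text \<open>Zeros at which a partial derivative does not vanish are isolated on the corresponding line;
  where both vanish, the holomorphic functions \<open>g'\<close> and \<open>h'\<close> of \<open>f = g + cnj h\<close> vanish.\<close>

lemma harmonic_zero_set_null:
  assumes f: "harmonic_on (ball c r) f" and nz: "\<exists>z\<in>ball c r. f z \<noteq> 0"
  shows "{z \<in> ball c r. f z = 0} \<in> null_sets lborel"
proof -
  let ?S = "ball c r"
  obtain g h where g: "g holomorphic_on ?S" and h: "h holomorphic_on ?S"
    and fgh: "\<And>z. z \<in> ?S \<Longrightarrow> f z = g z + cnj (h z)"
    using harmonic_on_imp_holomorphic_parts[OF f convex_ball] by metis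
  define g' where "g' = deriv g"
  define h' where "h' = deriv h"
  have hol: "g' holomorphic_on ?S" "h' holomorphic_on ?S"
    using g h by (auto simp: g'_def h'_def intro: holomorphic_deriv)
  define fx where "fx z = g' z + cnj (h' z)" for z
  define fy where "fy z = \<i> * g' z + cnj (\<i> * h' z)" for z
  have D: "(f has_derivative (\<lambda>k. Re k *\<^sub>R fx z + Im k *\<^sub>R fy z)) (at z)" if "z \<in> ?S" for z
  proof -
    have "(g has_field_derivative g' z) (at z)" "(h has_field_derivative h' z) (at z)"
      using that g h by (auto simp: g'_def h'_def intro!: holomorphic_derivI[where S="?S"])
    then have "((\<lambda>w. g w + cnj (h w)) has_derivative (\<lambda>k. g' z * k + cnj (h' z * k))) (at z)"
      by (intro derivative_intros has_derivative_cnj) (auto simp: has_field_derivative_def)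
    also have "(\<lambda>k. g' z * k + cnj (h' z * k)) = (\<lambda>k. Re k *\<^sub>R fx z + Im k *\<^sub>R fy z)"
      unfolding fx_def fy_def by (intro ext) (simp add: complex_eq_iff algebra_simps)
    finally show ?thesis
      by (rule has_derivative_transform_within_open[where s="?S"]) (use that fgh in auto)
  qed
  have cf: "continuous_on ?S f" by (rule harmonic_on_continuous[OF f])
  have cg: "continuous_on ?S g'" "continuous_on ?S h'"
    using hol by (auto intro: holomorphic_on_imp_continuous_on)
  have cx: "continuous_on ?S fx" "continuous_on ?S fy"
    unfolding fx_def fy_def by (intro continuous_intros cg)+
  have meas: "{z \<in> ?S. u z = 0} \<in> sets borel" "{z \<in> ?S. u z \<noteq> 0} \<in> sets borel" 
    if "continuous_on ?S u" for u :: "complex \<Rightarrow> complex"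
  proof -
    have o: "open (?S \<inter> u -` (- {0}))"
      using that by (intro continuous_open_preimage) auto
    have e: "{z \<in> ?S. u z \<noteq> 0} = ?S \<inter> u -` (- {0})" by auto
    show "{z \<in> ?S. u z \<noteq> 0} \<in> sets borel" unfolding e using o by (rule borel_open)
    moreover have "{z \<in> ?S. u z = 0} = ?S - {z \<in> ?S. u z \<noteq> 0}" by auto
    ultimately show "{z \<in> ?S. u z = 0} \<in> sets borel" by simp
  qed
  have N1: "{z \<in> ?S. f z = 0} \<inter> {z \<in> ?S. fx z \<noteq> 0} \<in> null_sets lborel"
  proof (rule null_set_by_lines)
    show "{z \<in> ?S. f z = 0} \<inter> {z \<in> ?S. fx z \<noteq> 0} \<in> sets borel"
      using meas cf cx by (intro sets.Int) auto
    have "countable {x. Complex x y \<in> {z \<in> ?S. f z = 0} \<inter> {z \<in> ?S. fx z \<noteq> 0}}" for y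
      by (rule countable_simple_zeros[where \<phi>="\<lambda>x. f (Complex x y)" and d="\<lambda>x. fx (Complex x y)"])
        (auto intro!: has_derivative_horizontal_line D)
    then show "(\<forall>x. countable {y. Complex x y \<in> {z \<in> ?S. f z = 0} \<inter> {z \<in> ?S. fx z \<noteq> 0}}) \<or>
      (\<forall>y. countable {x. Complex x y \<in> {z \<in> ?S. f z = 0} \<inter> {z \<in> ?S. fx z \<noteq> 0}})" by blast
  qed
  have N2: "{z \<in> ?S. f z = 0} \<inter> {z \<in> ?S. fy z \<noteq> 0} \<in> null_sets lborel"
  proof (rule null_set_by_lines)
    show "{z \<in> ?S. f z = 0} \<inter> {z \<in> ?S. fy z \<noteq> 0} \<in> sets borel"
      using meas cf cx by (intro sets.Int) auto
    have "countable {y. Complex x y \<in> {z \<in> ?S. f z = 0} \<inter> {z \<in> ?S. fy z \<noteq> 0}}" for x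
      by (rule countable_simple_zeros[where \<phi>="\<lambda>y. f (Complex x y)" and d="\<lambda>y. fy (Complex x y)"])
        (auto intro!: has_derivative_horizontal_line D)
    then show "(\<forall>x. countable {y. Complex x y \<in> {z \<in> ?S. f z = 0} \<inter> {z \<in> ?S. fy z \<noteq> 0}}) \<or>
      (\<forall>y. countable {x. Complex x y \<in> {z \<in> ?S. f z = 0} \<inter> {z \<in> ?S. fy z \<noteq> 0}})" by blast
  qed
  have sub: "g' z = 0 \<and> h' z = 0" if "fx z = 0" "fy z = 0" for z
  proof -
    have ii: "\<i> * (\<i> * w) = - w" for w by (simp flip: mult.assoc)
    have e: "fy z = \<i> * g' z - \<i> * cnj (h' z)" by (simp add: fy_def)
    have "\<i> * fy z = cnj (h' z) - g' z" unfolding e right_diff_distrib ii by simp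
    then have "cnj (h' z) - g' z = 0" unfolding that(2) mult_zero_right by (rule sym)
    then have 1: "cnj (h' z) = g' z" by (simp only: right_minus_eq)
    moreover have "g' z + cnj (h' z) = 0" using that(1) by (simp only: fx_def)
    ultimately have "2 * g' z = 0" by (simp only: mult_2)
    then have "g' z = 0" by simp
    moreover from this 1 have "h' z = 0" by (simp only: complex_cnj_zero_iff)
    ultimately show ?thesis ..
  qed
  show ?thesis
  \<comment> \<open>If both derivatives vanish identically, f is a nonzero constant and has no
    zeros; otherwise one of them has only countably many zeros.\<close>
  proof (cases "\<forall>z\<in>?S. g' z = 0 \<and> h' z = 0")
    case True
    have "(f has_derivative (\<lambda>h. 0)) (at z within ?S)" if "z \<in> ?S" for z
    proof -
      have "fx z = 0" "fy z = 0" using True that by (simp_all add: fx_def fy_def)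
      then show ?thesis using D[OF that] by (simp add: has_derivative_at_withinI)
    qed
    then have "\<exists>C. \<forall>z\<in>?S. f z = C" by (rule has_derivative_zero_constant[OF convex_ball])
    then obtain C where C: "\<forall>z\<in>?S. f z = C" ..
    obtain z0 where z0: "z0 \<in> ?S" "f z0 \<noteq> 0" using nz ..
    have "f z \<noteq> 0" if "z \<in> ?S" for z
      using bspec[OF C that] bspec[OF C z0(1)] z0(2) by simp
    then have e: "{z \<in> ?S. f z = 0} = {}" by blast
    show ?thesis unfolding e by (rule null_sets.empty_sets)
  next
    case False
    have cz: "countable {z \<in> ?S. u z = 0}" if "u holomorphic_on ?S" "z0 \<in> ?S" "u z0 \<noteq> 0" for u z0
    proof (cases "u constant_on ?S")
      case True
      then obtain C where C: "\<forall>z\<in>?S. u z = C" unfolding constant_on_def ..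
      have "u z \<noteq> 0" if "z \<in> ?S" for z
        using bspec[OF C that] bspec[OF C \<open>z0 \<in> ?S\<close>] \<open>u z0 \<noteq> 0\<close> by simp
      then have e: "{z \<in> ?S. u z = 0} = {}" by blast
      show ?thesis unfolding e by simp
    next
      case False
      then show ?thesis
        by (intro holomorphic_countable_zeros[OF that(1)] fsigma_ball) simp_all
    qed
    have "countable {z \<in> ?S. g' z = 0} \<or> countable {z \<in> ?S. h' z = 0}"
      using False cz hol by blast
    then have "countable {z \<in> ?S. g' z = 0 \<and> h' z = 0}"
    proof
      assume "countable {z \<in> ?S. g' z = 0}"
      then show ?thesis by (rule countable_subset[rotated]) blast
    next
      assume "countable {z \<in> ?S. h' z = 0}"
      then show ?thesis by (rule countable_subset[rotated]) blast
    qed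
    then have N3: "{z \<in> ?S. g' z = 0 \<and> h' z = 0} \<in> null_sets lborel"
      by (rule countable_imp_null_set_lborel)
    have "{z \<in> ?S. f z = 0} \<subseteq> {z \<in> ?S. f z = 0} \<inter> {z \<in> ?S. fx z \<noteq> 0}
      \<union> {z \<in> ?S. f z = 0} \<inter> {z \<in> ?S. fy z \<noteq> 0} \<union> {z \<in> ?S. g' z = 0 \<and> h' z = 0}"
      using sub by blast
    then show ?thesis
      using meas(1)[OF cf] by (intro null_sets_subset[OF null_sets.Un[OF null_sets.Un[OF N1 N2] N3]]) simp_all
  qed
qed

section \<open>Square-integrable harmonic functions\<close>

definition L2 :: "'a measure \<Rightarrow> ('a \<Rightarrow> complex) set" where
  "L2 M = {f. f \<in> borel_measurable M \<and> integrable M (\<lambda>x. (cmod (f x))\<^sup>2)}"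

lemma L2_measurable: "f \<in> L2 M \<Longrightarrow> f \<in> borel_measurable M"
  by (simp add: L2_def)

lemma L2_integrable: "f \<in> L2 M \<Longrightarrow> integrable M (\<lambda>x. (cmod (f x))\<^sup>2)"
  by (simp add: L2_def)

lemma cmod_add_square_le: "(cmod (a + b))\<^sup>2 \<le> 2 * (cmod a)\<^sup>2 + 2 * (cmod b)\<^sup>2"
proof -
  have "(cmod (a + b))\<^sup>2 \<le> (cmod a + cmod b)\<^sup>2"
    by (intro power_mono norm_triangle_ineq) simp
  also have "\<dots> \<le> 2 * (cmod a)\<^sup>2 + 2 * (cmod b)\<^sup>2"
    using zero_le_power2[of "cmod a - cmod b"] by (simp add: power2_eq_square algebra_simps)
  finally show ?thesis .
qed

lemma L2_add:
  assumes "f \<in> L2 M" "g \<in> L2 M"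
  shows "(\<lambda>x. f x + g x) \<in> L2 M"
proof -
  note [measurable] = assms[THEN L2_measurable]
  have "integrable M (\<lambda>x. (cmod (f x + g x))\<^sup>2)"
  proof (rule Bochner_Integration.integrable_bound)
    show "integrable M (\<lambda>x. 2 * (cmod (f x))\<^sup>2 + 2 * (cmod (g x))\<^sup>2)"
      by (intro Bochner_Integration.integrable_add integrable_mult_right assms[THEN L2_integrable])
    show "AE x in M. norm ((cmod (f x + g x))\<^sup>2) \<le> norm (2 * (cmod (f x))\<^sup>2 + 2 * (cmod (g x))\<^sup>2)"
      using cmod_add_square_le[of "f _" "g _"] by (intro AE_I2) simp
  qed measurable
  then show ?thesis by (simp add: L2_def)
qed

lemma L2_bounded_mult:
  assumes f: "f \<in> L2 M" and p: "p \<in> borel_measurable M" "AE x in M. cmod (p x) \<le> B"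
  shows "(\<lambda>x. p x * f x) \<in> L2 M"
proof -
  note [measurable] = p(1) L2_measurable[OF f]
  have "integrable M (\<lambda>x. (cmod (p x * f x))\<^sup>2)"
  proof (rule Bochner_Integration.integrable_bound[of M "\<lambda>x. B\<^sup>2 * (cmod (f x))\<^sup>2"])
    show "AE x in M. norm ((cmod (p x * f x))\<^sup>2) \<le> norm (B\<^sup>2 * (cmod (f x))\<^sup>2)"
      using p(2) by eventually_elim
        (auto simp: norm_mult power_mult_distrib intro!: mult_right_mono power_mono)
  qed (use L2_integrable[OF f] in \<open>auto\<close>)
  then show ?thesis by (simp add: L2_def)
qed

lemma L2_cmult: "f \<in> L2 M \<Longrightarrow> (\<lambda>x. c * f x) \<in> L2 M"
  by (rule L2_bounded_mult[where B="cmod c"]) auto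

lemma L2_diff: "f \<in> L2 M \<Longrightarrow> g \<in> L2 M \<Longrightarrow> (\<lambda>x. f x - g x) \<in> L2 M"
  using L2_add[OF _ L2_cmult[of g M "-1"]] by simp

lemma L2_cnj: "f \<in> L2 M \<Longrightarrow> (\<lambda>x. cnj (f x)) \<in> L2 M"
  by (auto simp: L2_def)

lemma L2_integrable_mult:
  assumes "f \<in> L2 M" "g \<in> L2 M"
  shows "integrable M (\<lambda>x. f x * g x)"
proof (rule Bochner_Integration.integrable_bound)
  note [measurable] = assms[THEN L2_measurable]
  show "(\<lambda>x. f x * g x) \<in> borel_measurable M" by measurable
  show "integrable M (\<lambda>x. (cmod (f x))\<^sup>2 + (cmod (g x))\<^sup>2)"
    using assms by (auto simp: L2_def)
  show "AE x in M. norm (f x * g x) \<le> norm ((cmod (f x))\<^sup>2 + (cmod (g x))\<^sup>2)"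
  proof (rule AE_I2)
    fix x
    have "cmod (f x) * cmod (g x) \<le> (cmod (f x))\<^sup>2 + (cmod (g x))\<^sup>2"
      using sum_squares_bound[of "cmod (f x)" "cmod (g x)"]
        mult_nonneg_nonneg[OF norm_ge_zero[of "f x"] norm_ge_zero[of "g x"]]
      unfolding mult.assoc by linarith
    then show "norm (f x * g x) \<le> norm ((cmod (f x))\<^sup>2 + (cmod (g x))\<^sup>2)"
      by (simp add: norm_mult)
  qed
qed

lemma L2_Cauchy_Schwarz:
  assumes f: "f \<in> L2 M" and g: "g \<in> L2 M"
  shows "(cmod (LINT x|M. f x * g x))\<^sup>2 \<le> (LINT x|M. (cmod (f x))\<^sup>2) * (LINT x|M. (cmod (g x))\<^sup>2)"
proof -
  note [measurable] = f[THEN L2_measurable] g[THEN L2_measurable]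
  have i: "integrable M (\<lambda>x. cmod (f x) * cmod (g x))"
    using integrable_norm[OF L2_integrable_mult[OF f g]] by (simp add: norm_mult)
  have "(\<integral>\<^sup>+x. ennreal (cmod (f x)) * ennreal (cmod (g x)) \<partial>M)\<^sup>2
      \<le> (\<integral>\<^sup>+x. (ennreal (cmod (f x)))\<^sup>2 \<partial>M) * (\<integral>\<^sup>+x. (ennreal (cmod (g x)))\<^sup>2 \<partial>M)"
    by (rule Cauchy_Schwarz_nn_integral) auto
  then have "ennreal ((LINT x|M. cmod (f x) * cmod (g x))\<^sup>2)
      \<le> ennreal ((LINT x|M. (cmod (f x))\<^sup>2) * (LINT x|M. (cmod (g x))\<^sup>2))"
    using i L2_integrable[OF f] L2_integrable[OF g]
    by (simp add: ennreal_mult'[symmetric] ennreal_power nn_integral_eq_integral integral_nonneg_AE)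
  then have "(LINT x|M. cmod (f x) * cmod (g x))\<^sup>2 \<le> (LINT x|M. (cmod (f x))\<^sup>2) * (LINT x|M. (cmod (g x))\<^sup>2)"
    by (simp add: ennreal_le_iff integral_nonneg_AE)
  moreover have "cmod (LINT x|M. f x * g x) \<le> (LINT x|M. cmod (f x) * cmod (g x))"
    using integral_norm_bound[of M "\<lambda>x. f x * g x"] by (simp add: norm_mult)
  ultimately show ?thesis
    by (meson norm_ge_zero order_trans power_mono)
qed

lemma wnorm_nonneg: "wnorm \<alpha> f \<ge> 0"
  by (simp add: wnorm_def integral_nonneg_AE)

lemma wnorm_le_iff:
  "0 \<le> B \<Longrightarrow> (wnorm \<alpha> f \<le> B) = ((LINT z|weighted_area \<alpha>. (cmod (f z))\<^sup>2) \<le> B\<^sup>2)"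
  unfolding wnorm_square[symmetric] using wnorm_nonneg[of \<alpha> f]
  by (simp add: power2_le_iff_abs_le)

lemma winner_Cauchy_Schwarz:
  assumes "f \<in> L2 (weighted_area \<alpha>)" "g \<in> L2 (weighted_area \<alpha>)"
  shows "cmod (winner \<alpha> f g) \<le> wnorm \<alpha> f * wnorm \<alpha> g"
proof -
  have "(cmod (winner \<alpha> f g))\<^sup>2 \<le> (wnorm \<alpha> f * wnorm \<alpha> g)\<^sup>2"
    using L2_Cauchy_Schwarz[OF assms(1) L2_cnj[OF assms(2)]]
    by (simp add: winner_def power_mult_distrib wnorm_square)
  then show ?thesis
    by (rule power2_le_imp_le) (simp add: wnorm_nonneg)
qed

lemma winner_integrable:
  "f \<in> L2 (weighted_area \<alpha>) \<Longrightarrow> g \<in> L2 (weighted_area \<alpha>) \<Longrightarrow>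
    integrable (weighted_area \<alpha>) (\<lambda>z. f z * cnj (g z))"
  by (intro L2_integrable_mult L2_cnj)

lemma winner_add_left:
  "f \<in> L2 (weighted_area \<alpha>) \<Longrightarrow> g \<in> L2 (weighted_area \<alpha>) \<Longrightarrow> k \<in> L2 (weighted_area \<alpha>) \<Longrightarrow>
    winner \<alpha> (\<lambda>z. f z + g z) k = winner \<alpha> f k + winner \<alpha> g k"
  unfolding winner_def by (simp add: distrib_right winner_integrable)

lemma winner_diff_left:
  "f \<in> L2 (weighted_area \<alpha>) \<Longrightarrow> g \<in> L2 (weighted_area \<alpha>) \<Longrightarrow> k \<in> L2 (weighted_area \<alpha>) \<Longrightarrow>
    winner \<alpha> (\<lambda>z. f z - g z) k = winner \<alpha> f k - winner \<alpha> g k"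
  unfolding winner_def by (simp add: left_diff_distrib winner_integrable)

lemma winner_cmult_left: "winner \<alpha> (\<lambda>z. c * f z) k = c * winner \<alpha> f k"
  unfolding winner_def by (simp add: mult.assoc)

lemma winner_cmult_right: "winner \<alpha> f (\<lambda>z. c * k z) = cnj c * winner \<alpha> f k"
  unfolding winner_def by (simp add: mult_ac flip: integral_mult_right_zero)

lemma winner_cnj: "winner \<alpha> g f = cnj (winner \<alpha> f g)"
  unfolding winner_def
  by (subst Bochner_Integration.integral_cnj[symmetric], rule Bochner_Integration.integral_cong) (auto simp: mult.commute)

lemma Lh2_L2: "f \<in> Lh2 \<alpha> \<Longrightarrow> f \<in> L2 (weighted_area \<alpha>)"
  by (auto simp: Lh2_def L2_def intro: continuous_imp_measurable_weighted_area harmonic_on_continuous)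

text \<open>Sums are formed on the holomorphic parts, which convexity provides, instead of on six
  partial derivatives.\<close>

lemma harmonic_on_add:
  assumes "harmonic_on S f" "harmonic_on S g" "convex S"
  shows "harmonic_on S (\<lambda>z. f z + g z)"
proof -
  have "open S" using assms by (simp add: harmonic_on_def)
  obtain u v where uv: "u holomorphic_on S" "v holomorphic_on S" "\<And>z. z \<in> S \<Longrightarrow> f z = u z + cnj (v z)"
    using harmonic_on_imp_holomorphic_parts[OF assms(1,3)] by metis
  obtain u' v' where uv': "u' holomorphic_on S" "v' holomorphic_on S" "\<And>z. z \<in> S \<Longrightarrow> g z = u' z + cnj (v' z)"
    using harmonic_on_imp_holomorphic_parts[OF assms(2,3)] by metis
  show ?thesis
    by (rule harmonic_on_holomorphic_parts[OF \<open>open S\<close>, of "\<lambda>z. u z + u' z" "\<lambda>z. v z + v' z"])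
      (use uv uv' in \<open>auto intro!: holomorphic_intros\<close>)
qed

lemma harmonic_on_cmult:
  assumes "harmonic_on S f" "convex S"
  shows "harmonic_on S (\<lambda>z. c * f z)"
proof -
  have "open S" using assms by (simp add: harmonic_on_def)
  obtain u v where uv: "u holomorphic_on S" "v holomorphic_on S" "\<And>z. z \<in> S \<Longrightarrow> f z = u z + cnj (v z)"
    using harmonic_on_imp_holomorphic_parts[OF assms] by metis
  show ?thesis
    by (rule harmonic_on_holomorphic_parts[OF \<open>open S\<close>, of "\<lambda>z. c * u z" "\<lambda>z. cnj c * v z"])
      (use uv in \<open>auto intro!: holomorphic_intros simp: distrib_left\<close>)
qed

lemma Lh2_add: "f \<in> Lh2 \<alpha> \<Longrightarrow> g \<in> Lh2 \<alpha> \<Longrightarrow> (\<lambda>z. f z + g z) \<in> Lh2 \<alpha>"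
  using L2_integrable[OF L2_add[OF Lh2_L2 Lh2_L2, of f \<alpha> g]]
  by (auto simp: Lh2_def intro!: harmonic_on_add)

lemma Lh2_cmult: "f \<in> Lh2 \<alpha> \<Longrightarrow> (\<lambda>z. c * f z) \<in> Lh2 \<alpha>"
  using L2_integrable[OF L2_cmult[OF Lh2_L2, of f \<alpha> c]]
  by (auto simp: Lh2_def intro!: harmonic_on_cmult)

lemma Lh2_diff: "f \<in> Lh2 \<alpha> \<Longrightarrow> g \<in> Lh2 \<alpha> \<Longrightarrow> (\<lambda>z. f z - g z) \<in> Lh2 \<alpha>"
  using Lh2_add[OF _ Lh2_cmult[of g \<alpha> "-1"]] by simp

text \<open>The normalisation \<open>b 0 = 0\<close> makes the coefficients unique.\<close>

definition harmonic_series :: "(nat \<Rightarrow> complex) \<Rightarrow> (nat \<Rightarrow> complex) \<Rightarrow> (complex \<Rightarrow> complex) \<Rightarrow> bool" where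
  "harmonic_series a b f \<longleftrightarrow> b 0 = 0 \<and>
     (\<forall>r. 0 \<le> r \<longrightarrow> r < 1 \<longrightarrow> summable (\<lambda>n. cmod (a n) * r ^ n) \<and> summable (\<lambda>n. cmod (b n) * r ^ n)) \<and>
     (\<forall>z\<in>unit_disk. f z = (\<Sum>n. a n * z ^ n) + cnj (\<Sum>n. b n * z ^ n))"

lemma harmonic_series_exists:
  assumes "harmonic_on unit_disk f"
  shows "\<exists>a b. harmonic_series a b f"
proof (rule harmonic_on_power_series[OF assms])
  fix a b :: "nat \<Rightarrow> complex"
  assume "b 0 = 0"
    and "\<And>r. 0 \<le> r \<Longrightarrow> r < 1 \<Longrightarrow> summable (\<lambda>n. cmod (a n) * r ^ n)"
    and "\<And>r. 0 \<le> r \<Longrightarrow> r < 1 \<Longrightarrow> summable (\<lambda>n. cmod (b n) * r ^ n)"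
    and "\<And>z. z \<in> unit_disk \<Longrightarrow> f z = (\<Sum>n. a n * z ^ n) + cnj (\<Sum>n. b n * z ^ n)"
  then have "harmonic_series a b f" unfolding harmonic_series_def by simp
  then show ?thesis by (intro exI)
qed

lemma summable_series_inside:
  assumes "\<And>r. 0 \<le> r \<Longrightarrow> r < 1 \<Longrightarrow> summable (\<lambda>n. cmod (a n) * r ^ n)" "cmod z < 1"
  shows "summable (\<lambda>n. a n * z ^ n)"
  using assms(1)[of "cmod z"] assms(2)
  by (intro summable_norm_cancel[of "\<lambda>n. a n * z ^ n"]) (simp add: norm_mult norm_power)

text \<open>Used for differences of members of a sequence, where \<open>coefficient_bound\<close>
  turns closeness in norm into closeness of coefficients.\<close>

lemma harmonic_series_diff:
  assumes "harmonic_series a b f" "harmonic_series a' b' g"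
  shows "harmonic_series (\<lambda>n. a n - a' n) (\<lambda>n. b n - b' n) (\<lambda>z. f z - g z)"
proof -
  have s: "summable (\<lambda>n. cmod (u n - v n) * r ^ n)"
    if "summable (\<lambda>n. cmod (u n) * r ^ n)" "summable (\<lambda>n. cmod (v n) * r ^ n)" "0 \<le> r"
    for u v :: "nat \<Rightarrow> complex" and r
    by (rule summable_comparison_test[OF _ summable_add[OF that(1,2)]])
      (use that(3) in \<open>auto intro!: mult_right_mono norm_triangle_ineq4 simp flip: distrib_right\<close>)
  have d: "(\<Sum>n. (u n - v n) * z ^ n) = (\<Sum>n. u n * z ^ n) - (\<Sum>n. v n * z ^ n)"
    if "\<And>r. 0 \<le> r \<Longrightarrow> r < 1 \<Longrightarrow> summable (\<lambda>n. cmod (u n) * r ^ n)"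
      "\<And>r. 0 \<le> r \<Longrightarrow> r < 1 \<Longrightarrow> summable (\<lambda>n. cmod (v n) * r ^ n)" "cmod z < 1" for u v :: "nat \<Rightarrow> complex" and z
    using suminf_diff[OF summable_series_inside[OF that(1,3)] summable_series_inside[OF that(2,3)]]
    by (simp add: left_diff_distrib)
  show ?thesis
    unfolding harmonic_series_def
  proof (intro conjI allI impI ballI)
    fix r :: real assume "0 \<le> r" "r < 1"
    then show "summable (\<lambda>n. cmod (a n - a' n) * r ^ n)" "summable (\<lambda>n. cmod (b n - b' n) * r ^ n)"
      using assms by (intro s; simp add: harmonic_series_def)+
  next
    fix z assume "z \<in> unit_disk"
    then have "(\<Sum>n. (a n - a' n) * z ^ n) = (\<Sum>n. a n * z ^ n) - (\<Sum>n. a' n * z ^ n)"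
      "(\<Sum>n. (b n - b' n) * z ^ n) = (\<Sum>n. b n * z ^ n) - (\<Sum>n. b' n * z ^ n)"
      using assms by (intro d; simp add: harmonic_series_def)+
    moreover have "f z = (\<Sum>n. a n * z ^ n) + cnj (\<Sum>n. b n * z ^ n)"
      "g z = (\<Sum>n. a' n * z ^ n) + cnj (\<Sum>n. b' n * z ^ n)"
      using assms \<open>z \<in> unit_disk\<close> by (simp_all add: harmonic_series_def)
    ultimately show "f z - g z = (\<Sum>n. (a n - a' n) * z ^ n) + cnj (\<Sum>n. (b n - b' n) * z ^ n)"
      by simp
  qed (use assms in \<open>simp add: harmonic_series_def\<close>)
qed

section \<open>Coefficient estimates and completeness\<close>

lemma open_measure_weighted_area_pos:
  assumes "\<alpha> > -1" "open U" "U \<subseteq> unit_disk" "U \<noteq> {}"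
  shows "(LINT z|weighted_area \<alpha>. indicator U z) > (0::real)"
proof -
  have [measurable]: "U \<in> sets borel" using assms by simp
  have U: "U \<in> sets (weighted_area \<alpha>)"
    using assms by (auto simp: sets_restrict_space)
  have "(\<integral>\<^sup>+z. indicator U z \<partial>weighted_area \<alpha>) \<noteq> 0"
  proof
    assume "(\<integral>\<^sup>+z. indicator U z \<partial>weighted_area \<alpha>) = 0"
    then have "(\<integral>\<^sup>+z. ennreal (wdensity \<alpha> z) * indicator U z \<partial>lborel) = 0"
      using assms by (subst (asm) nn_integral_weighted_area) auto
    then have "AE z in lborel. ennreal (wdensity \<alpha> z) * indicator U z = 0"
      by (subst (asm) nn_integral_0_iff_AE) auto
    then have "AE z in lborel. z \<notin> U"
    proof eventually_elim
      case (elim z)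
      show ?case
      proof
        assume "z \<in> U"
        moreover from this have "z \<in> unit_disk" using assms by blast
        moreover have "weight \<alpha> z / pi > 0" using weight_pos[OF assms(1), of z] calculation by simp
        ultimately show False
          using elim by (simp add: wdensity_def ennreal_eq_0_iff)
      qed
    qed
    then have "U \<in> null_sets lborel" by (simp add: AE_iff_null_sets)
    then have "negligible U" using null_sets_completionI[of U lborel] by (simp add: negligible_iff_null_sets)
    with assms show False by (simp add: open_not_negligible)
  qed
  then have "emeasure (weighted_area \<alpha>) U \<noteq> 0" using U by simp
  moreover interpret finite_measure "weighted_area \<alpha>" using assms by (simp add: finite_measure_weighted_area)
  have "(LINT z|weighted_area \<alpha>. indicator U z) = measure (weighted_area \<alpha>) U"
    using U assms(3) by (simp add: Int_absorb2)
  ultimately show ?thesis by (simp add: emeasure_eq_measure zero_less_measure_iff)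
qed

text \<open>On the annulus between \<open>\<sigma>\<close> and \<open>r\<close>, a set of positive
  weighted measure \<open>m\<close>, the integrand is at least \<sigma>^(2n).\<close>

lemma moment_lower_bound:
  assumes "\<alpha> > -1" "0 < \<sigma>" "\<sigma> < r" "r \<le> 1"
  obtains m where "m > 0" "\<And>n. moment \<alpha> r n \<ge> m * \<sigma> ^ (2 * n)"
proof -
  define U where "U = ball 0 r - cball (0::complex) \<sigma>"
  define m where "m = (LINT z|weighted_area \<alpha>. indicator U z :: real)"
  have "open U" by (simp add: U_def open_Diff)
  have "cmod (complex_of_real ((\<sigma> + r) / 2)) = (\<sigma> + r) / 2"
    unfolding norm_of_real using assms by simp
  then have "complex_of_real ((\<sigma> + r) / 2) \<in> U"
    unfolding U_def Diff_iff mem_ball mem_cball dist_0_norm using assms by simp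
  then have "U \<noteq> {}" by blast
  then have "m > 0" unfolding m_def using assms \<open>open U\<close>
    by (intro open_measure_weighted_area_pos) (simp_all, auto simp: U_def)
  moreover have "moment \<alpha> r n \<ge> m * \<sigma> ^ (2 * n)" for n
  proof -
    have "m * \<sigma> ^ (2 * n) = (LINT z|weighted_area \<alpha>. indicator U z * \<sigma> ^ (2 * n))"
      by (simp add: m_def)
    also have "\<dots> \<le> moment \<alpha> r n" unfolding moment_def
    proof (rule integral_mono)
      show "integrable (weighted_area \<alpha>) (\<lambda>z. indicator U z * \<sigma> ^ (2 * n))"
        by (rule integrable_weighted_area_bounded[OF assms(1), where B="\<sigma> ^ (2 * n)"])
          (use assms \<open>open U\<close> in \<open>auto simp: indicator_def intro!: borel_imp_measurable_weighted_area
            borel_measurable_times borel_measurable_indicator[unfolded indicator_def[abs_def]]\<close>)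
      show "integrable (weighted_area \<alpha>) (\<lambda>z. indicator (ball 0 r) z * cmod z ^ (2 * n))"
        by (rule integrable_weighted_area_bounded[OF assms(1), where B=1])
          (auto simp: indicator_def power_le_one intro!: borel_imp_measurable_weighted_area)
      show "indicator U z * \<sigma> ^ (2 * n) \<le> indicator (ball 0 r) z * cmod z ^ (2 * n)" for z
        using assms by (auto simp: U_def indicator_def intro!: power_mono)
    qed
    finally show ?thesis .
  qed
  ultimately show thesis by (rule that)
qed

text \<open>Cross terms vanish by orthogonality except at n = 0, where both halves have a constant
  term; the normalisation \<open>b 0 = 0\<close> removes this overlap.\<close>

lemma harmonic_series_coefficient:
  assumes "\<alpha> > -1" "0 < r" "r < 1" and hs: "harmonic_series a b f"
  shows "(LINT z|weighted_area \<alpha>. indicator (ball 0 r) z * (f z * cnj z ^ n)) = a n * moment \<alpha> r n"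
    and "n > 0 \<Longrightarrow> (LINT z|weighted_area \<alpha>. indicator (ball 0 r) z * (f z * z ^ n)) = cnj (b n) * moment \<alpha> r n"
proof -
  let ?N = "weighted_area \<alpha>"
  define g where "g z = (\<Sum>n. a n * z ^ n)" for z
  define h where "h z = (\<Sum>n. b n * z ^ n)" for z
  have sa: "summable (\<lambda>n. cmod (a n) * r ^ n)" and sb: "summable (\<lambda>n. cmod (b n) * r ^ n)" and b0: "b 0 = 0"
    and f: "\<And>z. z \<in> unit_disk \<Longrightarrow> f z = g z + cnj (h z)"
    using hs assms by (auto simp: harmonic_series_def g_def h_def)
  note [measurable] = indicator_ball_measurable power_measurable_weighted_area power_series_measurable
  have int: "integrable ?N (\<lambda>z. indicator (ball 0 r) z * ((\<Sum>n. d n * z ^ n) * p z))"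
    if d: "summable (\<lambda>n. cmod (d n) * r ^ n)" and [measurable]: "p \<in> borel_measurable ?N"
      and p: "\<And>z. z \<in> unit_disk \<Longrightarrow> cmod (p z) \<le> 1" for d :: "nat \<Rightarrow> complex" and p
  proof (rule integrable_weighted_area_bounded[OF assms(1), where B="\<Sum>n. cmod (d n) * r ^ n"])
    fix z assume z: "z \<in> unit_disk"
    have 0: "0 \<le> (\<Sum>n. cmod (d n) * r ^ n)"
      using assms by (intro suminf_nonneg d) auto
    have "cmod (\<Sum>n. d n * z ^ n) \<le> (\<Sum>n. cmod (d n) * r ^ n)" if "cmod z < r"
    proof (rule norm_suminf_le[OF _ d])
      show "norm (d n * z ^ n) \<le> cmod (d n) * r ^ n" for n
        using that by (auto simp: norm_mult norm_power intro!: mult_left_mono power_mono)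
    qed
    then have "cmod (\<Sum>n. d n * z ^ n) * cmod (p z) \<le> (\<Sum>n. cmod (d n) * r ^ n) * 1" if "cmod z < r"
      using that p[OF z] 0 by (intro mult_mono) auto
    then show "norm (indicator (ball 0 r) z * ((\<Sum>n. d n * z ^ n) * p z)) \<le> (\<Sum>n. cmod (d n) * r ^ n)"
      using 0 by (auto simp: indicator_def norm_mult)
  qed measurable
  have ig: "integrable ?N (\<lambda>z. indicator (ball 0 r) z * (g z * cnj z ^ n))"
    "integrable ?N (\<lambda>z. indicator (ball 0 r) z * (g z * z ^ n))"
    "integrable ?N (\<lambda>z. indicator (ball 0 r) z * (h z * cnj z ^ n))"
    "integrable ?N (\<lambda>z. indicator (ball 0 r) z * (h z * z ^ n))" for n
    unfolding g_def h_def
    by (intro int sa sb; (measurable)?; simp add: norm_power power_le_one)+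
  note A = power_series_coefficient[OF assms(1,2) sa, folded g_def]
  note B = power_series_coefficient[OF assms(1,2) sb, folded h_def]
  have icj: "integrable ?N (\<lambda>z. cnj (F z))" if "integrable ?N F" for F :: "complex \<Rightarrow> complex"
    using that by simp
  have "(LINT z|?N. indicator (ball 0 r) z * (f z * cnj z ^ n))
      = (LINT z|?N. indicator (ball 0 r) z * (g z * cnj z ^ n) + cnj (indicator (ball 0 r) z * (h z * z ^ n)))"
    by (intro Bochner_Integration.integral_cong) (auto simp: f algebra_simps indicator_def)
  also have "\<dots> = a n * moment \<alpha> r n + cnj (if n = 0 then b 0 * moment \<alpha> r 0 else 0)"
    unfolding A(1)[symmetric] B(2)[symmetric]
    by (subst Bochner_Integration.integral_cnj[symmetric]) (intro Bochner_Integration.integral_add ig icj)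
  finally show "(LINT z|?N. indicator (ball 0 r) z * (f z * cnj z ^ n)) = a n * moment \<alpha> r n"
    by (simp add: b0)
  assume "n > 0"
  have "(LINT z|?N. indicator (ball 0 r) z * (f z * z ^ n))
      = (LINT z|?N. indicator (ball 0 r) z * (g z * z ^ n) + cnj (indicator (ball 0 r) z * (h z * cnj z ^ n)))"
    by (intro Bochner_Integration.integral_cong) (auto simp: f algebra_simps indicator_def)
  also have "\<dots> = (if n = 0 then a 0 * moment \<alpha> r 0 else 0) + cnj (b n * moment \<alpha> r n)"
    unfolding A(2)[symmetric] B(1)[symmetric]
    by (subst Bochner_Integration.integral_cnj[symmetric]) (intro Bochner_Integration.integral_add ig icj)
  finally show "(LINT z|?N. indicator (ball 0 r) z * (f z * z ^ n)) = cnj (b n) * moment \<alpha> r n"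
    using \<open>n > 0\<close> by simp
qed

text \<open>Pairing f with a monomial on a ball of radius r < 1 gives a coefficient times a moment.
  Cauchy-Schwarz bounds the pairing by the norm, and the moments decay no faster than \<sigma>^n.
  \<open>Z\<close> depends neither on f nor on n, as completeness and the compactness argument
  require.\<close>

lemma coefficient_bound:
  assumes "\<alpha> > -1" "0 < \<sigma>" "\<sigma> < 1"
  obtains Z where "Z > 0"
    "\<And>f a b n. f \<in> Lh2 \<alpha> \<Longrightarrow> harmonic_series a b f \<Longrightarrow> cmod (a n) \<le> Z * (1 / \<sigma>) ^ n * wnorm \<alpha> f"
    "\<And>f a b n. f \<in> Lh2 \<alpha> \<Longrightarrow> harmonic_series a b f \<Longrightarrow> cmod (b n) \<le> Z * (1 / \<sigma>) ^ n * wnorm \<alpha> f"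
proof -
  let ?N = "weighted_area \<alpha>"
  \<comment> \<open>The square root turns the moment bound s^(2n) into \<sigma>^n.\<close>
  define s where "s = sqrt \<sigma>"
  have s: "0 < s" "s < 1" using assms by (auto simp: s_def)
  define r where "r = (s + 1) / 2"
  have r: "0 < r" "s < r" "r < 1" using s by (auto simp: r_def)
  obtain m where m: "m > 0" "\<And>n. moment \<alpha> r n \<ge> m * s ^ (2 * n)"
    by (rule moment_lower_bound[OF assms(1) s(1) r(2) less_imp_le[OF r(3)]]) (rule that)
  have m': "moment \<alpha> r n \<ge> m * \<sigma> ^ n" for n
    using m(2)[of n] assms by (simp add: s_def power_mult)
  have key: "cmod (LINT z|?N. indicator (ball 0 r) z * (f z * p z)) \<le> wnorm \<alpha> f"
    if f: "f \<in> Lh2 \<alpha>" and p: "p \<in> borel_measurable ?N" "\<And>z. z \<in> unit_disk \<Longrightarrow> cmod (p z) \<le> 1" for f p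
  proof -
    define q where "q z = indicator (ball 0 r) z * p z" for z
    have q: "q \<in> borel_measurable ?N" using p(1) indicator_ball_measurable unfolding q_def by measurable
    have q1: "cmod (q z) \<le> 1" if "z \<in> unit_disk" for z
      using p(2)[OF that] by (auto simp: q_def indicator_def)
    have q1': "(cmod (q z))\<^sup>2 \<le> 1" if "z \<in> unit_disk" for z
      using q1[OF that] by (simp add: power_le_one)
    have iq: "integrable ?N (\<lambda>z. (cmod (q z))\<^sup>2)"
      using q q1' by (intro integrable_weighted_area_bounded[OF assms(1), where B=1]) auto
    then have "q \<in> L2 ?N" using q by (simp add: L2_def)
    have "(cmod (LINT z|?N. f z * q z))\<^sup>2 \<le> (wnorm \<alpha> f)\<^sup>2 * (LINT z|?N. (cmod (q z))\<^sup>2)"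
      using L2_Cauchy_Schwarz[OF Lh2_L2[OF f] \<open>q \<in> L2 ?N\<close>] by (simp add: wnorm_square)
    also have "\<dots> \<le> (wnorm \<alpha> f)\<^sup>2 * (LINT z|?N. 1)"
      using q1' iq by (intro mult_left_mono integral_mono integrable_weighted_area_bounded[OF assms(1), where B=1]) auto
    also have "\<dots> = (wnorm \<alpha> f)\<^sup>2" by (simp only: integral_const_weighted_area[OF assms(1)] mult_1_right)
    finally have "cmod (LINT z|?N. f z * q z) \<le> wnorm \<alpha> f"
      by (rule power2_le_imp_le) (simp add: wnorm_nonneg)
    then show ?thesis by (simp add: q_def mult.left_commute)
  qed
  have fin: "cmod x \<le> (1 / m) * (1 / \<sigma>) ^ n * w"
    if "cmod (x * complex_of_real (moment \<alpha> r n)) \<le> w" for x n w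
  proof -
    have pos: "m * \<sigma> ^ n > 0" using m assms by simp
    have "cmod x * (m * \<sigma> ^ n) \<le> cmod x * moment \<alpha> r n"
      using m' by (intro mult_left_mono) auto
    also have "\<dots> \<le> w" using that m'[of n] pos by (simp add: norm_mult)
    finally show ?thesis using pos m assms by (simp add: field_simps)
  qed
  show thesis
  proof (rule that[of "1 / m"])
    show "1 / m > 0" using m by simp
    fix f a b n assume f: "f \<in> Lh2 \<alpha>" and hs: "harmonic_series a b f"
    note C = harmonic_series_coefficient[OF assms(1) r(1,3) hs]
    show "cmod (a n) \<le> 1 / m * (1 / \<sigma>) ^ n * wnorm \<alpha> f"
    proof (rule fin)
      show "cmod (a n * complex_of_real (moment \<alpha> r n)) \<le> wnorm \<alpha> f"
        unfolding C(1)[symmetric]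
        by (intro key f power_measurable_weighted_area) (simp add: norm_power power_le_one)
    qed
    show "cmod (b n) \<le> 1 / m * (1 / \<sigma>) ^ n * wnorm \<alpha> f"
    proof (cases "n = 0")
      case True
      then show ?thesis using hs m by (simp add: harmonic_series_def wnorm_nonneg)
    next
      case False
      have "cmod (cnj (b n)) \<le> 1 / m * (1 / \<sigma>) ^ n * wnorm \<alpha> f"
      proof (rule fin)
        show "cmod (cnj (b n) * complex_of_real (moment \<alpha> r n)) \<le> wnorm \<alpha> f"
          using False unfolding C(2)[OF False[unfolded neq0_conv], symmetric]
          by (intro key f power_measurable_weighted_area) (simp add: norm_power power_le_one)
      qed
      then show ?thesis by simp
    qed
  qed
qed

text \<open>Tannery's theorem: a common summable majorant lets the limit pass through the sum. The
  majorant is inherited by the limit coefficients and bounds the series uniformly in k.\<close>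

lemma power_series_limit:
  fixes a :: "nat \<Rightarrow> nat \<Rightarrow> complex"
  assumes lim: "\<And>n. (\<lambda>k. a k n) \<longlonglongrightarrow> a' n" and A: "\<And>k n. cmod (a k n) \<le> A n"
    and s: "summable (\<lambda>n. A n * r ^ n)" and z: "cmod z \<le> r"
  shows "(\<lambda>k. \<Sum>n. a k n * z ^ n) \<longlonglongrightarrow> (\<Sum>n. a' n * z ^ n)"
    and "summable (\<lambda>n. cmod (a' n) * r ^ n)"
    and "\<And>k. cmod (\<Sum>n. a k n * z ^ n) \<le> (\<Sum>n. A n * r ^ n)"
proof -
  have r: "r \<ge> 0" using z norm_ge_zero order_trans by blast
  have A0: "A n \<ge> 0" for n using A[of 0 n] norm_ge_zero order_trans by blast
  have b: "cmod (a k n * z ^ n) \<le> A n * r ^ n" for k n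
    unfolding norm_mult norm_power using A z A0 by (intro mult_mono power_mono) auto
  then have "eventually (\<lambda>(n, k). cmod (a k n * z ^ n) \<le> A n * r ^ n) (at_top \<times>\<^sub>F sequentially)"
    by (intro always_eventually) auto
  moreover have "(\<lambda>k. a k n * z ^ n) \<longlonglongrightarrow> a' n * z ^ n" for n
    by (intro tendsto_mult lim tendsto_const)
  ultimately show "(\<lambda>k. \<Sum>n. a k n * z ^ n) \<longlonglongrightarrow> (\<Sum>n. a' n * z ^ n)"
    using tannerys_theorem[OF _ _ s, of "\<lambda>n k. a k n * z ^ n" "\<lambda>n. a' n * z ^ n" sequentially] by simp
  have "cmod (a' n) \<le> A n" for n
    by (rule tendsto_upperbound[OF tendsto_norm[OF lim]]) (use A in auto)
  then show "summable (\<lambda>n. cmod (a' n) * r ^ n)"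
    using r by (intro summable_comparison_test[OF _ s]) (auto intro!: exI[of _ 0] mult_right_mono)
  show "cmod (\<Sum>n. a k n * z ^ n) \<le> (\<Sum>n. A n * r ^ n)" for k
    by (rule norm_suminf_le[OF b s])
qed

lemma summable_geometric_ratio:
  fixes Z r \<sigma> :: real
  assumes "0 \<le> r" "r < \<sigma>"
  shows "summable (\<lambda>n. Z * (1 / \<sigma>) ^ n * r ^ n)"
proof -
  have "summable (\<lambda>n. Z * (r / \<sigma>) ^ n)"
    using assms by (intro summable_mult summable_geometric) auto
  then show ?thesis by (simp add: power_divide power_one_over field_simps)
qed

text \<open>The coefficient bound annihilates every coefficient; the value 1/2 is an arbitrary
  radius. Members of \<open>Lh2\<close> are 0 off the disk, so the equality is one of functions on
  the plane.\<close>

lemma Lh2_wnorm_eq_0: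
  assumes "\<alpha> > -1" "f \<in> Lh2 \<alpha>" "wnorm \<alpha> f = 0"
  shows "f = (\<lambda>z. 0)"
proof
  fix z
  obtain a b where hs: "harmonic_series a b f"
    using harmonic_series_exists[of f] assms(2) by (auto simp: Lh2_def)
  obtain Z where "Z > 0"
    "\<And>f a b n. f \<in> Lh2 \<alpha> \<Longrightarrow> harmonic_series a b f \<Longrightarrow> cmod (a n) \<le> Z * (1 / (1/2)) ^ n * wnorm \<alpha> f"
    "\<And>f a b n. f \<in> Lh2 \<alpha> \<Longrightarrow> harmonic_series a b f \<Longrightarrow> cmod (b n) \<le> Z * (1 / (1/2)) ^ n * wnorm \<alpha> f"
    by (rule coefficient_bound[OF assms(1), of "1/2"]) auto
  from this(2,3)[OF assms(2) hs]
  have "cmod (a n) \<le> 0" "cmod (b n) \<le> 0" for n by (simp_all add: assms(3))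
  then have "a n = 0" "b n = 0" for n by simp_all
  then show "f z = 0"
    using hs assms(2) by (cases "z \<in> unit_disk") (auto simp: harmonic_series_def Lh2_def)
qed

text \<open>The coefficients converge and give a harmonic pointwise limit; Fatou's lemma then turns
  the Cauchy condition into convergence in norm.\<close>

lemma Lh2_complete:
  assumes "\<alpha> > -1" and f: "\<And>j::nat. f j \<in> Lh2 \<alpha>"
    and C: "\<And>e. e > 0 \<Longrightarrow> \<exists>N. \<forall>m\<ge>N. \<forall>n\<ge>N. wnorm \<alpha> (\<lambda>z. f m z - f n z) < e"
  shows "\<exists>g\<in>Lh2 \<alpha>. (\<lambda>j. wnorm \<alpha> (\<lambda>z. f j z - g z)) \<longlonglongrightarrow> 0"
proof -
  have "\<forall>j. \<exists>a b. harmonic_series a b (f j)"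
    using f by (auto simp: Lh2_def intro: harmonic_series_exists)
  then obtain a b where hs: "\<And>j. harmonic_series (a j) (b j) (f j)" by metis
  have hd: "harmonic_series (\<lambda>n. a i n - a j n) (\<lambda>n. b i n - b j n) (\<lambda>z. f i z - f j z)" for i j
    by (intro harmonic_series_diff hs)
  have fd: "(\<lambda>z. f i z - f j z) \<in> Lh2 \<alpha>" for i j by (intro Lh2_diff f)
  obtain N where N: "\<And>m n. m \<ge> N \<Longrightarrow> n \<ge> N \<Longrightarrow> wnorm \<alpha> (\<lambda>z. f m z - f n z) < 1"
    using C[of 1] by auto
  have cauchy: "Cauchy (\<lambda>j. a j n)" "Cauchy (\<lambda>j. b j n)" for n
  proof -
    obtain Z where Z: "Z > 0"
      "\<And>f a b n. f \<in> Lh2 \<alpha> \<Longrightarrow> harmonic_series a b f \<Longrightarrow> cmod (a n) \<le> Z * (1 / (1/2)) ^ n * wnorm \<alpha> f"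
      "\<And>f a b n. f \<in> Lh2 \<alpha> \<Longrightarrow> harmonic_series a b f \<Longrightarrow> cmod (b n) \<le> Z * (1 / (1/2)) ^ n * wnorm \<alpha> f"
      by (rule coefficient_bound[OF assms(1), of "1/2"]) auto
    have "\<exists>M. \<forall>i\<ge>M. \<forall>j\<ge>M. cmod (a i n - a j n) < e \<and> cmod (b i n - b j n) < e" if "e > 0" for e
    proof -
      define P where "P = Z * (1 / (1/2)) ^ n"
      have "P > 0" using Z(1) by (simp add: P_def)
      obtain M where M: "\<And>i j. i \<ge> M \<Longrightarrow> j \<ge> M \<Longrightarrow> wnorm \<alpha> (\<lambda>z. f i z - f j z) < e / P"
        using C[of "e / P"] \<open>P > 0\<close> \<open>e > 0\<close> by (metis divide_pos_pos)
      have "cmod (a i n - a j n) < e \<and> cmod (b i n - b j n) < e" if "i \<ge> M" "j \<ge> M" for i j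
      proof -
        have "P * wnorm \<alpha> (\<lambda>z. f i z - f j z) < e"
          using M[OF that] \<open>P > 0\<close> by (simp add: field_simps)
        then show ?thesis
          using Z(2)[OF fd[of i j] hd[of i j], of n] Z(3)[OF fd[of i j] hd[of i j], of n]
          by (simp add: P_def)
      qed
      then show ?thesis by blast
    qed
    note * = this
    show "Cauchy (\<lambda>j. a j n)"
    proof (rule CauchyI)
      fix e :: real assume "0 < e"
      from *[OF this] show "\<exists>M. \<forall>i\<ge>M. \<forall>j\<ge>M. cmod (a i n - a j n) < e" by blast
    qed
    show "Cauchy (\<lambda>j. b j n)"
    proof (rule CauchyI)
      fix e :: real assume "0 < e"
      from *[OF this] show "\<exists>M. \<forall>i\<ge>M. \<forall>j\<ge>M. cmod (b i n - b j n) < e" by blast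
    qed
  qed
  then obtain a' b' where lim: "\<And>n. (\<lambda>j. a j n) \<longlonglongrightarrow> a' n" "\<And>n. (\<lambda>j. b j n) \<longlonglongrightarrow> b' n"
    unfolding Cauchy_convergent_iff convergent_def by metis
  have L: "(\<lambda>k. \<Sum>n. a (N + k) n * z ^ n) \<longlonglongrightarrow> (\<Sum>n. a' n * z ^ n)"
      "(\<lambda>k. \<Sum>n. b (N + k) n * z ^ n) \<longlonglongrightarrow> (\<Sum>n. b' n * z ^ n)"
      "summable (\<lambda>n. a' n * z ^ n)" "summable (\<lambda>n. b' n * z ^ n)" if z: "cmod z < 1" for z
  proof -
    \<comment> \<open>A radius strictly between |z| and 1 makes the coefficient majorant summable at
      |z|.\<close>
    define \<sigma> where "\<sigma> = (cmod z + 1) / 2"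
    have \<sigma>: "0 < \<sigma>" "cmod z < \<sigma>" "\<sigma> < 1" using z norm_ge_zero[of z] by (simp_all add: \<sigma>_def add_nonneg_pos)
    obtain Z where Z: "Z > 0"
      "\<And>f a b n. f \<in> Lh2 \<alpha> \<Longrightarrow> harmonic_series a b f \<Longrightarrow> cmod (a n) \<le> Z * (1 / \<sigma>) ^ n * wnorm \<alpha> f"
      "\<And>f a b n. f \<in> Lh2 \<alpha> \<Longrightarrow> harmonic_series a b f \<Longrightarrow> cmod (b n) \<le> Z * (1 / \<sigma>) ^ n * wnorm \<alpha> f"
      by (rule coefficient_bound[OF assms(1) \<sigma>(1,3)]) auto
    \<comment> \<open>Comparison with the fixed member \<open>f N\<close> suffices, because all
      later members are within distance 1 of it.\<close>
    have bd: "cmod (a (N + k) n) \<le> cmod (a N n) + Z * (1 / \<sigma>) ^ n"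
      "cmod (b (N + k) n) \<le> cmod (b N n) + Z * (1 / \<sigma>) ^ n" for k n
    proof -
      have "Z * (1 / \<sigma>) ^ n * wnorm \<alpha> (\<lambda>z. f (N + k) z - f N z) \<le> Z * (1 / \<sigma>) ^ n * 1"
        using N[of "N + k" N] Z(1) \<sigma> by (intro mult_left_mono) auto
      then have "cmod (a (N + k) n - a N n) \<le> Z * (1 / \<sigma>) ^ n" "cmod (b (N + k) n - b N n) \<le> Z * (1 / \<sigma>) ^ n"
        using Z(2)[OF fd[of "N + k" N] hd[of "N + k" N], of n] Z(3)[OF fd[of "N + k" N] hd[of "N + k" N], of n]
        by simp_all
      then show "cmod (a (N + k) n) \<le> cmod (a N n) + Z * (1 / \<sigma>) ^ n"
        "cmod (b (N + k) n) \<le> cmod (b N n) + Z * (1 / \<sigma>) ^ n"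
        using norm_triangle_sub[of "a (N + k) n" "a N n"] norm_triangle_sub[of "b (N + k) n" "b N n"] by linarith+
    qed
    have s: "summable (\<lambda>n. (cmod (a N n) + Z * (1 / \<sigma>) ^ n) * cmod z ^ n)"
      "summable (\<lambda>n. (cmod (b N n) + Z * (1 / \<sigma>) ^ n) * cmod z ^ n)"
      using hs[of N] z summable_geometric_ratio[OF norm_ge_zero \<sigma>(2), of Z]
      unfolding distrib_right harmonic_series_def by (auto intro!: summable_add)
    have lim': "(\<lambda>k. a (N + k) n) \<longlonglongrightarrow> a' n" "(\<lambda>k. b (N + k) n) \<longlonglongrightarrow> b' n" for n
      using LIMSEQ_ignore_initial_segment[OF lim(1), of N] LIMSEQ_ignore_initial_segment[OF lim(2), of N]
      by (simp_all add: add.commute)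
    note A = power_series_limit[OF lim'(1) bd(1) s(1) order_refl]
    note B = power_series_limit[OF lim'(2) bd(2) s(2) order_refl]
    show "(\<lambda>k. \<Sum>n. a (N + k) n * z ^ n) \<longlonglongrightarrow> (\<Sum>n. a' n * z ^ n)"
      "(\<lambda>k. \<Sum>n. b (N + k) n * z ^ n) \<longlonglongrightarrow> (\<Sum>n. b' n * z ^ n)" by (rule A B)+
    show "summable (\<lambda>n. a' n * z ^ n)" "summable (\<lambda>n. b' n * z ^ n)"
      using A(2) B(2) by (auto intro: summable_norm_cancel simp: norm_mult norm_power)
  qed
  define g where "g z = (if z \<in> unit_disk then (\<Sum>n. a' n * z ^ n) + cnj (\<Sum>n. b' n * z ^ n) else 0)" for z
  have lim_f: "(\<lambda>k. f (N + k) z) \<longlonglongrightarrow> g z" if z: "z \<in> unit_disk" for z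
  proof -
    have "(\<lambda>k. (\<Sum>n. a (N + k) n * z ^ n) + cnj (\<Sum>n. b (N + k) n * z ^ n)) \<longlonglongrightarrow> g z"
      unfolding g_def using z by (auto intro!: tendsto_intros L)
    moreover have "f (N + k) z = (\<Sum>n. a (N + k) n * z ^ n) + cnj (\<Sum>n. b (N + k) n * z ^ n)" for k
      using hs[of "N + k"] z by (simp add: harmonic_series_def)
    ultimately show ?thesis by simp
  qed
  have harm: "harmonic_on unit_disk g"
    by (rule harmonic_on_summable[of 1 a' b']) (auto simp: g_def intro: L)
  have gm[measurable]: "g \<in> borel_measurable (weighted_area \<alpha>)"
    by (intro continuous_imp_measurable_weighted_area harmonic_on_continuous harm)
  note fm[measurable] = L2_measurable[OF Lh2_L2[OF f]]
  have bound: "(\<lambda>z. f j z - g z) \<in> L2 (weighted_area \<alpha>) \<and> wnorm \<alpha> (\<lambda>z. f j z - g z) \<le> e"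
    if e: "e > 0" and j: "j \<ge> M" and M: "\<And>m n. m \<ge> M \<Longrightarrow> n \<ge> M \<Longrightarrow> wnorm \<alpha> (\<lambda>z. f m z - f n z) < e" for e M j
  proof -
    define u where "u i z = ennreal ((cmod (f j z - f (N + i) z))\<^sup>2)" for i z
    have um: "u i \<in> borel_measurable (weighted_area \<alpha>)" for i unfolding u_def by measurable
    have "(\<integral>\<^sup>+z. ennreal ((cmod (f j z - g z))\<^sup>2) \<partial>weighted_area \<alpha>)
        = (\<integral>\<^sup>+z. liminf (\<lambda>i. u i z) \<partial>weighted_area \<alpha>)"
    proof (rule nn_integral_cong)
      fix z assume "z \<in> space (weighted_area \<alpha>)"
      then have "(\<lambda>i. u i z) \<longlonglongrightarrow> ennreal ((cmod (f j z - g z))\<^sup>2)"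
        unfolding u_def by (intro tendsto_intros lim_f) simp
      then show "ennreal ((cmod (f j z - g z))\<^sup>2) = liminf (\<lambda>i. u i z)"
        by (intro lim_imp_Liminf[symmetric]) auto
    qed
    \<comment> \<open>Fatou's lemma: the integrals on the right are squared distances of two
      members, at most \<open>e\<^sup>2\<close> once both indices are beyond M.\<close>
    also have "\<dots> \<le> liminf (\<lambda>i. \<integral>\<^sup>+z. u i z \<partial>weighted_area \<alpha>)"
      by (rule nn_integral_liminf[OF um])
    also have "\<dots> \<le> ennreal (e\<^sup>2)"
    proof (rule Liminf_le)
      show "\<forall>\<^sub>F i in sequentially. (\<integral>\<^sup>+z. u i z \<partial>weighted_area \<alpha>) \<le> ennreal (e\<^sup>2)"
        using eventually_ge_at_top[of M]
      proof eventually_elim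
        case (elim i)
        have "(\<integral>\<^sup>+z. u i z \<partial>weighted_area \<alpha>) = ennreal ((wnorm \<alpha> (\<lambda>z. f j z - f (N + i) z))\<^sup>2)"
          unfolding u_def wnorm_square
          using L2_integrable[OF Lh2_L2[OF fd]] by (intro nn_integral_eq_integral) auto
        also have "\<dots> \<le> ennreal (e\<^sup>2)"
          using M[OF j, of "N + i"] elim by (intro ennreal_leI power_mono) (auto simp: wnorm_nonneg)
        finally show ?case .
      qed
    qed simp
    finally have le: "(\<integral>\<^sup>+z. ennreal ((cmod (f j z - g z))\<^sup>2) \<partial>weighted_area \<alpha>) \<le> ennreal (e\<^sup>2)" .
    have int: "integrable (weighted_area \<alpha>) (\<lambda>z. (cmod (f j z - g z))\<^sup>2)"
      using le by (intro integrableI_bounded) (auto intro: le_less_trans)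
    then have "ennreal (LINT z|weighted_area \<alpha>. (cmod (f j z - g z))\<^sup>2) \<le> ennreal (e\<^sup>2)"
      using le by (subst nn_integral_eq_integral[symmetric]) auto
    then show ?thesis using int e by (simp add: L2_def wnorm_le_iff)
  qed
  show ?thesis
  proof (rule bexI[of _ g])
    have "(\<lambda>z. f N z - g z) \<in> L2 (weighted_area \<alpha>)" using bound[of 1 N N] N by simp
    from L2_diff[OF Lh2_L2[OF f[of N]] this] have "g \<in> L2 (weighted_area \<alpha>)" by simp
    then show "g \<in> Lh2 \<alpha>" using harm by (auto simp: Lh2_def g_def dest: L2_integrable)
    show "(\<lambda>j. wnorm \<alpha> (\<lambda>z. f j z - g z)) \<longlonglongrightarrow> 0"
    proof (rule LIMSEQ_I)
      fix e :: real assume "e > 0"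
      then obtain M where M: "\<And>m n. m \<ge> M \<Longrightarrow> n \<ge> M \<Longrightarrow> wnorm \<alpha> (\<lambda>z. f m z - f n z) < e / 2"
        using C[of "e / 2"] by (metis half_gt_zero)
      have "norm (wnorm \<alpha> (\<lambda>z. f j z - g z) - 0) < e" if "j \<ge> M" for j
        using bound[OF _ that M] \<open>e > 0\<close> by (simp add: wnorm_nonneg)
      then show "\<exists>no. \<forall>n\<ge>no. norm (wnorm \<alpha> (\<lambda>z. f n z - g z) - 0) < e" by blast
    qed
  qed
qed

section \<open>Minimising a quadratic functional\<close>

lemma linear_coefficient_zero:
  fixes x q :: real
  assumes "\<And>t. 0 \<le> 2 * t * x + t\<^sup>2 * q" "q \<ge> 0"
  shows "x = 0"
proof (rule ccontr)
  assume "x \<noteq> 0"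
  \<comment> \<open>A variant of the minimiser -x / q in which q + 1 avoids division by 0; the value
    there is \<open>- (y\<^sup>2 * (q + 2))\<close>, which is negative.\<close>
  define y where "y = - x / (q + 1)"
  have x: "x = - (y * (q + 1))" using assms(2) by (simp add: y_def)
  have "y \<noteq> 0" using \<open>x \<noteq> 0\<close> x by auto
  have "0 \<le> 2 * y * x + y\<^sup>2 * q" by (rule assms(1))
  also have "\<dots> = - (y\<^sup>2 * (q + 2))" by (simp add: x power2_eq_square algebra_simps)
  finally show False using \<open>y \<noteq> 0\<close> assms(2) by (simp add: mult_le_0_iff)
qed

text \<open>Riesz representation for the weighted form \<open>\<integral> \<psi> f cnj k\<close>: minimise
  \<open>\<integral> \<psi> |f|\<^sup>2 - 2 Re \<integral> g cnj f\<close>. With \<open>\<psi> = 1\<close> this gives the orthogonal projection, and with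
  \<open>\<psi> = \<phi>\<close> the inverse of the Toeplitz operator.\<close>

lemma Lh2_riesz:
  fixes \<psi> :: "complex \<Rightarrow> real"
  assumes "\<alpha> > -1" and \<psi>: "\<psi> \<in> borel_measurable (weighted_area \<alpha>)"
    and \<psi>0: "AE z in weighted_area \<alpha>. 0 \<le> \<psi> z" and \<psi>B: "AE z in weighted_area \<alpha>. \<psi> z \<le> B"
    and "C > 0" and coercive: "\<And>f. f \<in> Lh2 \<alpha> \<Longrightarrow>
      C * (LINT z|weighted_area \<alpha>. (cmod (f z))\<^sup>2) \<le> (LINT z|weighted_area \<alpha>. (cmod (f z))\<^sup>2 * \<psi> z)"
    and g: "g \<in> L2 (weighted_area \<alpha>)"
  shows "\<exists>h\<in>Lh2 \<alpha>. \<forall>k\<in>Lh2 \<alpha>. winner \<alpha> (\<lambda>z. g z - complex_of_real (\<psi> z) * h z) k = 0"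
proof -
  let ?N = "weighted_area \<alpha>"
  define E where "E f k = winner \<alpha> (\<lambda>z. complex_of_real (\<psi> z) * f z) k" for f k
  define Q where "Q f = (LINT z|?N. (cmod (f z))\<^sup>2 * \<psi> z)" for f
  define J where "J f = Q f - 2 * Re (winner \<alpha> g f)" for f
  note [measurable] = \<psi>
  have \<psi>m: "(\<lambda>z. complex_of_real (\<psi> z)) \<in> borel_measurable ?N" by measurable
  have \<psi>B': "AE z in ?N. cmod (complex_of_real (\<psi> z)) \<le> B"
    using \<psi>0 \<psi>B by eventually_elim simp
  have \<psi>L2: "(\<lambda>z. complex_of_real (\<psi> z) * f z) \<in> L2 ?N" if "f \<in> L2 ?N" for f
    by (rule L2_bounded_mult[OF that \<psi>m \<psi>B'])
  have EQ: "E f f = complex_of_real (Q f)" for f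
    unfolding E_def Q_def winner_def integral_complex_of_real[symmetric]
    by (intro Bochner_Integration.integral_cong) (auto simp: complex_norm_square mult_ac simp del: of_real_power)
  have E_sym: "E k f = cnj (E f k)" for f k
    unfolding E_def winner_def
    by (subst Bochner_Integration.integral_cnj[symmetric], rule Bochner_Integration.integral_cong) (auto simp: mult_ac)
  have E_add: "E (\<lambda>z. f z + g z) k = E f k + E g k" if "f \<in> L2 ?N" "g \<in> L2 ?N" "k \<in> L2 ?N" for f g k
    unfolding E_def distrib_left using that by (intro winner_add_left \<psi>L2)
  have E_cmult: "E (\<lambda>z. c * f z) k = c * E f k" for c f k
    unfolding E_def by (simp add: mult.left_commute winner_cmult_left)
  have w_add: "winner \<alpha> g (\<lambda>z. f z + k z) = winner \<alpha> g f + winner \<alpha> g k" if "f \<in> L2 ?N" "k \<in> L2 ?N" for f k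
    using winner_add_left[OF that g] by (subst (1 2 3) winner_cnj) simp
  \<comment> \<open>Along a line the functional is a quadratic polynomial in t. The quadratic
    coefficient yields the Cauchy property of a minimising sequence, the linear one the equation for
    its limit.\<close>
  have expand: "J (\<lambda>z. f z + complex_of_real t * k z) = J f + 2 * t * Re (E f k - winner \<alpha> g k) + t\<^sup>2 * Q k"
    if f: "f \<in> L2 ?N" and k: "k \<in> L2 ?N" for f k t
  proof -
    have tk: "(\<lambda>z. complex_of_real t * k z) \<in> L2 ?N" by (rule L2_cmult[OF k])
    have fk: "(\<lambda>z. f z + complex_of_real t * k z) \<in> L2 ?N" by (rule L2_add[OF f tk])
    have "E (\<lambda>z. f z + complex_of_real t * k z) (\<lambda>z. f z + complex_of_real t * k z)
        = E f (\<lambda>z. f z + complex_of_real t * k z) + t * E k (\<lambda>z. f z + complex_of_real t * k z)"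
      by (simp add: E_add f tk fk E_cmult)
    also have "\<dots> = (Q f + t * cnj (E k f)) + t * (cnj (E f k) + t * Q k)"
      unfolding E_sym[of f "\<lambda>z. f z + complex_of_real t * k z"] E_sym[of k "\<lambda>z. f z + complex_of_real t * k z"]
      by (simp add: E_add f k tk E_cmult EQ)
    finally have "Re (E (\<lambda>z. f z + complex_of_real t * k z) (\<lambda>z. f z + complex_of_real t * k z))
        = Re ((Q f + t * cnj (E k f)) + t * (cnj (E f k) + t * Q k))"
      by (rule arg_cong)
    also have "\<dots> = Q f + 2 * t * Re (E f k) + t\<^sup>2 * Q k"
      unfolding E_sym[of f k] by (simp add: power2_eq_square algebra_simps)
    finally have "Q (\<lambda>z. f z + complex_of_real t * k z) = Q f + 2 * t * Re (E f k) + t\<^sup>2 * Q k"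
      by (simp add: EQ)
    then show ?thesis
      unfolding J_def by (simp add: w_add f tk winner_cmult_right algebra_simps)
  qed
  have Q_lower: "C * (wnorm \<alpha> f)\<^sup>2 \<le> Q f" if "f \<in> Lh2 \<alpha>" for f
    using coercive[OF that] by (simp add: Q_def wnorm_square)
  \<comment> \<open>Completing the square: with x the norm of f and y that of g, C x^2 - 2 x y is at
    least -y^2 / C.\<close>
  have J_lower: "- ((wnorm \<alpha> g)\<^sup>2 / C) \<le> J f" if f: "f \<in> Lh2 \<alpha>" for f
  proof -
    have "Re (winner \<alpha> g f) \<le> wnorm \<alpha> g * wnorm \<alpha> f"
      using complex_Re_le_cmod winner_Cauchy_Schwarz[OF g Lh2_L2[OF f]] by (rule order_trans)
    then have "C * (wnorm \<alpha> f)\<^sup>2 - 2 * (wnorm \<alpha> g * wnorm \<alpha> f) \<le> J f"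
      using Q_lower[OF f] unfolding J_def by linarith
    moreover have "0 \<le> (C * wnorm \<alpha> f - wnorm \<alpha> g)\<^sup>2 / C" using \<open>C > 0\<close> by simp
    then have "- ((wnorm \<alpha> g)\<^sup>2 / C) \<le> C * (wnorm \<alpha> f)\<^sup>2 - 2 * (wnorm \<alpha> g * wnorm \<alpha> f)"
      using \<open>C > 0\<close> by (simp add: field_simps power2_eq_square)
    ultimately show ?thesis by linarith
  qed
  define d where "d = Inf (J ` Lh2 \<alpha>)"
  have zero: "(\<lambda>z. 0) \<in> Lh2 \<alpha>"
    by (auto simp: Lh2_def intro!: harmonic_on_holomorphic_parts[of _ "\<lambda>z. 0" "\<lambda>z. 0"])
  have bdd: "bdd_below (J ` Lh2 \<alpha>)" using J_lower by (auto simp: bdd_below_def)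
  have d_le: "d \<le> J f" if "f \<in> Lh2 \<alpha>" for f
    unfolding d_def using that by (intro cInf_lower bdd) auto
  have "\<exists>f\<in>Lh2 \<alpha>. J f < d + 1 / real (Suc n)" for n
  proof -
    have "\<exists>x\<in>J ` Lh2 \<alpha>. x < d + 1 / real (Suc n)"
      using zero bdd by (subst cInf_less_iff[symmetric]) (auto simp: d_def[symmetric])
    then show ?thesis by blast
  qed
  then obtain f where f: "\<And>n. f n \<in> Lh2 \<alpha>" and fJ: "\<And>n. J (f n) < d + 1 / real (Suc n)" by metis
  note fL = Lh2_L2[OF f]
  \<comment> \<open>Parallelogram argument: the midpoint of two near minimisers cannot lie below the
    infimum, so the quadratic form of their difference is small; coercivity converts this into a
    norm.\<close>
  have near: "C * (wnorm \<alpha> (\<lambda>z. f m z - f n z))\<^sup>2 \<le> 2 / real (Suc m) + 2 / real (Suc n)" for m n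
  proof -
    define k where "k z = f m z - f n z" for z
    have k: "k \<in> Lh2 \<alpha>" unfolding k_def by (intro Lh2_diff f)
    have mid: "(\<lambda>z. f n z + complex_of_real (1/2) * k z) \<in> Lh2 \<alpha>" by (intro Lh2_add Lh2_cmult f k)
    have "J (\<lambda>z. f n z + complex_of_real (1/2) * k z) = J (f n) + Re (E (f n) k - winner \<alpha> g k) + Q k / 4"
      by (subst expand[OF fL Lh2_L2[OF k]]) (simp add: power2_eq_square)
    moreover have "J (f m) = J (f n) + 2 * Re (E (f n) k - winner \<alpha> g k) + Q k"
      using expand[OF fL[of n] Lh2_L2[OF k], of 1] by (simp add: k_def)
    ultimately have "Q k = 2 * J (f n) + 2 * J (f m) - 4 * J (\<lambda>z. f n z + complex_of_real (1/2) * k z)"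
      by linarith
    also have "\<dots> \<le> 2 / real (Suc m) + 2 / real (Suc n)"
      using d_le[OF mid] fJ[of n] fJ[of m] by simp
    finally have "C * (wnorm \<alpha> k)\<^sup>2 \<le> 2 / real (Suc m) + 2 / real (Suc n)" using Q_lower[OF k] by simp
    then show ?thesis unfolding k_def[abs_def] .
  qed
  have cauchy: "\<exists>N. \<forall>m\<ge>N. \<forall>n\<ge>N. wnorm \<alpha> (\<lambda>z. f m z - f n z) < e" if "e > 0" for e
  proof -
    obtain N where N: "inverse (real (Suc N)) < C * e\<^sup>2 / 4"
      using reals_Archimedean[of "C * e\<^sup>2 / 4"] \<open>e > 0\<close> \<open>C > 0\<close> by auto
    have "wnorm \<alpha> (\<lambda>z. f m z - f n z) < e" if "m \<ge> N" "n \<ge> N" for m n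
    proof -
      have "inverse (real (Suc m)) \<le> inverse (real (Suc N))" "inverse (real (Suc n)) \<le> inverse (real (Suc N))"
        using that by simp_all
      moreover have "C * (wnorm \<alpha> (\<lambda>z. f m z - f n z))\<^sup>2
          \<le> 2 * inverse (real (Suc m)) + 2 * inverse (real (Suc n))"
        using near[of m n] by (simp only: divide_inverse)
      ultimately have "C * (wnorm \<alpha> (\<lambda>z. f m z - f n z))\<^sup>2 < C * e\<^sup>2"
        using N by linarith
      then have "(wnorm \<alpha> (\<lambda>z. f m z - f n z))\<^sup>2 < e\<^sup>2"
        using \<open>C > 0\<close> mult_less_cancel_left_pos by blast
      then show ?thesis using less_imp_le[OF \<open>e > 0\<close>] by (rule power2_less_imp_less)
    qed
    then show ?thesis by blast
  qed
  obtain h where h: "h \<in> Lh2 \<alpha>" and lim: "(\<lambda>j. wnorm \<alpha> (\<lambda>z. f j z - h z)) \<longlonglongrightarrow> 0"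
    using Lh2_complete[of \<alpha> f, OF assms(1) f cauchy] ..
  \<comment> \<open>Boundedness of the symbol makes \<open>E\<close> continuous in its first
    argument, which allows the passage from the sequence to its limit.\<close>
  have B0: "wnorm \<alpha> (\<lambda>z. complex_of_real (\<psi> z) * u z) \<le> \<bar>B\<bar> * wnorm \<alpha> u" if u: "u \<in> L2 ?N" for u
  proof -
    have "(LINT z|?N. (cmod (complex_of_real (\<psi> z) * u z))\<^sup>2) \<le> (LINT z|?N. B\<^sup>2 * (cmod (u z))\<^sup>2)"
    proof (rule integral_mono_AE)
      show "AE z in ?N. (cmod (complex_of_real (\<psi> z) * u z))\<^sup>2 \<le> B\<^sup>2 * (cmod (u z))\<^sup>2"
        using \<psi>B'
      proof eventually_elim
        case (elim z)
        then have "(cmod (complex_of_real (\<psi> z)))\<^sup>2 \<le> B\<^sup>2" by (intro power_mono norm_ge_zero)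
        then show ?case unfolding norm_mult power_mult_distrib by (intro mult_right_mono zero_le_power2)
      qed
    qed (use L2_integrable[OF u] L2_integrable[OF \<psi>L2[OF u]] in auto)
    then show ?thesis
      by (subst wnorm_le_iff) (simp_all add: wnorm_nonneg power_mult_distrib wnorm_square)
  qed
  have e_lim: "(\<lambda>n. E (f n) k - winner \<alpha> g k) \<longlonglongrightarrow> E h k - winner \<alpha> g k" if k: "k \<in> Lh2 \<alpha>" for k
  proof -
    have dL: "(\<lambda>z. f n z - h z) \<in> L2 ?N" for n by (intro L2_diff fL Lh2_L2 h)
    have "cmod (E (f n) k - E h k) \<le> \<bar>B\<bar> * wnorm \<alpha> k * wnorm \<alpha> (\<lambda>z. f n z - h z)" for n
    proof -
      have "E (f n) k - E h k = E (\<lambda>z. f n z - h z) k"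
        using E_add[OF dL Lh2_L2[OF h] Lh2_L2[OF k], of n] by simp
      also have "cmod \<dots> \<le> wnorm \<alpha> (\<lambda>z. complex_of_real (\<psi> z) * (f n z - h z)) * wnorm \<alpha> k"
        unfolding E_def by (intro winner_Cauchy_Schwarz \<psi>L2 dL Lh2_L2 k)
      also have "\<dots> \<le> (\<bar>B\<bar> * wnorm \<alpha> (\<lambda>z. f n z - h z)) * wnorm \<alpha> k"
        by (intro mult_right_mono B0 dL wnorm_nonneg)
      finally show ?thesis by (simp add: mult_ac)
    qed
    then have bd: "\<forall>\<^sub>F n in sequentially. norm (E (f n) k - E h k) \<le> \<bar>B\<bar> * wnorm \<alpha> k * wnorm \<alpha> (\<lambda>z. f n z - h z)"
      by (intro always_eventually allI)
    have "(\<lambda>n. \<bar>B\<bar> * wnorm \<alpha> k * wnorm \<alpha> (\<lambda>z. f n z - h z)) \<longlonglongrightarrow> 0"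
      by (rule tendsto_mult_right_zero[OF lim])
    with bd have "(\<lambda>n. E (f n) k - E h k) \<longlonglongrightarrow> 0" by (rule Lim_null_comparison)
    then have "(\<lambda>n. E (f n) k) \<longlonglongrightarrow> E h k" by (rule LIM_zero_cancel)
    then show ?thesis by (intro tendsto_diff tendsto_const)
  qed
  have Re0: "Re (E h k - winner \<alpha> g k) = 0" if k: "k \<in> Lh2 \<alpha>" for k
  proof (rule linear_coefficient_zero[where q="Q k"])
    have "0 \<le> C * (wnorm \<alpha> k)\<^sup>2" using \<open>C > 0\<close> by simp
    then show "0 \<le> Q k" using Q_lower[OF k] by linarith
    fix t :: real
    \<comment> \<open>\<open>f n\<close> is within 1 / (n + 1) of the infimum, so a variation lowers
      the functional by at most that much; the limit removes the slack.\<close>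
    have "(\<lambda>n. 1 / real (Suc n) + 2 * t * Re (E (f n) k - winner \<alpha> g k) + t\<^sup>2 * Q k)
        \<longlonglongrightarrow> 0 + 2 * t * Re (E h k - winner \<alpha> g k) + t\<^sup>2 * Q k"
      by (intro tendsto_intros e_lim k LIMSEQ_Suc[OF lim_1_over_n])
    moreover have "0 \<le> 1 / real (Suc n) + 2 * t * Re (E (f n) k - winner \<alpha> g k) + t\<^sup>2 * Q k" for n
      using d_le[OF Lh2_add[OF f[of n] Lh2_cmult[OF k, of "complex_of_real t"]]] fJ[of n]
        expand[OF fL[of n] Lh2_L2[OF k], of t] by linarith
    ultimately show "0 \<le> 2 * t * Re (E h k - winner \<alpha> g k) + t\<^sup>2 * Q k"
      using LIMSEQ_le_const[of _ "0 + 2 * t * Re (E h k - winner \<alpha> g k) + t\<^sup>2 * Q k" 0] by auto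
  qed
  \<comment> \<open>Replacing k by \<i> k turns the real part into the imaginary part, so the
    complex equation follows from the real one.\<close>
  have zero': "E h k - winner \<alpha> g k = 0" if k: "k \<in> Lh2 \<alpha>" for k
  proof -
    have "E h (\<lambda>z. \<i> * k z) = - \<i> * E h k" by (subst (1 2) E_sym) (simp add: E_cmult)
    then have "E h (\<lambda>z. \<i> * k z) - winner \<alpha> g (\<lambda>z. \<i> * k z) = - \<i> * (E h k - winner \<alpha> g k)"
      by (simp add: winner_cmult_right algebra_simps)
    then have "Im (E h k - winner \<alpha> g k) = 0" using Re0[OF Lh2_cmult[OF k, of \<i>]] by simp
    with Re0[OF k] show ?thesis by (simp add: complex_eq_iff)
  qed
  show ?thesis
  proof (intro bexI[OF _ h] ballI)
    fix k assume k: "k \<in> Lh2 \<alpha>"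
    have "winner \<alpha> (\<lambda>z. g z - complex_of_real (\<psi> z) * h z) k = winner \<alpha> g k - E h k"
      unfolding E_def by (intro winner_diff_left g \<psi>L2 Lh2_L2 h k)
    then show "winner \<alpha> (\<lambda>z. g z - complex_of_real (\<psi> z) * h z) k = 0" using zero'[OF k] by simp
  qed
qed

section \<open>Invertibility of Toeplitz operators\<close>

text \<open>The constant is a parameter because 1 / C becomes the norm bound of the inverse
  operator.\<close>

definition coercive :: "real \<Rightarrow> (complex \<Rightarrow> real) \<Rightarrow> real \<Rightarrow> bool" where
  "coercive \<alpha> \<psi> C \<longleftrightarrow> C > 0 \<and> (\<forall>f\<in>Lh2 \<alpha>.
     (LINT z|weighted_area \<alpha>. (cmod (f z))\<^sup>2 * \<psi> z) \<ge> C * (LINT z|weighted_area \<alpha>. (cmod (f z))\<^sup>2))"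

definition bounded_symbol :: "real \<Rightarrow> (complex \<Rightarrow> real) \<Rightarrow> real \<Rightarrow> bool" where
  "bounded_symbol \<alpha> \<psi> B \<longleftrightarrow> \<psi> \<in> borel_measurable (weighted_area \<alpha>) \<and>
     (AE z in weighted_area \<alpha>. 0 \<le> \<psi> z \<and> \<psi> z \<le> B)"

text \<open>Weak form of \<psi> h = g: the residual is orthogonal to the whole space. For \<psi> = 1
  the description is that of \<open>proj_Lh2\<close>, so that uniqueness, linearity and norm bounds
  are proved once for both uses.\<close>

definition solve :: "real \<Rightarrow> (complex \<Rightarrow> real) \<Rightarrow> (complex \<Rightarrow> complex) \<Rightarrow> complex \<Rightarrow> complex" where
  "solve \<alpha> \<psi> g = (THE h. h \<in> Lh2 \<alpha> \<and>
     (\<forall>k\<in>Lh2 \<alpha>. winner \<alpha> (\<lambda>z. g z - complex_of_real (\<psi> z) * h z) k = 0))"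

lemma proj_Lh2_eq_solve: "proj_Lh2 \<alpha> g = solve \<alpha> (\<lambda>_. 1) g"
  by (simp add: proj_Lh2_def solve_def)

lemma coercive_1: "coercive \<alpha> (\<lambda>_. 1) 1"
  by (simp add: coercive_def)

lemma bounded_symbol_1: "bounded_symbol \<alpha> (\<lambda>_. 1) 1"
  by (simp add: bounded_symbol_def)

lemma bounded_symbol_mult_L2:
  assumes "bounded_symbol \<alpha> \<psi> B" "f \<in> L2 (weighted_area \<alpha>)"
  shows "(\<lambda>z. complex_of_real (\<psi> z) * f z) \<in> L2 (weighted_area \<alpha>)"
proof (rule L2_bounded_mult[OF assms(2)])
  have [measurable]: "\<psi> \<in> borel_measurable (weighted_area \<alpha>)"
    using assms(1) by (simp add: bounded_symbol_def)
  show "(\<lambda>z. complex_of_real (\<psi> z)) \<in> borel_measurable (weighted_area \<alpha>)" by measurable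
  have "AE z in weighted_area \<alpha>. 0 \<le> \<psi> z \<and> \<psi> z \<le> B"
    using assms(1) by (simp add: bounded_symbol_def)
  then show "AE z in weighted_area \<alpha>. cmod (complex_of_real (\<psi> z)) \<le> B"
    by eventually_elim simp
qed

lemma winner_symbol_self:
  "winner \<alpha> (\<lambda>z. complex_of_real (\<psi> z) * h z) h
    = complex_of_real (LINT z|weighted_area \<alpha>. (cmod (h z))\<^sup>2 * \<psi> z)"
  unfolding winner_def integral_complex_of_real[symmetric]
  by (intro Bochner_Integration.integral_cong)
    (auto simp: complex_norm_square mult_ac simp del: of_real_power)

text \<open>Testing the equation with k = h gives C times the squared norm of h on the left and the
  inner product of g and h on the right; Cauchy-Schwarz then cancels one factor.\<close>

lemma Lh2_solution_norm:
  assumes \<psi>: "bounded_symbol \<alpha> \<psi> B" "coercive \<alpha> \<psi> C" and g: "g \<in> L2 (weighted_area \<alpha>)"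
    and h: "h \<in> Lh2 \<alpha>" "\<forall>k\<in>Lh2 \<alpha>. winner \<alpha> (\<lambda>z. g z - complex_of_real (\<psi> z) * h z) k = 0"
  shows "wnorm \<alpha> h \<le> (1 / C) * wnorm \<alpha> g"
proof -
  have C: "C > 0" using \<psi> by (simp add: coercive_def)
  have "winner \<alpha> g h = winner \<alpha> (\<lambda>z. complex_of_real (\<psi> z) * h z) h"
    using bspec[OF h(2,1)] winner_diff_left[OF g bounded_symbol_mult_L2[OF \<psi>(1) Lh2_L2[OF h(1)]] Lh2_L2[OF h(1)]]
    by simp
  then have "C * (wnorm \<alpha> h)\<^sup>2 \<le> Re (winner \<alpha> g h)"
    using \<psi>(2) h(1) by (simp add: winner_symbol_self coercive_def wnorm_square)
  also have "\<dots> \<le> wnorm \<alpha> g * wnorm \<alpha> h"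
    by (rule order_trans[OF complex_Re_le_cmod winner_Cauchy_Schwarz[OF g Lh2_L2[OF h(1)]]])
  finally have *: "(C * wnorm \<alpha> h) * wnorm \<alpha> h \<le> wnorm \<alpha> g * wnorm \<alpha> h"
    by (simp add: power2_eq_square mult.assoc)
  show ?thesis
  proof (cases "wnorm \<alpha> h = 0")
    case True
    then show ?thesis using C by (simp add: wnorm_nonneg)
  next
    case False
    then have "C * wnorm \<alpha> h \<le> wnorm \<alpha> g"
      using * wnorm_nonneg[of \<alpha> h] mult_le_cancel_right_pos[of "wnorm \<alpha> h"] by simp
    then show ?thesis using C by (simp add: field_simps)
  qed
qed

text \<open>The difference of two solutions solves the problem with datum 0, so the norm estimate
  makes its norm 0.\<close>

lemma solve_eqI:
  assumes \<alpha>: "\<alpha> > -1" and \<psi>: "bounded_symbol \<alpha> \<psi> B" "coercive \<alpha> \<psi> C" and g: "g \<in> L2 (weighted_area \<alpha>)"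
    and h: "h \<in> Lh2 \<alpha>" "\<forall>k\<in>Lh2 \<alpha>. winner \<alpha> (\<lambda>z. g z - complex_of_real (\<psi> z) * h z) k = 0"
  shows "solve \<alpha> \<psi> g = h"
  unfolding solve_def
proof (rule the_equality)
  fix h' assume h': "h' \<in> Lh2 \<alpha> \<and> (\<forall>k\<in>Lh2 \<alpha>. winner \<alpha> (\<lambda>z. g z - complex_of_real (\<psi> z) * h' z) k = 0)"
  let ?L = "L2 (weighted_area \<alpha>)"
  have L: "(\<lambda>z. complex_of_real (\<psi> z) * h z) \<in> ?L" "(\<lambda>z. complex_of_real (\<psi> z) * h' z) \<in> ?L"
    using h h' by (auto intro: bounded_symbol_mult_L2[OF \<psi>(1)] Lh2_L2)
  have d: "(\<lambda>z. h' z - h z) \<in> Lh2 \<alpha>" using h h' by (intro Lh2_diff) auto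
  have zero: "(\<lambda>z. 0) \<in> ?L" by (simp add: L2_def)
  have "wnorm \<alpha> (\<lambda>z. h' z - h z) \<le> (1 / C) * wnorm \<alpha> (\<lambda>z. 0)"
  proof (rule Lh2_solution_norm[OF \<psi> zero d], intro ballI)
    fix k assume k: "k \<in> Lh2 \<alpha>"
    have "winner \<alpha> (\<lambda>z. 0 - complex_of_real (\<psi> z) * (h' z - h z)) k
        = winner \<alpha> (\<lambda>z. (g z - complex_of_real (\<psi> z) * h' z) - (g z - complex_of_real (\<psi> z) * h z)) k"
      by (simp add: right_diff_distrib)
    also have "\<dots> = winner \<alpha> (\<lambda>z. g z - complex_of_real (\<psi> z) * h' z) k - winner \<alpha> (\<lambda>z. g z - complex_of_real (\<psi> z) * h z) k"
      by (intro winner_diff_left L2_diff g L Lh2_L2 k)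
    also have "\<dots> = 0" using h(2) h' k by simp
    finally show "winner \<alpha> (\<lambda>z. 0 - complex_of_real (\<psi> z) * (h' z - h z)) k = 0" .
  qed
  moreover have "wnorm \<alpha> (\<lambda>z. 0) = 0" by (simp add: wnorm_def)
  ultimately have "wnorm \<alpha> (\<lambda>z. h' z - h z) = 0"
    using wnorm_nonneg[of \<alpha> "\<lambda>z. h' z - h z"] by (intro antisym) simp_all
  from Lh2_wnorm_eq_0[OF \<alpha> d this] show "h' = h" by (simp add: fun_eq_iff)
qed (use h in auto)

lemma solve:
  assumes \<alpha>: "\<alpha> > -1" and \<psi>: "bounded_symbol \<alpha> \<psi> B" "coercive \<alpha> \<psi> C" and g: "g \<in> L2 (weighted_area \<alpha>)"
  shows "solve \<alpha> \<psi> g \<in> Lh2 \<alpha>"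
    and "\<forall>k\<in>Lh2 \<alpha>. winner \<alpha> (\<lambda>z. g z - complex_of_real (\<psi> z) * solve \<alpha> \<psi> g z) k = 0"
    and "wnorm \<alpha> (solve \<alpha> \<psi> g) \<le> (1 / C) * wnorm \<alpha> g"
proof -
  have m: "\<psi> \<in> borel_measurable (weighted_area \<alpha>)" and "AE z in weighted_area \<alpha>. 0 \<le> \<psi> z \<and> \<psi> z \<le> B"
    using \<psi> by (simp_all add: bounded_symbol_def)
  then have "AE z in weighted_area \<alpha>. 0 \<le> \<psi> z" "AE z in weighted_area \<alpha>. \<psi> z \<le> B" by auto
  then have "\<exists>h\<in>Lh2 \<alpha>. \<forall>k\<in>Lh2 \<alpha>. winner \<alpha> (\<lambda>z. g z - complex_of_real (\<psi> z) * h z) k = 0"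
    using \<psi>(2) by (intro Lh2_riesz[OF \<alpha> m, where C=C and B=B] g) (simp_all add: coercive_def)
  then obtain h where h: "h \<in> Lh2 \<alpha>" "\<forall>k\<in>Lh2 \<alpha>. winner \<alpha> (\<lambda>z. g z - complex_of_real (\<psi> z) * h z) k = 0" ..
  have eq: "solve \<alpha> \<psi> g = h" by (rule solve_eqI[OF \<alpha> \<psi> g h])
  show "solve \<alpha> \<psi> g \<in> Lh2 \<alpha>"
    "\<forall>k\<in>Lh2 \<alpha>. winner \<alpha> (\<lambda>z. g z - complex_of_real (\<psi> z) * solve \<alpha> \<psi> g z) k = 0"
    unfolding eq by (rule h)+
  show "wnorm \<alpha> (solve \<alpha> \<psi> g) \<le> (1 / C) * wnorm \<alpha> g"
    unfolding eq by (rule Lh2_solution_norm[OF \<psi> g h])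
qed

text \<open>Linearity is a consequence of uniqueness: the sum of the solutions satisfies the
  orthogonality relations for the sum of the data.\<close>

lemma solve_add:
  assumes \<alpha>: "\<alpha> > -1" and \<psi>: "bounded_symbol \<alpha> \<psi> B" "coercive \<alpha> \<psi> C"
    and f: "f \<in> L2 (weighted_area \<alpha>)" and g: "g \<in> L2 (weighted_area \<alpha>)"
  shows "solve \<alpha> \<psi> (\<lambda>z. f z + g z) = (\<lambda>z. solve \<alpha> \<psi> f z + solve \<alpha> \<psi> g z)"
proof (rule solve_eqI[OF \<alpha> \<psi> L2_add[OF f g] Lh2_add])
  note F = solve[OF \<alpha> \<psi> f] and G = solve[OF \<alpha> \<psi> g]
  show "solve \<alpha> \<psi> f \<in> Lh2 \<alpha>" "solve \<alpha> \<psi> g \<in> Lh2 \<alpha>" by (rule F G)+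
  show "\<forall>k\<in>Lh2 \<alpha>. winner \<alpha> (\<lambda>z. (f z + g z) - complex_of_real (\<psi> z) * (solve \<alpha> \<psi> f z + solve \<alpha> \<psi> g z)) k = 0"
  proof
    fix k assume k: "k \<in> Lh2 \<alpha>"
    have "winner \<alpha> (\<lambda>z. (f z + g z) - complex_of_real (\<psi> z) * (solve \<alpha> \<psi> f z + solve \<alpha> \<psi> g z)) k
      = winner \<alpha> (\<lambda>z. (f z - complex_of_real (\<psi> z) * solve \<alpha> \<psi> f z) + (g z - complex_of_real (\<psi> z) * solve \<alpha> \<psi> g z)) k"
      by (simp add: algebra_simps)
    also have "\<dots> = winner \<alpha> (\<lambda>z. f z - complex_of_real (\<psi> z) * solve \<alpha> \<psi> f z) k
        + winner \<alpha> (\<lambda>z. g z - complex_of_real (\<psi> z) * solve \<alpha> \<psi> g z) k"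
      by (intro winner_add_left L2_diff f g bounded_symbol_mult_L2[OF \<psi>(1)] Lh2_L2 F(1) G(1) k)
    also have "\<dots> = 0" using F(2) G(2) k by simp
    finally show "winner \<alpha> (\<lambda>z. (f z + g z) - complex_of_real (\<psi> z) * (solve \<alpha> \<psi> f z + solve \<alpha> \<psi> g z)) k = 0" .
  qed
qed

lemma solve_cmult:
  assumes \<alpha>: "\<alpha> > -1" and \<psi>: "bounded_symbol \<alpha> \<psi> B" "coercive \<alpha> \<psi> C"
    and f: "f \<in> L2 (weighted_area \<alpha>)"
  shows "solve \<alpha> \<psi> (\<lambda>z. c * f z) = (\<lambda>z. c * solve \<alpha> \<psi> f z)"
proof (rule solve_eqI[OF \<alpha> \<psi> L2_cmult[OF f] Lh2_cmult])
  note F = solve[OF \<alpha> \<psi> f]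
  show "solve \<alpha> \<psi> f \<in> Lh2 \<alpha>" by (rule F)
  show "\<forall>k\<in>Lh2 \<alpha>. winner \<alpha> (\<lambda>z. c * f z - complex_of_real (\<psi> z) * (c * solve \<alpha> \<psi> f z)) k = 0"
  proof
    fix k assume k: "k \<in> Lh2 \<alpha>"
    have "winner \<alpha> (\<lambda>z. c * f z - complex_of_real (\<psi> z) * (c * solve \<alpha> \<psi> f z)) k
      = winner \<alpha> (\<lambda>z. c * (f z - complex_of_real (\<psi> z) * solve \<alpha> \<psi> f z)) k"
      by (simp add: algebra_simps)
    then show "winner \<alpha> (\<lambda>z. c * f z - complex_of_real (\<psi> z) * (c * solve \<alpha> \<psi> f z)) k = 0"
      using F(2) k by (simp add: winner_cmult_left)
  qed
qed

text \<open>The projection is a contraction. The second bound keeps \<phi> f on the right instead of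
  |B| times the norm of f; the implication from invertibility to coercivity needs this sharper
  form.\<close>

lemma bounded_operator_toeplitz:
  assumes \<alpha>: "\<alpha> > -1" and \<phi>: "bounded_symbol \<alpha> \<phi> B"
  shows "bounded_operator_Lh2 \<alpha> (toeplitz \<alpha> (\<lambda>z. complex_of_real (\<phi> z)))"
    and "\<And>f. f \<in> Lh2 \<alpha> \<Longrightarrow> wnorm \<alpha> (toeplitz \<alpha> (\<lambda>z. complex_of_real (\<phi> z)) f)
      \<le> wnorm \<alpha> (\<lambda>z. complex_of_real (\<phi> z) * f z)"
proof -
  let ?T = "toeplitz \<alpha> (\<lambda>z. complex_of_real (\<phi> z))"
  note m = bounded_symbol_mult_L2[OF \<phi> Lh2_L2]
  have T: "?T f = solve \<alpha> (\<lambda>_. 1) (\<lambda>z. complex_of_real (\<phi> z) * f z)" for f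
    by (simp add: toeplitz_def proj_Lh2_eq_solve)
  note S = solve[OF \<alpha> bounded_symbol_1 coercive_1 m]
  show le: "wnorm \<alpha> (?T f) \<le> wnorm \<alpha> (\<lambda>z. complex_of_real (\<phi> z) * f z)" if "f \<in> Lh2 \<alpha>" for f
    using S(3)[OF that] by (simp add: T)
  have le2: "wnorm \<alpha> (\<lambda>z. complex_of_real (\<phi> z) * f z) \<le> \<bar>B\<bar> * wnorm \<alpha> f" if f: "f \<in> Lh2 \<alpha>" for f
  proof -
    have b: "AE z in weighted_area \<alpha>. 0 \<le> \<phi> z \<and> \<phi> z \<le> B"
      using \<phi> by (simp add: bounded_symbol_def)
    have "(LINT z|weighted_area \<alpha>. (cmod (complex_of_real (\<phi> z) * f z))\<^sup>2) \<le> (LINT z|weighted_area \<alpha>. B\<^sup>2 * (cmod (f z))\<^sup>2)"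
    proof (rule integral_mono_AE)
      show "AE z in weighted_area \<alpha>. (cmod (complex_of_real (\<phi> z) * f z))\<^sup>2 \<le> B\<^sup>2 * (cmod (f z))\<^sup>2"
        using b
      proof eventually_elim
        case (elim z)
        then have "(cmod (complex_of_real (\<phi> z)))\<^sup>2 \<le> B\<^sup>2" by (intro power_mono norm_ge_zero) simp
        then show ?case unfolding norm_mult power_mult_distrib by (intro mult_right_mono zero_le_power2)
      qed
    qed (use L2_integrable[OF Lh2_L2[OF f]] L2_integrable[OF m[OF f]] in auto)
    then show ?thesis
      by (subst wnorm_le_iff) (simp_all add: wnorm_nonneg power_mult_distrib wnorm_square)
  qed
  show "bounded_operator_Lh2 \<alpha> ?T"
    unfolding bounded_operator_Lh2_def
  proof (intro conjI ballI allI exI[of _ "\<bar>B\<bar>"])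
    fix f g assume f: "f \<in> Lh2 \<alpha>" and g: "g \<in> Lh2 \<alpha>"
    show "?T (\<lambda>z. f z + g z) = (\<lambda>z. ?T f z + ?T g z)"
      unfolding T distrib_left by (rule solve_add[OF \<alpha> bounded_symbol_1 coercive_1 m[OF f] m[OF g]])
  next
    fix f c assume f: "f \<in> Lh2 \<alpha>"
    show "?T (\<lambda>z. c * f z) = (\<lambda>z. c * ?T f z)"
      unfolding T mult.left_commute[of _ c] by (rule solve_cmult[OF \<alpha> bounded_symbol_1 coercive_1 m[OF f]])
  next
    fix f assume f: "f \<in> Lh2 \<alpha>"
    show "?T f \<in> Lh2 \<alpha>" unfolding T by (rule S(1)[OF f])
    show "wnorm \<alpha> (?T f) \<le> \<bar>B\<bar> * wnorm \<alpha> f" using le[OF f] le2[OF f] by (rule order_trans)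
  qed
qed

text \<open>The inverse is \<open>solve \<alpha> \<phi>\<close>. That T f - \<phi> f is orthogonal
  to the space says both that T f is the projection of \<phi> f and that f solves the weak problem
  with datum T f; uniqueness then identifies the two compositions.\<close>

lemma coercive_imp_invertible:
  assumes \<alpha>: "\<alpha> > -1" and \<phi>: "bounded_symbol \<alpha> \<phi> B" "coercive \<alpha> \<phi> C"
  shows "invertible_on_Lh2 \<alpha> (toeplitz \<alpha> (\<lambda>z. complex_of_real (\<phi> z)))"
  unfolding invertible_on_Lh2_def
proof (intro conjI exI[of _ "solve \<alpha> \<phi>"] ballI)
  let ?T = "toeplitz \<alpha> (\<lambda>z. complex_of_real (\<phi> z))"
  show "bounded_operator_Lh2 \<alpha> ?T" by (rule bounded_operator_toeplitz[OF \<alpha> \<phi>(1)])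
  note S = solve[OF \<alpha> \<phi> Lh2_L2]
  show "bounded_operator_Lh2 \<alpha> (solve \<alpha> \<phi>)"
    unfolding bounded_operator_Lh2_def
  proof (intro conjI ballI allI exI[of _ "1 / C"])
    fix f g assume f: "f \<in> Lh2 \<alpha>" and g: "g \<in> Lh2 \<alpha>"
    show "solve \<alpha> \<phi> (\<lambda>z. f z + g z) = (\<lambda>z. solve \<alpha> \<phi> f z + solve \<alpha> \<phi> g z)"
      by (rule solve_add[OF \<alpha> \<phi> Lh2_L2[OF f] Lh2_L2[OF g]])
  next
    fix f c assume f: "f \<in> Lh2 \<alpha>"
    show "solve \<alpha> \<phi> (\<lambda>z. c * f z) = (\<lambda>z. c * solve \<alpha> \<phi> f z)"
      by (rule solve_cmult[OF \<alpha> \<phi> Lh2_L2[OF f]])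
  next
    fix f assume f: "f \<in> Lh2 \<alpha>"
    show "solve \<alpha> \<phi> f \<in> Lh2 \<alpha>" "wnorm \<alpha> (solve \<alpha> \<phi> f) \<le> 1 / C * wnorm \<alpha> f" by (rule S[OF f])+
  qed
  fix f assume f: "f \<in> Lh2 \<alpha>"
  have T: "?T u = solve \<alpha> (\<lambda>_. 1) (\<lambda>z. complex_of_real (\<phi> z) * u z)" for u
    by (simp add: toeplitz_def proj_Lh2_eq_solve)
  note m = bounded_symbol_mult_L2[OF \<phi>(1) Lh2_L2]
  note P = solve[OF \<alpha> bounded_symbol_1 coercive_1 m]
  show "solve \<alpha> \<phi> (?T f) = f"
  proof (rule solve_eqI[OF \<alpha> \<phi> _ f])
    show Tf: "?T f \<in> L2 (weighted_area \<alpha>)" unfolding T by (intro Lh2_L2 P f)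
    show "\<forall>k\<in>Lh2 \<alpha>. winner \<alpha> (\<lambda>z. ?T f z - complex_of_real (\<phi> z) * f z) k = 0"
    proof
      fix k assume k: "k \<in> Lh2 \<alpha>"
      have "winner \<alpha> (\<lambda>z. complex_of_real (\<phi> z) * f z - ?T f z) k = 0"
        using P(2)[OF f] k unfolding T by simp
      then show "winner \<alpha> (\<lambda>z. ?T f z - complex_of_real (\<phi> z) * f z) k = 0"
        using winner_diff_left[OF Tf m[OF f] Lh2_L2[OF k]] winner_diff_left[OF m[OF f] Tf Lh2_L2[OF k]] by simp
    qed
  qed
  show "?T (solve \<alpha> \<phi> f) = f"
    unfolding T
  proof (rule solve_eqI[OF \<alpha> bounded_symbol_1 coercive_1 m[OF S(1)[OF f]] f])
    show "\<forall>k\<in>Lh2 \<alpha>. winner \<alpha> (\<lambda>z. complex_of_real (\<phi> z) * solve \<alpha> \<phi> f z - complex_of_real 1 * f z) k = 0"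
    proof
      fix k assume k: "k \<in> Lh2 \<alpha>"
      have "winner \<alpha> (\<lambda>z. f z - complex_of_real (\<phi> z) * solve \<alpha> \<phi> f z) k = 0"
        using S(2)[OF f] k by simp
      then show "winner \<alpha> (\<lambda>z. complex_of_real (\<phi> z) * solve \<alpha> \<phi> f z - complex_of_real 1 * f z) k = 0"
        using winner_diff_left[OF Lh2_L2[OF f] m[OF S(1)[OF f]] Lh2_L2[OF k]]
          winner_diff_left[OF m[OF S(1)[OF f]] Lh2_L2[OF f] Lh2_L2[OF k]] by simp
    qed
  qed
qed

text \<open>Since 0 \<le> \<phi> \<le> B, the square of \<phi> is at most |B| \<phi>. If D bounds
  the inverse, the squared norm of f is therefore at most D^2 |B| times the integral of \<phi>
  |f|^2.\<close>

lemma invertible_imp_coercive: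
  assumes \<alpha>: "\<alpha> > -1" and \<phi>: "bounded_symbol \<alpha> \<phi> B"
    and inv: "invertible_on_Lh2 \<alpha> (toeplitz \<alpha> (\<lambda>z. complex_of_real (\<phi> z)))"
  shows "\<exists>C. coercive \<alpha> \<phi> C"
proof -
  let ?T = "toeplitz \<alpha> (\<lambda>z. complex_of_real (\<phi> z))" and ?N = "weighted_area \<alpha>"
  obtain S where S: "bounded_operator_Lh2 \<alpha> S" "\<forall>f\<in>Lh2 \<alpha>. S (?T f) = f \<and> ?T (S f) = f"
    using inv unfolding invertible_on_Lh2_def by blast
  obtain D where D: "\<forall>f\<in>Lh2 \<alpha>. wnorm \<alpha> (S f) \<le> D * wnorm \<alpha> f"
    using S(1) unfolding bounded_operator_Lh2_def by blast
  have b: "AE z in ?N. 0 \<le> \<phi> z \<and> \<phi> z \<le> B" and [measurable]: "\<phi> \<in> borel_measurable ?N"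
    using \<phi> by (simp_all add: bounded_symbol_def)
  \<comment> \<open>The summand 1 keeps \<open>A\<close> positive even when D or B is 0.\<close>
  define A where "A = D\<^sup>2 * \<bar>B\<bar> + 1"
  have "A > 0" unfolding A_def by (intro add_nonneg_pos mult_nonneg_nonneg) auto
  have "(1 / A) * (LINT z|?N. (cmod (f z))\<^sup>2) \<le> (LINT z|?N. (cmod (f z))\<^sup>2 * \<phi> z)" if f: "f \<in> Lh2 \<alpha>" for f
  proof -
    note [measurable] = L2_measurable[OF Lh2_L2[OF f]]
    have Tf: "?T f \<in> Lh2 \<alpha>" using bounded_operator_toeplitz(1)[OF \<alpha> \<phi>] f by (simp add: bounded_operator_Lh2_def)
    have i1: "integrable ?N (\<lambda>z. (cmod (f z))\<^sup>2 * \<phi> z)"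
    proof (rule Bochner_Integration.integrable_bound[of _ "\<lambda>z. \<bar>B\<bar> * (cmod (f z))\<^sup>2"])
      show "integrable ?N (\<lambda>z. \<bar>B\<bar> * (cmod (f z))\<^sup>2)"
        by (intro integrable_mult_right L2_integrable[OF Lh2_L2[OF f]])
      show "AE z in ?N. norm ((cmod (f z))\<^sup>2 * \<phi> z) \<le> norm (\<bar>B\<bar> * (cmod (f z))\<^sup>2)"
        using b
      proof eventually_elim
        case (elim z)
        have "\<phi> z * (cmod (f z))\<^sup>2 \<le> B * (cmod (f z))\<^sup>2"
          using elim by (intro mult_right_mono) simp_all
        then show ?case using elim by (simp add: abs_mult mult.commute)
      qed
    qed measurable
    have "wnorm \<alpha> f \<le> D * wnorm \<alpha> (?T f)" using D S(2) f Tf by metis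
    then have "(wnorm \<alpha> f)\<^sup>2 \<le> (D * wnorm \<alpha> (?T f))\<^sup>2" by (intro power_mono wnorm_nonneg)
    also have "\<dots> = D\<^sup>2 * (wnorm \<alpha> (?T f))\<^sup>2" by (rule power_mult_distrib)
    also have "\<dots> \<le> D\<^sup>2 * (wnorm \<alpha> (\<lambda>z. complex_of_real (\<phi> z) * f z))\<^sup>2"
      using bounded_operator_toeplitz(2)[OF \<alpha> \<phi> f] by (intro mult_left_mono power_mono wnorm_nonneg) auto
    also have "(wnorm \<alpha> (\<lambda>z. complex_of_real (\<phi> z) * f z))\<^sup>2 \<le> (LINT z|?N. \<bar>B\<bar> * ((cmod (f z))\<^sup>2 * \<phi> z))"
      unfolding wnorm_square
    proof (rule integral_mono_AE)
      show "AE z in ?N. (cmod (complex_of_real (\<phi> z) * f z))\<^sup>2 \<le> \<bar>B\<bar> * ((cmod (f z))\<^sup>2 * \<phi> z)"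
        using b
      proof eventually_elim
        case (elim z)
        have "\<phi> z * (\<phi> z * (cmod (f z))\<^sup>2) \<le> \<bar>B\<bar> * (\<phi> z * (cmod (f z))\<^sup>2)"
          using elim by (intro mult_right_mono) auto
        then show ?case by (simp add: norm_mult power_mult_distrib power2_eq_square mult_ac)
      qed
    qed (use i1 L2_integrable[OF bounded_symbol_mult_L2[OF \<phi> Lh2_L2[OF f]]] in auto)
    also have "(LINT z|?N. \<bar>B\<bar> * ((cmod (f z))\<^sup>2 * \<phi> z)) = \<bar>B\<bar> * (LINT z|?N. (cmod (f z))\<^sup>2 * \<phi> z)"
      by simp
    finally have "(wnorm \<alpha> f)\<^sup>2 \<le> (D\<^sup>2 * \<bar>B\<bar>) * (LINT z|?N. (cmod (f z))\<^sup>2 * \<phi> z)"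
      by (simp add: mult_left_mono mult.assoc)
    also have "\<dots> \<le> A * (LINT z|?N. (cmod (f z))\<^sup>2 * \<phi> z)"
      unfolding A_def using b by (intro mult_right_mono integral_nonneg_AE) auto
    finally show ?thesis using \<open>A > 0\<close> by (simp add: wnorm_square field_simps)
  qed
  then have "coercive \<alpha> \<phi> (1 / A)" using \<open>A > 0\<close> by (simp add: coercive_def)
  then show ?thesis ..
qed

section \<open>The local estimate\<close>

text \<open>A countable product of closed balls is compact and sequentially compact, so a single
  subsequence makes all coordinates converge.\<close>

lemma compact_sequences:
  fixes x :: "nat \<Rightarrow> nat \<Rightarrow> 'a::{heine_borel, real_normed_vector}"
  assumes "\<And>k n. norm (x k n) \<le> A n"
  obtains l r where "strict_mono (r :: nat \<Rightarrow> nat)" "\<And>n. (\<lambda>k. x (r k) n) \<longlonglongrightarrow> l n"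
proof -
  have "compactin (product_topology (\<lambda>_. euclidean) UNIV) (PiE UNIV (\<lambda>n. cball (0::'a) (A n)))"
    by (subst compactin_PiE) (simp add: compactin_euclidean_iff)
  then have "compact (PiE UNIV (\<lambda>n. cball (0::'a) (A n)))"
    by (simp add: euclidean_product_topology compactin_euclidean_iff)
  then have "seq_compact (PiE UNIV (\<lambda>n. cball (0::'a) (A n)))"
    by (rule compact_imp_seq_compact)
  moreover have "\<forall>k. x k \<in> PiE UNIV (\<lambda>n. cball (0::'a) (A n))"
    using assms by (auto simp: PiE_UNIV_domain)
  ultimately obtain l r where r: "strict_mono (r :: nat \<Rightarrow> nat)" and l: "(x \<circ> r) \<longlonglongrightarrow> l"
    by (rule seq_compactE)
  have "(\<lambda>k. x (r k) n) \<longlonglongrightarrow> l n" for n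
  proof -
    have "continuous_on UNIV (\<lambda>y :: nat \<Rightarrow> 'a. y n)" by (rule continuous_on_product_coordinates)
    from continuous_on_tendsto_compose[OF this l] show ?thesis by simp
  qed
  with r show thesis by (rule that)
qed

lemma nn_integral_lborel_affine:
  fixes c :: complex
  assumes g: "g \<in> borel_measurable borel" and s: "s > 0"
  shows "(\<integral>\<^sup>+z. g z \<partial>lborel) = ennreal (s\<^sup>2) * (\<integral>\<^sup>+v. g (c + s *\<^sub>R v) \<partial>lborel)"
proof -
  note [measurable] = g
  have "(\<integral>\<^sup>+z. g z \<partial>lborel)
      = (\<integral>\<^sup>+z. g z \<partial>density (distr lborel borel (\<lambda>x. c + s *\<^sub>R x)) (\<lambda>_. ennreal (\<bar>s\<bar> ^ DIM(complex))))"
    using s by (subst lborel_affine[of s c]) auto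
  also have "\<dots> = ennreal (s\<^sup>2) * (\<integral>\<^sup>+v. g (c + s *\<^sub>R v) \<partial>lborel)"
    by (simp add: nn_integral_density nn_integral_distr nn_integral_cmult)
  finally show ?thesis .
qed

text \<open>The sublevel sets of |g|^2 in the ball decrease to the zero set, which is null. Once one
  of them has measure below \<delta> / 2, every admissible E keeps measure \<delta> / 2 on which
  |g|^2 is at least 1 / (j + 1). Hence \<epsilon> does not depend on E.\<close>

lemma nonzero_harmonic_mass:
  assumes "harmonic_on (ball 0 \<kappa>) g" and z0: "z0 \<in> ball 0 \<kappa>" "g z0 \<noteq> 0" and "\<delta> > 0"
    and g[measurable]: "g \<in> borel_measurable borel"
  obtains \<epsilon> where "\<epsilon> > 0"
    "\<And>E. E \<in> sets borel \<Longrightarrow> E \<subseteq> ball 0 \<kappa> \<Longrightarrow> ennreal \<delta> \<le> emeasure lborel E \<Longrightarrow>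
      ennreal \<epsilon> \<le> (\<integral>\<^sup>+z. indicator E z * ennreal ((cmod (g z))\<^sup>2) \<partial>lborel)"
proof -
  define A where "A j = {z \<in> ball 0 \<kappa>. (cmod (g z))\<^sup>2 < 1 / real (Suc j)}" for j
  have Am: "A j \<in> sets borel" for j unfolding A_def by measurable
  have "(\<lambda>j. emeasure lborel (A j)) \<longlonglongrightarrow> emeasure lborel (\<Inter>j. A j)"
  proof (rule Lim_emeasure_decseq)
    show "range A \<subseteq> sets lborel" using Am by auto
    show "decseq A"
    proof (rule decseq_SucI, rule subsetI)
      fix j z assume "z \<in> A (Suc j)"
      moreover have "1 / real (Suc (Suc j)) \<le> 1 / real (Suc j)" by (simp add: frac_le)
      ultimately show "z \<in> A j" unfolding A_def mem_Collect_eq by linarith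
    qed
    fix j
    have "emeasure lborel (A j) \<le> emeasure lborel (ball (0::complex) \<kappa>)"
      by (intro emeasure_mono) (auto simp: A_def)
    also have "\<dots> < \<infinity>" by (rule emeasure_bounded_finite) simp
    finally show "emeasure lborel (A j) \<noteq> \<infinity>" by simp
  qed
  also have "(\<Inter>j. A j) = {z \<in> ball 0 \<kappa>. g z = 0}"
  proof (intro set_eqI iffI)
    fix z assume z: "z \<in> (\<Inter>j. A j)"
    have "(cmod (g z))\<^sup>2 \<le> 0"
    proof (rule field_le_epsilon)
      fix e :: real assume "e > 0"
      then obtain j where "inverse (real (Suc j)) < e" using reals_Archimedean by blast
      moreover have "(cmod (g z))\<^sup>2 < 1 / real (Suc j)" using z by (simp add: A_def)
      ultimately show "(cmod (g z))\<^sup>2 \<le> 0 + e" by (simp add: inverse_eq_divide)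
    qed
    then show "z \<in> {z \<in> ball 0 \<kappa>. g z = 0}" using z by (simp add: A_def)
  qed (simp add: A_def)
  also have "emeasure lborel {z \<in> ball 0 \<kappa>. g z = 0} = 0"
    by (rule null_setsD1[OF harmonic_zero_set_null[OF assms(1) bexI[of _ z0]]]) (rule z0)+
  finally have "\<forall>\<^sub>F j in sequentially. emeasure lborel (A j) < ennreal (\<delta> / 2)"
    using \<open>\<delta> > 0\<close> by (intro order_tendstoD) auto
  then obtain j where j: "emeasure lborel (A j) < ennreal (\<delta> / 2)"
    by (auto simp: eventually_sequentially)
  show thesis
  proof (rule that)
    show "\<delta> / 2 / real (Suc j) > 0" using \<open>\<delta> > 0\<close> by simp
    fix E :: "complex set" assume E[measurable]: "E \<in> sets borel" and sub: "E \<subseteq> ball 0 \<kappa>" and big: "ennreal \<delta> \<le> emeasure lborel E"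
    have "emeasure lborel E \<le> emeasure lborel (A j) + emeasure lborel (E - A j)"
      using Am by (intro order_trans[OF _ emeasure_subadditive] emeasure_mono) auto
    also have "\<dots> \<le> ennreal (\<delta> / 2) + emeasure lborel (E - A j)"
      using j by (intro add_right_mono) simp
    finally have "ennreal \<delta> \<le> ennreal (\<delta> / 2) + emeasure lborel (E - A j)" using big by (rule order_trans[rotated])
    moreover have "ennreal \<delta> = ennreal (\<delta> / 2) + ennreal (\<delta> / 2)"
      using \<open>\<delta> > 0\<close> by (simp flip: ennreal_plus)
    ultimately have "ennreal (\<delta> / 2) \<le> emeasure lborel (E - A j)"
      by simp
    then have "ennreal (1 / real (Suc j)) * ennreal (\<delta> / 2) \<le> ennreal (1 / real (Suc j)) * emeasure lborel (E - A j)"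
      by (rule mult_left_mono) simp
    also have "\<dots> = (\<integral>\<^sup>+z. ennreal (1 / real (Suc j)) * indicator (E - A j) z \<partial>lborel)"
      using Am by (subst nn_integral_cmult_indicator) auto
    also have "\<dots> \<le> (\<integral>\<^sup>+z. indicator E z * ennreal ((cmod (g z))\<^sup>2) \<partial>lborel)"
      using sub by (intro nn_integral_mono) (auto simp: indicator_def A_def not_less intro!: ennreal_leI)
    also have "ennreal (1 / real (Suc j)) * ennreal (\<delta> / 2) = ennreal (\<delta> / 2 / real (Suc j))"
      using \<open>\<delta> > 0\<close> by (simp flip: ennreal_mult')
    finally show "ennreal (\<delta> / 2 / real (Suc j)) \<le> (\<integral>\<^sup>+z. indicator E z * ennreal ((cmod (g z))\<^sup>2) \<partial>lborel)" .
  qed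
qed

lemma wdensity_0: "wdensity 0 z = indicator unit_disk z / pi"
proof (cases "cmod z < 1")
  case True
  \<comment> \<open>A zero exponent gives the value 1 only for a nonzero base, so 1 - |z|^2 has to
    be nonzero.\<close>
  then have "(cmod z)\<^sup>2 \<noteq> 1" by (simp add: power2_eq_1_iff) (use norm_ge_zero[of z] in linarith)
  then show ?thesis by (simp add: wdensity_def weight_def)
qed (simp add: wdensity_def)

text \<open>The bound on the whole disk controls the coefficients at a radius beyond \<kappa> and so
  gives a uniform majorant on the inner ball; the normalisation there survives in the limit.
  Parameter 0 stands for plain normalised area.\<close>

lemma normalized_counterexample_limit:
  fixes f :: "nat \<Rightarrow> complex \<Rightarrow> complex"
  assumes \<kappa>: "0 < \<kappa>" "\<kappa> < 1" and "\<delta> > 0"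
    and f: "\<And>k. f k \<in> Lh2 0" and bd: "\<And>k. wnorm 0 (f k) \<le> M"
    and fm: "\<And>k. f k \<in> borel_measurable borel"
    and one: "\<And>k. (\<integral>\<^sup>+z. indicator (ball 0 \<kappa>) z * ennreal ((cmod (f k z))\<^sup>2) \<partial>lborel) = 1"
    and E: "\<And>k. E k \<in> sets borel" "\<And>k. E k \<subseteq> ball 0 \<kappa>" "\<And>k. ennreal \<delta> \<le> emeasure lborel (E k)"
    and small: "(\<lambda>k. \<integral>\<^sup>+z. indicator (E k) z * ennreal ((cmod (f k z))\<^sup>2) \<partial>lborel) \<longlonglongrightarrow> 0"
  shows False
proof -
  define \<sigma> where "\<sigma> = (\<kappa> + 1) / 2"
  have \<sigma>: "0 < \<sigma>" "\<kappa> < \<sigma>" "\<sigma> < 1" using \<kappa> by (auto simp: \<sigma>_def)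
  obtain Z where Z: "Z > 0"
      "\<And>f a b n. f \<in> Lh2 0 \<Longrightarrow> harmonic_series a b f \<Longrightarrow> cmod (a n) \<le> Z * (1 / \<sigma>) ^ n * wnorm 0 f"
      "\<And>f a b n. f \<in> Lh2 0 \<Longrightarrow> harmonic_series a b f \<Longrightarrow> cmod (b n) \<le> Z * (1 / \<sigma>) ^ n * wnorm 0 f"
    by (rule coefficient_bound[of 0 \<sigma>]) (use \<sigma> in auto)
  have "\<forall>k. \<exists>a b. harmonic_series a b (f k)"
    using f by (auto simp: Lh2_def intro: harmonic_series_exists)
  then obtain a b where hs: "\<And>k. harmonic_series (a k) (b k) (f k)" by metis
  define A where "A n = Z * M * (1 / \<sigma>) ^ n" for n
  have zbd: "Z * (1 / \<sigma>) ^ n * wnorm 0 (f k) \<le> A n" for k n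
    using mult_left_mono[OF bd[of k], of "Z * (1 / \<sigma>) ^ n"] Z(1) \<sigma> by (simp add: A_def mult_ac)
  have aA: "cmod (a k n) \<le> A n" and bA: "cmod (b k n) \<le> A n" for k n
    using order_trans[OF Z(2)[OF f hs] zbd] order_trans[OF Z(3)[OF f hs] zbd] by auto
  obtain a' r1 where r1: "strict_mono r1" and a': "\<And>n. (\<lambda>k. a (r1 k) n) \<longlonglongrightarrow> a' n"
    by (rule compact_sequences[of a A]) (use aA in auto)
  obtain b' r2 where r2: "strict_mono r2" and b': "\<And>n. (\<lambda>k. b (r1 (r2 k)) n) \<longlonglongrightarrow> b' n"
    by (rule compact_sequences[of "\<lambda>k. b (r1 k)" A]) (use bA in auto)
  \<comment> \<open>Two extractions in succession: one for the coefficients \<open>a\<close>, then a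
    further one for \<open>b\<close>.\<close>
  define r where "r k = r1 (r2 k)" for k
  have r: "strict_mono r" using strict_mono_o[OF r1 r2] by (simp add: r_def[abs_def] o_def)
  have lim: "(\<lambda>k. a (r k) n) \<longlonglongrightarrow> a' n" "(\<lambda>k. b (r k) n) \<longlonglongrightarrow> b' n" for n
    using LIMSEQ_subseq_LIMSEQ[OF a' r2, of n] b'[of n] by (auto simp: r_def o_def)
  have sA: "summable (\<lambda>n. A n * \<kappa> ^ n)"
    unfolding A_def using \<kappa> \<sigma> by (intro summable_geometric_ratio) auto
  define S where "S = (\<Sum>n. A n * \<kappa> ^ n)"
  \<comment> \<open>The limit is cut off to the ball on which the majorant is summable.\<close>
  define g where "g z = indicator (ball 0 \<kappa>) z * ((\<Sum>n. a' n * z ^ n) + cnj (\<Sum>n. b' n * z ^ n))" for z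
  note PA = power_series_limit[of "\<lambda>k. a (r k)", OF lim(1) aA sA]
  note PB = power_series_limit[of "\<lambda>k. b (r k)", OF lim(2) bA sA]
  have fk: "f k z = (\<Sum>n. a k n * z ^ n) + cnj (\<Sum>n. b k n * z ^ n)" if "z \<in> ball 0 \<kappa>" for k z
    using hs[of k] that \<kappa> by (simp add: harmonic_series_def)
  have flim: "(\<lambda>k. f (r k) z) \<longlonglongrightarrow> g z" if "z \<in> ball 0 \<kappa>" for z
    unfolding fk[OF that] using that PA(1)[of z] PB(1)[of z] by (auto simp: g_def intro!: tendsto_intros)
  have fbd: "cmod (f (r k) z) \<le> 2 * S" if "z \<in> ball 0 \<kappa>" for k z
    unfolding fk[OF that] S_def
    using that PA(3)[of z k] PB(3)[of z k]
      norm_triangle_ineq[of "\<Sum>n. a (r k) n * z ^ n" "cnj (\<Sum>n. b (r k) n * z ^ n)"] by simp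
  have gh: "harmonic_on (ball 0 \<kappa>) g"
  proof (rule harmonic_on_summable[of \<kappa> a' b'])
    have "summable (\<lambda>n. d n * z ^ n)" if "z \<in> ball 0 \<kappa>" "summable (\<lambda>n. cmod (d n) * \<kappa> ^ n)" for z and d :: "nat \<Rightarrow> complex"
      by (rule summable_norm_cancel[OF summable_comparison_test[OF _ that(2)]])
        (use that(1) in \<open>auto simp: norm_mult norm_power intro!: mult_left_mono power_mono\<close>)
    then show "summable (\<lambda>n. a' n * z ^ n)" "summable (\<lambda>n. b' n * z ^ n)" if "z \<in> ball 0 \<kappa>" for z
      using that PA(2)[of 0] PB(2)[of 0] \<kappa> by auto
  qed (use \<kappa> in \<open>auto simp: g_def\<close>)
  have gm[measurable]: "g \<in> borel_measurable borel"
    unfolding g_def[abs_def]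
    by (intro borel_measurable_times borel_measurable_indicator borel_measurable_add measurable_cnj
        borel_measurable_suminf borel_measurable_power borel_measurable_const) simp_all
  note [measurable] = fm E(1)
  let ?w = "\<lambda>z. indicator (ball 0 \<kappa>) z * ennreal ((2 * S)\<^sup>2) :: ennreal"
  have wfin: "(\<integral>\<^sup>+z. indicator (ball (0::complex) \<kappa>) z * ennreal c \<partial>lborel) < \<infinity>" for c
    using emeasure_bounded_finite[of "ball (0::complex) \<kappa>"]
    by (subst nn_integral_multc) (auto simp: ennreal_mult_less_top)
  have meas: "(\<lambda>z. indicator (ball 0 \<kappa>) z * ennreal ((cmod (f (r k) z))\<^sup>2)) \<in> borel_measurable borel"
    "(\<lambda>z. indicator (ball 0 \<kappa>) z * ennreal \<bar>(cmod (f (r k) z))\<^sup>2 - (cmod (g z))\<^sup>2\<bar>) \<in> borel_measurable borel"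
    "(\<lambda>z. indicator (ball 0 \<kappa>) z * ennreal ((cmod (g z))\<^sup>2)) \<in> borel_measurable borel"
    "?w \<in> borel_measurable borel" for k
    by (intro borel_measurable_times_ennreal borel_measurable_indicator measurable_compose[OF _ measurable_ennreal]
        borel_measurable_abs borel_measurable_diff borel_measurable_power
        measurable_compose[OF fm borel_measurable_norm] measurable_compose[OF gm borel_measurable_norm]
        borel_measurable_const borel_open open_ball)+
  have sq: "(cmod (f (r k) z))\<^sup>2 \<le> (2 * S)\<^sup>2" if "z \<in> ball 0 \<kappa>" for k z
    using fbd[OF that] by (intro power_mono) auto
  have sqg: "(cmod (g z))\<^sup>2 \<le> (2 * S)\<^sup>2" if "z \<in> ball 0 \<kappa>" for z
    by (rule tendsto_upperbound[OF tendsto_power[OF tendsto_norm[OF flim[OF that]]]])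
      (use sq[OF that] in auto)
  have "(\<lambda>k. \<integral>\<^sup>+z. indicator (ball 0 \<kappa>) z * ennreal ((cmod (f (r k) z))\<^sup>2) \<partial>lborel)
      \<longlonglongrightarrow> (\<integral>\<^sup>+z. indicator (ball 0 \<kappa>) z * ennreal ((cmod (g z))\<^sup>2) \<partial>lborel)"
  proof (rule nn_integral_dominated_convergence[where w="?w"])
    show "AE z in lborel. indicator (ball 0 \<kappa>) z * ennreal ((cmod (f (r k) z))\<^sup>2) \<le> ?w z" for k
      using sq[of _ k] by (intro AE_I2) (auto simp: indicator_def intro!: ennreal_leI)
    show "AE z in lborel. (\<lambda>k. indicator (ball 0 \<kappa>) z * ennreal ((cmod (f (r k) z))\<^sup>2))
        \<longlonglongrightarrow> indicator (ball 0 \<kappa>) z * ennreal ((cmod (g z))\<^sup>2)"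
    proof (rule AE_I2)
      fix z
      show "(\<lambda>k. indicator (ball 0 \<kappa>) z * ennreal ((cmod (f (r k) z))\<^sup>2))
        \<longlonglongrightarrow> indicator (ball 0 \<kappa>) z * ennreal ((cmod (g z))\<^sup>2)"
      proof (cases "z \<in> ball 0 \<kappa>")
        case True
        then show ?thesis using flim[OF True] by (simp add: tendsto_ennrealI tendsto_power tendsto_norm)
      qed simp
    qed
  qed (use wfin meas in \<open>simp_all only: borel_measurable_const measurable_lborel2\<close>)
  then have g1: "(\<integral>\<^sup>+z. indicator (ball 0 \<kappa>) z * ennreal ((cmod (g z))\<^sup>2) \<partial>lborel) = 1"
    unfolding one using LIMSEQ_unique[OF _ tendsto_const] by metis
  have "\<exists>z0\<in>ball 0 \<kappa>. g z0 \<noteq> 0"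
  proof (rule ccontr)
    assume "\<not> (\<exists>z0\<in>ball 0 \<kappa>. g z0 \<noteq> 0)"
    then have "(\<integral>\<^sup>+z. indicator (ball 0 \<kappa>) z * ennreal ((cmod (g z))\<^sup>2) \<partial>lborel) = (\<integral>\<^sup>+z. 0 \<partial>(lborel :: complex measure))"
      by (intro nn_integral_cong) (auto simp: indicator_def)
    then show False using g1 by simp
  qed
  then obtain z0 where z0: "z0 \<in> ball 0 \<kappa>" "g z0 \<noteq> 0" ..
  obtain \<epsilon> where \<epsilon>: "\<epsilon> > 0" "\<And>E. E \<in> sets borel \<Longrightarrow> E \<subseteq> ball 0 \<kappa> \<Longrightarrow> ennreal \<delta> \<le> emeasure lborel E \<Longrightarrow>
      ennreal \<epsilon> \<le> (\<integral>\<^sup>+z. indicator E z * ennreal ((cmod (g z))\<^sup>2) \<partial>lborel)"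
    by (rule nonzero_harmonic_mass[OF gh z0 \<open>\<delta> > 0\<close> gm]) blast
  \<comment> \<open>The sets vary with k, so pointwise convergence is not enough: the L^1 distance
    of the squared moduli on the whole ball tends to 0 and dominates the error on every one of the
    sets.\<close>
  define D where "D k = (\<integral>\<^sup>+z. indicator (ball 0 \<kappa>) z * ennreal \<bar>(cmod (f (r k) z))\<^sup>2 - (cmod (g z))\<^sup>2\<bar> \<partial>lborel)" for k
  have "D \<longlonglongrightarrow> (\<integral>\<^sup>+z. 0 \<partial>(lborel :: complex measure))"
    unfolding D_def
  proof (rule nn_integral_dominated_convergence[where w="?w"])
    show "AE z in lborel. indicator (ball 0 \<kappa>) z * ennreal \<bar>(cmod (f (r k) z))\<^sup>2 - (cmod (g z))\<^sup>2\<bar> \<le> ?w z" for k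
    proof (rule AE_I2)
      fix z
      have "\<bar>(cmod (f (r k) z))\<^sup>2 - (cmod (g z))\<^sup>2\<bar> \<le> (2 * S)\<^sup>2" if "z \<in> ball 0 \<kappa>"
        using sq[OF that, of k] sqg[OF that] zero_le_power2[of "cmod (g z)"] zero_le_power2[of "cmod (f (r k) z)"]
        by linarith
      then show "indicator (ball 0 \<kappa>) z * ennreal \<bar>(cmod (f (r k) z))\<^sup>2 - (cmod (g z))\<^sup>2\<bar> \<le> ?w z"
        by (auto simp: indicator_def intro!: ennreal_leI)
    qed
    show "AE z in lborel. (\<lambda>k. indicator (ball 0 \<kappa>) z * ennreal \<bar>(cmod (f (r k) z))\<^sup>2 - (cmod (g z))\<^sup>2\<bar>) \<longlonglongrightarrow> 0"
    proof (rule AE_I2)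
      fix z
      show "(\<lambda>k. indicator (ball 0 \<kappa>) z * ennreal \<bar>(cmod (f (r k) z))\<^sup>2 - (cmod (g z))\<^sup>2\<bar>) \<longlonglongrightarrow> 0"
      proof (cases "z \<in> ball 0 \<kappa>")
        case True
        have "(\<lambda>k. (cmod (f (r k) z))\<^sup>2 - (cmod (g z))\<^sup>2) \<longlonglongrightarrow> (cmod (g z))\<^sup>2 - (cmod (g z))\<^sup>2"
          by (intro tendsto_diff tendsto_power tendsto_norm flim True tendsto_const)
        then have "(\<lambda>k. ennreal \<bar>(cmod (f (r k) z))\<^sup>2 - (cmod (g z))\<^sup>2\<bar>) \<longlonglongrightarrow> ennreal \<bar>0\<bar>"
          by (intro tendsto_ennrealI tendsto_rabs) simp
        then show ?thesis using True by simp
      qed simp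
    qed
  qed (use wfin meas in \<open>simp_all only: borel_measurable_const measurable_lborel2\<close>)
  then have D0: "D \<longlonglongrightarrow> 0" by simp
  have "ennreal \<epsilon> \<le> (\<integral>\<^sup>+z. indicator (E (r k)) z * ennreal ((cmod (f (r k) z))\<^sup>2) \<partial>lborel) + D k" for k
  proof -
    have "ennreal \<epsilon> \<le> (\<integral>\<^sup>+z. indicator (E (r k)) z * ennreal ((cmod (g z))\<^sup>2) \<partial>lborel)"
      by (rule \<epsilon>(2)[OF E])
    also have "\<dots> \<le> (\<integral>\<^sup>+z. indicator (E (r k)) z * ennreal ((cmod (f (r k) z))\<^sup>2)
        + indicator (ball 0 \<kappa>) z * ennreal \<bar>(cmod (f (r k) z))\<^sup>2 - (cmod (g z))\<^sup>2\<bar> \<partial>lborel)"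
    proof (rule nn_integral_mono)
      fix z
      have "(cmod (g z))\<^sup>2 \<le> (cmod (f (r k) z))\<^sup>2 + \<bar>(cmod (f (r k) z))\<^sup>2 - (cmod (g z))\<^sup>2\<bar>" by linarith
      then have "ennreal ((cmod (g z))\<^sup>2) \<le> ennreal ((cmod (f (r k) z))\<^sup>2 + \<bar>(cmod (f (r k) z))\<^sup>2 - (cmod (g z))\<^sup>2\<bar>)"
        by (rule ennreal_leI)
      then have "ennreal ((cmod (g z))\<^sup>2) \<le> ennreal ((cmod (f (r k) z))\<^sup>2) + ennreal \<bar>(cmod (f (r k) z))\<^sup>2 - (cmod (g z))\<^sup>2\<bar>"
        by (simp only: ennreal_plus[OF zero_le_power2 abs_ge_zero])
      then show "indicator (E (r k)) z * ennreal ((cmod (g z))\<^sup>2) \<le> indicator (E (r k)) z * ennreal ((cmod (f (r k) z))\<^sup>2)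
        + indicator (ball 0 \<kappa>) z * ennreal \<bar>(cmod (f (r k) z))\<^sup>2 - (cmod (g z))\<^sup>2\<bar>"
        using E(2)[of "r k"] by (cases "z \<in> E (r k)") auto
    qed
    also have "\<dots> = (\<integral>\<^sup>+z. indicator (E (r k)) z * ennreal ((cmod (f (r k) z))\<^sup>2) \<partial>lborel) + D k"
      unfolding D_def using meas(2)[of k]
      by (intro nn_integral_add) (simp_all add: measurable_compose[OF fm borel_measurable_norm] E(1))
    finally show ?thesis .
  qed
  moreover have "(\<lambda>k. (\<integral>\<^sup>+z. indicator (E (r k)) z * ennreal ((cmod (f (r k) z))\<^sup>2) \<partial>lborel) + D k) \<longlonglongrightarrow> 0 + 0"
    using LIMSEQ_subseq_LIMSEQ[OF small r] D0 by (intro tendsto_add) (auto simp: o_def)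
  ultimately have "ennreal \<epsilon> \<le> 0 + 0" by (intro LIMSEQ_le_const) auto
  then show False using \<epsilon>(1) by simp
qed


text \<open>Extended nonnegative values keep the local estimates meaningful without integrability;
  finiteness enters only where terms are cancelled.\<close>

definition mass :: "complex set \<Rightarrow> (complex \<Rightarrow> complex) \<Rightarrow> ennreal" where
  "mass E f = (\<integral>\<^sup>+z. indicator E z * ennreal ((cmod (f z))\<^sup>2) \<partial>lborel)"

lemma mass_mono: "E \<subseteq> F \<Longrightarrow> mass E f \<le> mass F f"
  unfolding mass_def by (intro nn_integral_mono mult_right_mono) (auto simp: indicator_def)

lemma mass_cmult:
  assumes "f \<in> borel_measurable borel" "E \<in> sets borel" "\<And>z. z \<in> E \<Longrightarrow> g z = c * f z"
  shows "mass E g = ennreal ((cmod c)\<^sup>2) * mass E f"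
proof -
  note [measurable] = assms(1,2)
  have "mass E g = (\<integral>\<^sup>+z. ennreal ((cmod c)\<^sup>2) * (indicator E z * ennreal ((cmod (f z))\<^sup>2)) \<partial>lborel)"
    unfolding mass_def
    by (intro nn_integral_cong) (auto simp: indicator_def assms(3) norm_mult power_mult_distrib ennreal_mult)
  also have "\<dots> = ennreal ((cmod c)\<^sup>2) * mass E f"
    unfolding mass_def by (intro nn_integral_cmult) measurable
  finally show ?thesis .
qed

lemma harmonic_on_cong:
  assumes "harmonic_on S f" "convex S" "\<And>z. z \<in> S \<Longrightarrow> g z = f z"
  shows "harmonic_on S g"
proof -
  have "open S" using assms by (simp add: harmonic_on_def)
  obtain u v where uv: "u holomorphic_on S" "v holomorphic_on S" "\<And>z. z \<in> S \<Longrightarrow> f z = u z + cnj (v z)"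
    using harmonic_on_imp_holomorphic_parts[OF assms(1,2)] by metis
  show ?thesis
    by (rule harmonic_on_holomorphic_parts[OF \<open>open S\<close> uv(1,2)]) (simp add: assms(3) uv(3))
qed

text \<open>Normalised area carries the factor 1 / pi, which is below 1 and is dropped in the
  bound.\<close>

lemma Lh2_0I:
  assumes h: "harmonic_on unit_disk g" and m: "g \<in> borel_measurable borel"
    and z: "\<And>z. z \<notin> unit_disk \<Longrightarrow> g z = 0" and M: "mass unit_disk g \<le> ennreal M" "M \<ge> 0"
  shows "g \<in> Lh2 0" "wnorm 0 g \<le> sqrt M"
proof -
  note [measurable] = m
  have "(\<integral>\<^sup>+z. ennreal ((cmod (g z))\<^sup>2) \<partial>weighted_area 0)
      = (\<integral>\<^sup>+z. ennreal (1 / pi) * (indicator unit_disk z * ennreal ((cmod (g z))\<^sup>2)) \<partial>lborel)"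
    by (subst nn_integral_weighted_area) (auto simp: wdensity_0 indicator_def intro!: nn_integral_cong)
  also have "\<dots> = ennreal (1 / pi) * mass unit_disk g"
    unfolding mass_def by (intro nn_integral_cmult) measurable
  also have "\<dots> \<le> 1 * ennreal M"
    using pi_ge_two M by (intro mult_mono) (auto simp: ennreal_le_1)
  finally have le: "(\<integral>\<^sup>+z. ennreal ((cmod (g z))\<^sup>2) \<partial>weighted_area 0) \<le> ennreal M" by simp
  have mm: "(\<lambda>z. (cmod (g z))\<^sup>2) \<in> borel_measurable (weighted_area 0)"
    by (intro borel_imp_measurable_weighted_area) measurable
  have int: "integrable (weighted_area 0) (\<lambda>z. (cmod (g z))\<^sup>2)"
    using le mm by (intro integrableI_bounded) (auto intro: le_less_trans)
  then show "g \<in> Lh2 0" using h z by (auto simp: Lh2_def)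
  have "ennreal (LINT z|weighted_area 0. (cmod (g z))\<^sup>2) \<le> ennreal M"
    using int le by (subst nn_integral_eq_integral[symmetric]) auto
  then show "wnorm 0 g \<le> sqrt M"
    using M(2) by (subst wnorm_le_iff) auto
qed

text \<open>Otherwise normalised counterexamples would converge, along a subsequence, to a nonzero
  harmonic function with arbitrarily small mass on sets of measure at least \<open>\<delta>\<close>; but its zero
  set is null.\<close>

lemma harmonic_local_estimate:
  assumes \<kappa>: "0 < \<kappa>" "\<kappa> < 1" and "\<delta> > 0" "M > 0"
  shows "\<exists>K>0. \<forall>f E. harmonic_on unit_disk f \<longrightarrow> f \<in> borel_measurable borel \<longrightarrow> E \<in> sets borel \<longrightarrow>
    E \<subseteq> ball 0 \<kappa> \<longrightarrow> ennreal \<delta> \<le> emeasure lborel E \<longrightarrow>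
    mass (ball 0 \<kappa>) f \<le> ennreal (1 / M) * mass unit_disk f + ennreal K * mass E f"
proof -
  define Q where "Q K \<longleftrightarrow> (\<forall>f E. harmonic_on unit_disk f \<longrightarrow> f \<in> borel_measurable borel \<longrightarrow> E \<in> sets borel \<longrightarrow>
    E \<subseteq> ball 0 \<kappa> \<longrightarrow> ennreal \<delta> \<le> emeasure lborel E \<longrightarrow>
    mass (ball 0 \<kappa>) f \<le> ennreal (1 / M) * mass unit_disk f + ennreal K * mass E f)" for K :: real
  have "\<exists>k. Q (real (Suc k))"
  proof (rule ccontr)
    assume neg: "\<nexists>k. Q (real (Suc k))"
    have "\<forall>k. \<exists>p. harmonic_on unit_disk (fst p) \<and> fst p \<in> borel_measurable borel \<and> snd p \<in> sets borel \<and>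
      snd p \<subseteq> ball 0 \<kappa> \<and> ennreal \<delta> \<le> emeasure lborel (snd p) \<and>
      ennreal (1 / M) * mass unit_disk (fst p) + ennreal (real (Suc k)) * mass (snd p) (fst p) < mass (ball 0 \<kappa>) (fst p)"
      (is "\<forall>k. \<exists>p. ?A k p")
    proof
      fix k
      show "\<exists>p. ?A k p"
      proof (rule ccontr)
        assume c: "\<nexists>p. ?A k p"
        have "Q (real (Suc k))"
          unfolding Q_def
        proof (intro allI impI leI notI)
          fix f E assume "harmonic_on unit_disk f" "f \<in> borel_measurable borel" "E \<in> sets borel"
            "E \<subseteq> ball 0 \<kappa>" "ennreal \<delta> \<le> emeasure lborel E"
            "ennreal (1 / M) * mass unit_disk f + ennreal (real (Suc k)) * mass E f < mass (ball 0 \<kappa>) f"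
          then have "?A k (f, E)" unfolding fst_conv snd_conv by (intro conjI)
          with c show False by (rule notE[OF _ exI])
        qed
        with neg show False by (rule notE[OF _ exI])
      qed
    qed
    then obtain p where p: "\<forall>k. harmonic_on unit_disk (fst (p k)) \<and> fst (p k) \<in> borel_measurable borel \<and> snd (p k) \<in> sets borel \<and>
      snd (p k) \<subseteq> ball 0 \<kappa> \<and> ennreal \<delta> \<le> emeasure lborel (snd (p k)) \<and>
      ennreal (1 / M) * mass unit_disk (fst (p k)) + ennreal (real (Suc k)) * mass (snd (p k)) (fst (p k)) < mass (ball 0 \<kappa>) (fst (p k))"
      by (rule choice[THEN exE])
    define f where "f k = fst (p k)" for k
    define E where "E k = snd (p k)" for k
    have h: "\<And>k. harmonic_on unit_disk (f k)" and fm: "\<And>k. f k \<in> borel_measurable borel"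
      and E: "\<And>k. E k \<in> sets borel" "\<And>k. E k \<subseteq> ball 0 \<kappa>" "\<And>k. ennreal \<delta> \<le> emeasure lborel (E k)"
      and bad: "\<And>k. ennreal (1 / M) * mass unit_disk (f k) + ennreal (real (Suc k)) * mass (E k) (f k)
        < mass (ball 0 \<kappa>) (f k)"
      unfolding f_def E_def using p by blast+
    have sub: "ball 0 \<kappa> \<subseteq> unit_disk" using \<kappa> by auto
    \<comment> \<open>Each summand of a failing inequality is below the inner mass: the total mass
      is less than M times it, and the mass on \<open>E k\<close> is less than 1 / (k + 1) of
      it.\<close>
    have b1: "ennreal (1 / M) * mass unit_disk (f k) < mass (ball 0 \<kappa>) (f k)"
      and b2: "ennreal (real (Suc k)) * mass (E k) (f k) < mass (ball 0 \<kappa>) (f k)" for k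
      using bad[of k] by (auto intro: le_less_trans[rotated])
    \<comment> \<open>With infinite total mass the right side would be infinite and the inequality
      could not fail.\<close>
    have yfin: "mass unit_disk (f k) < \<infinity>" for k
    proof (rule ccontr)
      assume "\<not> mass unit_disk (f k) < \<infinity>"
      then have "mass unit_disk (f k) = \<infinity>" by (simp add: less_top[symmetric])
      then show False using b1[of k] \<open>M > 0\<close> by (simp add: ennreal_mult_top)
    qed
    have xfin: "mass (ball 0 \<kappa>) (f k) < \<infinity>" for k
      by (rule le_less_trans[OF mass_mono[OF sub] yfin])
    define x where "x k = enn2real (mass (ball 0 \<kappa>) (f k))" for k
    have x: "mass (ball 0 \<kappa>) (f k) = ennreal (x k)" for k
      using xfin[of k] by (simp add: x_def)
    have xpos: "x k > 0" for k
    proof -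
      have "0 < mass (ball 0 \<kappa>) (f k)" by (rule le_less_trans[OF _ b1]) simp
      then show ?thesis by (simp add: x)
    qed
    \<comment> \<open>The factor that normalises the mass on the inner ball to 1.\<close>
    define c where "c k = complex_of_real (1 / sqrt (x k))" for k
    have cc: "(cmod (c k))\<^sup>2 = 1 / x k" for k
      using xpos[of k] by (simp add: c_def norm_divide power_divide)
    \<comment> \<open>The cut-off produces a member of \<open>Lh2 0\<close>, whose elements vanish
      off the disk; nothing is known about \<open>f k\<close> there.\<close>
    define g where "g k z = indicator unit_disk z * (c k * f k z)" for k z
    note [measurable] = fm
    have gm: "g k \<in> borel_measurable borel" for k unfolding g_def by measurable
    have mg: "mass A (g k) = ennreal (1 / x k) * mass A (f k)" if "A \<subseteq> unit_disk" "A \<in> sets borel" for A k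
      using that unfolding cc[symmetric] by (intro mass_cmult fm) (auto simp: g_def)
    have gh: "harmonic_on unit_disk (g k)" for k
      by (rule harmonic_on_cong[OF harmonic_on_cmult[OF h]]) (auto simp: g_def)
    have "mass unit_disk (g k) \<le> ennreal M" for k
    proof -
      have "mass unit_disk (f k) = ennreal M * (ennreal (1 / M) * mass unit_disk (f k))"
        using \<open>M > 0\<close> by (simp add: mult.assoc[symmetric] ennreal_mult'[symmetric])
      also have "\<dots> \<le> ennreal M * ennreal (x k)"
        using b1[of k] unfolding x by (intro mult_left_mono) auto
      finally have "ennreal (1 / x k) * mass unit_disk (f k) \<le> ennreal (1 / x k) * (ennreal M * ennreal (x k))"
        by (rule mult_left_mono) simp
      also have "\<dots> = ennreal M"
        using xpos[of k] \<open>M > 0\<close> by (simp add: ennreal_mult'[symmetric])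
      finally show ?thesis by (simp add: mg)
    qed
    then have G: "g k \<in> Lh2 0" "wnorm 0 (g k) \<le> sqrt M" for k
      using \<open>M > 0\<close> by (auto intro!: Lh2_0I gh gm simp: g_def)
    show False
    proof (rule normalized_counterexample_limit[OF \<kappa> \<open>\<delta> > 0\<close> G gm _ E])
      show "(\<integral>\<^sup>+z. indicator (ball 0 \<kappa>) z * ennreal ((cmod (g k z))\<^sup>2) \<partial>lborel) = 1" for k
        using mg[OF sub, of k] xpos[of k] by (simp add: x mass_def[symmetric] ennreal_mult'[symmetric])
      have up: "mass (E k) (g k) \<le> ennreal (1 / real (Suc k))" for k
      proof -
        have "mass (E k) (f k) = ennreal (1 / real (Suc k)) * (ennreal (real (Suc k)) * mass (E k) (f k))"
          by (simp add: mult.assoc[symmetric] ennreal_mult'[symmetric] del: of_nat_Suc)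
        also have "\<dots> \<le> ennreal (1 / real (Suc k)) * ennreal (x k)"
          using b2[of k] unfolding x by (intro mult_left_mono) auto
        finally have "ennreal (1 / x k) * mass (E k) (f k) \<le> ennreal (1 / x k) * (ennreal (1 / real (Suc k)) * ennreal (x k))"
          by (rule mult_left_mono) simp
        also have "\<dots> = ennreal (1 / real (Suc k))"
          using xpos[of k] by (simp add: ennreal_mult'[symmetric] del: of_nat_Suc)
        finally show ?thesis using E(1,2)[of k] sub by (subst mg) auto
      qed
      have l: "(\<lambda>k. ennreal (1 / real (Suc k))) \<longlonglongrightarrow> 0"
        using tendsto_ennrealI[OF LIMSEQ_Suc[OF lim_1_over_n]] by (simp only: ennreal_0)
      have "(\<lambda>k. mass (E k) (g k)) \<longlonglongrightarrow> 0"
      proof (rule tendsto_sandwich[OF _ _ tendsto_const l])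
        show "\<forall>\<^sub>F k in sequentially. 0 \<le> mass (E k) (g k)" by simp
        show "\<forall>\<^sub>F k in sequentially. mass (E k) (g k) \<le> ennreal (1 / real (Suc k))"
          using up by (intro always_eventually allI)
      qed
      then show "(\<lambda>k. \<integral>\<^sup>+z. indicator (E k) z * ennreal ((cmod (g k z))\<^sup>2) \<partial>lborel) \<longlonglongrightarrow> 0"
        unfolding mass_def .
    qed
  qed
  then obtain k where "Q (real (Suc k))" ..
  then show ?thesis unfolding Q_def by (intro exI[of _ "real (Suc k)"] conjI) simp_all
qed

section \<open>Transport to arbitrary Euclidean disks\<close>

lemma mass_affine:
  assumes "f \<in> borel_measurable borel" "E \<in> sets borel" "s > 0"
  shows "mass E f = ennreal (s\<^sup>2) * mass ((\<lambda>v. c + s *\<^sub>R v) -` E) (\<lambda>v. f (c + s *\<^sub>R v))"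
proof -
  note [measurable] = assms(1,2)
  have "indicator E (c + s *\<^sub>R v) = (indicator ((\<lambda>v. c + s *\<^sub>R v) -` E) v :: ennreal)" for v
    by (simp add: indicator_def)
  moreover have "(\<lambda>z. indicator E z * ennreal ((cmod (f z))\<^sup>2)) \<in> borel_measurable borel" by measurable
  ultimately show ?thesis
    unfolding mass_def by (subst nn_integral_lborel_affine[where c=c and s=s]) (use assms(3) in auto)
qed

lemma emeasure_affine:
  fixes c :: complex
  assumes "E \<in> sets borel" "s > 0"
  shows "emeasure lborel E = ennreal (s\<^sup>2) * emeasure lborel ((\<lambda>v. c + s *\<^sub>R v) -` E)"
proof -
  have m: "(\<lambda>v. c + s *\<^sub>R v) -` E \<in> sets borel"
  proof -
    have "(\<lambda>v. c + s *\<^sub>R v) \<in> borel_measurable borel" by measurable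
    from measurable_sets[OF this assms(1)] show ?thesis by simp
  qed
  have "emeasure lborel E = mass E (\<lambda>_. 1)" using assms by (simp add: mass_def)
  also have "\<dots> = ennreal (s\<^sup>2) * mass ((\<lambda>v. c + s *\<^sub>R v) -` E) (\<lambda>_. 1)"
    using assms by (subst mass_affine[where c=c and s=s]) auto
  also have "mass ((\<lambda>v. c + s *\<^sub>R v) -` E) (\<lambda>_. 1) = emeasure lborel ((\<lambda>v. c + s *\<^sub>R v) -` E)"
    using m by (simp add: mass_def)
  finally show ?thesis .
qed

lemma harmonic_on_affine:
  assumes h: "harmonic_on (ball c s) f" and s: "s > 0"
  shows "harmonic_on unit_disk (\<lambda>v. f (c + s *\<^sub>R v))"
proof -
  obtain u v where uv: "u holomorphic_on ball c s" "v holomorphic_on ball c s"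
    "\<And>z. z \<in> ball c s \<Longrightarrow> f z = u z + cnj (v z)"
    using harmonic_on_imp_holomorphic_parts[OF h convex_ball] by metis
  have inb: "c + s *\<^sub>R w \<in> ball c s" if "w \<in> unit_disk" for w
    using that s by (simp add: dist_norm)
  have comp: "(\<lambda>w. k (c + s *\<^sub>R w)) holomorphic_on unit_disk" if "k holomorphic_on ball c s" for k
  proof -
    have "(\<lambda>w. c + s *\<^sub>R w) holomorphic_on unit_disk"
      unfolding scaleR_conv_of_real by (intro holomorphic_intros)
    moreover have "(\<lambda>w. c + s *\<^sub>R w) ` unit_disk \<subseteq> ball c s" using inb by blast
    ultimately show ?thesis
      using holomorphic_on_compose_gen[of _ unit_disk k "ball c s"] that by (simp add: o_def)
  qed
  show ?thesis
    by (rule harmonic_on_holomorphic_parts[OF open_ball comp[OF uv(1)] comp[OF uv(2)]])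
      (simp add: uv(3)[OF inb])
qed

text \<open>Under v -> c + s v all masses, and the area of E, scale by \<open>s\<^sup>2\<close>,
  while harmonicity is preserved. Hence one constant \<open>K\<close> serves every centre and
  radius.\<close>

lemma harmonic_local_estimate_ball:
  assumes \<kappa>: "0 < \<kappa>" "\<kappa> < 1" and "\<delta> > 0" "M > 0"
  shows "\<exists>K>0. \<forall>f E c s. s > 0 \<longrightarrow> harmonic_on (ball c s) f \<longrightarrow> f \<in> borel_measurable borel \<longrightarrow> E \<in> sets borel \<longrightarrow>
    E \<subseteq> ball c (\<kappa> * s) \<longrightarrow> ennreal (\<delta> * s\<^sup>2) \<le> emeasure lborel E \<longrightarrow>
    mass (ball c (\<kappa> * s)) f \<le> ennreal (1 / M) * mass (ball c s) f + ennreal K * mass E f"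
proof -
  obtain K where K': "K > 0 \<and> (\<forall>f E. harmonic_on unit_disk f \<longrightarrow> f \<in> borel_measurable borel \<longrightarrow> E \<in> sets borel \<longrightarrow>
    E \<subseteq> ball 0 \<kappa> \<longrightarrow> ennreal \<delta> \<le> emeasure lborel E \<longrightarrow>
    mass (ball 0 \<kappa>) f \<le> ennreal (1 / M) * mass unit_disk f + ennreal K * mass E f)"
    using harmonic_local_estimate[OF assms] ..
  note K = conjunct1[OF K'] conjunct2[OF K']
  show ?thesis
  proof (intro exI[of _ K] conjI K(1) allI impI)
    fix f :: "complex \<Rightarrow> complex" and E c and s :: real
    assume s: "s > 0" and h: "harmonic_on (ball c s) f" and fm: "f \<in> borel_measurable borel"
      and E: "E \<in> sets borel" "E \<subseteq> ball c (\<kappa> * s)" "ennreal (\<delta> * s\<^sup>2) \<le> emeasure lborel E"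
    let ?T = "\<lambda>v::complex. c + s *\<^sub>R v"
    have Tm: "?T \<in> borel_measurable borel" by measurable
    have ball: "?T -` ball c (t * s) = ball 0 t" for t
      using s by (auto simp: dist_norm)
    have "?T -` E \<in> sets borel" using measurable_sets[OF Tm E(1)] by simp
    moreover have "?T -` E \<subseteq> ball 0 \<kappa>" using E(2) unfolding ball[symmetric] by blast
    moreover have "ennreal \<delta> \<le> emeasure lborel (?T -` E)"
    proof -
      have "ennreal (1 / s\<^sup>2) * ennreal (\<delta> * s\<^sup>2) \<le> ennreal (1 / s\<^sup>2) * (ennreal (s\<^sup>2) * emeasure lborel (?T -` E))"
        using E(3) emeasure_affine[OF E(1) s, of c] by (intro mult_left_mono) auto
      then show ?thesis
        using s \<open>\<delta> > 0\<close> by (simp add: mult.assoc[symmetric] ennreal_mult'[symmetric])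
    qed
    moreover have "(\<lambda>v. f (?T v)) \<in> borel_measurable borel" by (rule measurable_compose[OF Tm fm])
    ultimately have main: "mass (ball 0 \<kappa>) (\<lambda>v. f (?T v)) \<le> ennreal (1 / M) * mass unit_disk (\<lambda>v. f (?T v))
        + ennreal K * mass (?T -` E) (\<lambda>v. f (?T v))"
      by (intro K(2)[rule_format] harmonic_on_affine[OF h s])
    have A: "mass A f = ennreal (s\<^sup>2) * mass (?T -` A) (\<lambda>v. f (?T v))" if "A \<in> sets borel" for A
      by (rule mass_affine[OF fm that s])
    have b1: "?T -` ball c s = unit_disk" using ball[of 1] by simp
    have "mass (ball c (\<kappa> * s)) f = ennreal (s\<^sup>2) * mass (ball 0 \<kappa>) (\<lambda>v. f (?T v))"
      by (subst A) (simp_all add: ball)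
    also have "\<dots> \<le> ennreal (s\<^sup>2) * (ennreal (1 / M) * mass unit_disk (\<lambda>v. f (?T v))
        + ennreal K * mass (?T -` E) (\<lambda>v. f (?T v)))"
      by (intro mult_left_mono main) simp
    also have "\<dots> = ennreal (1 / M) * mass (ball c s) f + ennreal K * mass E f"
      using A[of "ball c s"] A[OF E(1)] by (simp add: b1 distrib_left mult_ac)
    finally show "mass (ball c (\<kappa> * s)) f \<le> ennreal (1 / M) * mass (ball c s) f + ennreal K * mass E f" .
  qed
qed

section \<open>Pseudohyperbolic disks\<close>

lemma square_less_iff:
  fixes x y :: real
  assumes "0 \<le> x" "0 \<le> y"
  shows "x\<^sup>2 < y\<^sup>2 \<longleftrightarrow> x < y"
  using power2_less_imp_less[OF _ assms(2)] power_strict_mono[OF _ assms(1), of y 2] by auto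

text \<open>Divided by |1 - cnj a z|^2 the left side is 1 minus the squared pseudohyperbolic
  distance. The comparisons between 1 - |a|^2, 1 - |z|^2 and the denominator rest on it.\<close>

lemma pseudohyperbolic_identity:
  "(cmod (1 - cnj a * z))\<^sup>2 - (cmod (z - a))\<^sup>2 = (1 - (cmod a)\<^sup>2) * (1 - (cmod z)\<^sup>2)"
  unfolding cmod_power2 by (simp add: power2_eq_square algebra_simps)

text \<open>The pseudohyperbolic disk with its denominator cleared. Both conditions on the moduli
  are built in, so that the relation is symmetric and the set is empty for a centre off the unit
  disk.\<close>

definition pdisk :: "real \<Rightarrow> complex \<Rightarrow> complex set" where
  "pdisk R a = {z. cmod a < 1 \<and> cmod z < 1 \<and> cmod (z - a) < R * cmod (1 - cnj a * z)}"

lemma pdisk_sym: "z \<in> pdisk R a \<longleftrightarrow> a \<in> pdisk R z"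
proof -
  have "cmod (1 - cnj a * z) = cmod (1 - cnj z * a)"
    using complex_mod_cnj[of "1 - cnj a * z"] by (simp add: mult.commute)
  then show ?thesis by (auto simp: pdisk_def norm_minus_commute)
qed

lemma pdisk_mono: "R \<le> R' \<Longrightarrow> pdisk R a \<subseteq> pdisk R' a"
  using mult_right_mono[OF _ norm_ge_zero, of R R'] unfolding pdisk_def by (blast intro: less_le_trans)

lemma one_minus_square_pos: "cmod a < 1 \<Longrightarrow> 0 < 1 - (cmod a)\<^sup>2"
  by (simp add: abs_square_less_1)

lemma denominator_lower_bound:
  assumes "cmod a < 1" "cmod z < 1"
  shows "(1 - (cmod a)\<^sup>2) / 2 \<le> cmod (1 - cnj a * z)"
proof -
  have "1 - cmod a \<le> 1 - cmod a * cmod z"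
    using assms mult_left_le[of "cmod z" "cmod a"] by simp
  also have "\<dots> \<le> cmod (1 - cnj a * z)"
    using norm_triangle_ineq2[of 1 "cnj a * z"] by (simp add: norm_mult)
  finally have "1 - cmod a \<le> cmod (1 - cnj a * z)" .
  moreover have "1 - (cmod a)\<^sup>2 \<le> 2 * (1 - cmod a)"
    using zero_le_power2[of "1 - cmod a"] by (simp add: power2_eq_square algebra_simps)
  ultimately show ?thesis by simp
qed

lemma pdisk_denominator:
  assumes "z \<in> pdisk R a" "0 < R"
  shows "(1 - R\<^sup>2) * (cmod (1 - cnj a * z))\<^sup>2 \<le> (1 - (cmod a)\<^sup>2) * (1 - (cmod z)\<^sup>2)"
proof -
  have "(cmod (z - a))\<^sup>2 \<le> (R * cmod (1 - cnj a * z))\<^sup>2"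
    using assms by (intro power_mono) (auto simp: pdisk_def)
  then show ?thesis
    unfolding pseudohyperbolic_identity[symmetric] by (simp add: power_mult_distrib algebra_simps)
qed

text \<open>The identity bounds (1 - R^2) |1 - cnj a z|^2 by (1 - |a|^2)(1 - |z|^2), and the
  denominator is at least (1 - |a|^2) / 2; cancelling one factor yields 4 / (1 - R^2), the 4 being
  the square of 2. The second estimate uses the first with a and z exchanged.\<close>

lemma pdisk_comparable:
  assumes "z \<in> pdisk R a" "0 < R" "R < 1"
  shows "1 - (cmod a)\<^sup>2 \<le> 4 / (1 - R\<^sup>2) * (1 - (cmod z)\<^sup>2)"
    and "cmod (z - a) \<le> 4 / (1 - R\<^sup>2) * (1 - (cmod a)\<^sup>2)"
proof -
  have comp: "1 - (cmod a)\<^sup>2 \<le> 4 / (1 - R\<^sup>2) * (1 - (cmod z)\<^sup>2)" if z: "z \<in> pdisk R a" for a z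
  proof -
    have az: "cmod a < 1" "cmod z < 1" using z by (auto simp: pdisk_def)
    note ta = one_minus_square_pos[OF az(1)]
    have q: "0 < 1 - R\<^sup>2" using assms by (simp add: abs_square_less_1)
    have "(1 - R\<^sup>2) * ((1 - (cmod a)\<^sup>2) / 2)\<^sup>2 \<le> (1 - R\<^sup>2) * (cmod (1 - cnj a * z))\<^sup>2"
      using denominator_lower_bound[OF az] ta q by (intro mult_left_mono power_mono) auto
    also have "\<dots> \<le> (1 - (cmod a)\<^sup>2) * (1 - (cmod z)\<^sup>2)" by (rule pdisk_denominator[OF z assms(2)])
    finally have "(1 - (cmod a)\<^sup>2) * ((1 - R\<^sup>2) * (1 - (cmod a)\<^sup>2) / 4) \<le> (1 - (cmod a)\<^sup>2) * (1 - (cmod z)\<^sup>2)"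
      by (simp add: power2_eq_square mult_ac)
    then have "(1 - R\<^sup>2) * (1 - (cmod a)\<^sup>2) / 4 \<le> 1 - (cmod z)\<^sup>2"
      using ta by (rule mult_left_le_imp_le)
    then show ?thesis using q by (simp add: field_simps)
  qed
  show "1 - (cmod a)\<^sup>2 \<le> 4 / (1 - R\<^sup>2) * (1 - (cmod z)\<^sup>2)" by (rule comp[OF assms(1)])
  have az: "cmod a < 1" "cmod z < 1" using assms by (auto simp: pdisk_def)
  note ta = one_minus_square_pos[OF az(1)] and tz = one_minus_square_pos[OF az(2)]
  have q: "0 < 1 - R\<^sup>2" "1 - R\<^sup>2 \<le> 1" using assms by (auto simp: abs_square_less_1)
  have "(cmod (z - a))\<^sup>2 \<le> (cmod (1 - cnj a * z))\<^sup>2"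
    using pseudohyperbolic_identity[of a z] mult_pos_pos[OF ta tz] by linarith
  also have "\<dots> \<le> (1 - (cmod a)\<^sup>2) * (1 - (cmod z)\<^sup>2) / (1 - R\<^sup>2)"
    using pdisk_denominator[OF assms(1,2)] q by (simp add: field_simps)
  also have "\<dots> \<le> (1 - (cmod a)\<^sup>2) * (4 / (1 - R\<^sup>2) * (1 - (cmod a)\<^sup>2)) / (1 - R\<^sup>2)"
    using comp[of a z] assms(1) ta q pdisk_sym[of z R a] by (intro divide_right_mono mult_left_mono) auto
  also have "\<dots> = 4 * ((1 - (cmod a)\<^sup>2) / (1 - R\<^sup>2))\<^sup>2" by (simp add: power2_eq_square)
  also have "\<dots> \<le> (4 / (1 - R\<^sup>2) * (1 - (cmod a)\<^sup>2))\<^sup>2"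
  proof -
    have "4 * y\<^sup>2 \<le> (4 * y)\<^sup>2" for y :: real by (simp add: power_mult_distrib)
    from this[of "(1 - (cmod a)\<^sup>2) / (1 - R\<^sup>2)"] show ?thesis by simp
  qed
  finally show "cmod (z - a) \<le> 4 / (1 - R\<^sup>2) * (1 - (cmod a)\<^sup>2)"
    by (rule power2_le_imp_le) (use q ta in auto)
qed

lemma ball_subset_pdisk:
  assumes "cmod a < 1" "0 < R" "R < 1"
  shows "ball a (R / 2 * (1 - (cmod a)\<^sup>2)) \<subseteq> pdisk R a"
proof
  fix z assume "z \<in> ball a (R / 2 * (1 - (cmod a)\<^sup>2))"
  then have d: "cmod (z - a) < R * ((1 - (cmod a)\<^sup>2) / 2)" by (simp add: dist_norm norm_minus_commute)
  note ta = one_minus_square_pos[OF assms(1)]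
  have "R * ((1 - (cmod a)\<^sup>2) / 2) \<le> 1 * ((1 - (cmod a)\<^sup>2) / 2)"
    using assms ta by (intro mult_right_mono) auto
  from less_le_trans[OF d this] have "2 * cmod (z - a) < 1 - (cmod a)\<^sup>2" by simp
  also have "1 - (cmod a)\<^sup>2 \<le> 2 * (1 - cmod a)"
    using zero_le_power2[of "1 - cmod a"] by (simp add: power2_eq_square algebra_simps)
  finally have "cmod (z - a) < 1 - cmod a" by simp
  moreover have "cmod z \<le> cmod a + cmod (z - a)" using norm_triangle_ineq[of a "z - a"] by simp
  ultimately have z: "cmod z < 1" by linarith
  have "R * ((1 - (cmod a)\<^sup>2) / 2) \<le> R * cmod (1 - cnj a * z)"
    using denominator_lower_bound[OF assms(1) z] assms by (intro mult_left_mono) auto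
  then show "z \<in> pdisk R a" using d z assms(1) by (simp add: pdisk_def)
qed

text \<open>An Apollonius disk: |z - a|^2 - R'^2 |1 - cnj a z|^2 has leading coefficient D, and
  completing the square gives centre c and radius s. In the last claim the ratio of the concentric
  balls is free of a; it becomes \<kappa> in the local estimate.\<close>

lemma pdisk_euclidean:
  assumes a: "cmod a < 1" and q: "0 < R'" "R' < 1"
  defines "D \<equiv> 1 - R'\<^sup>2 * (cmod a)\<^sup>2"
  defines "c \<equiv> ((1 - R'\<^sup>2) / D) *\<^sub>R a" and "s \<equiv> R' * (1 - (cmod a)\<^sup>2) / D"
  shows "pdisk R' a = ball c s" and "s > 0" and "s \<le> R' / (1 - R'\<^sup>2) * (1 - (cmod a)\<^sup>2)"
    and "\<And>R. 0 < R \<Longrightarrow> R < R' \<Longrightarrow> pdisk R a \<subseteq> ball c (sqrt (1 - (R'\<^sup>2 - R\<^sup>2) * (1 - R'\<^sup>2) / (4 * R'\<^sup>2)) * s)"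
proof -
  define q where "q = R'\<^sup>2"
  define A where "A = (cmod a)\<^sup>2"
  have q: "0 < q" "q < 1" using assms by (auto simp: q_def abs_square_less_1)
  have A: "0 \<le> A" "A < 1" using one_minus_square_pos[OF a] by (auto simp: A_def)
  have "q * A \<le> q * 1" using q A by (intro mult_left_mono) auto
  moreover have "0 \<le> q * A" using q A by (intro mult_nonneg_nonneg) auto
  moreover have Deq: "D = 1 - q * A" by (simp add: D_def q_def A_def)
  ultimately have D: "1 - q \<le> D" "0 < D" "D \<le> 1" using q by linarith+
  have s2: "s\<^sup>2 = q * (1 - A)\<^sup>2 / D\<^sup>2"
    by (simp add: s_def q_def A_def power_mult_distrib power_divide)
  show spos: "s > 0" unfolding s_def using assms A D by (auto simp: A_def)
  show "s \<le> R' / (1 - R'\<^sup>2) * (1 - (cmod a)\<^sup>2)"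
    unfolding s_def using assms(2) A D q by (simp add: q_def[symmetric] A_def[symmetric] frac_le)
  have id: "(cmod (z - a))\<^sup>2 - q * (cmod (1 - cnj a * z))\<^sup>2 = D * ((cmod (z - c))\<^sup>2 - s\<^sup>2)" for z
  proof -
    define k where "k = (1 - q) / D"
    have kD: "D * k = 1 - q" using D by (simp add: k_def)
    have c: "c = k *\<^sub>R a" by (simp add: c_def k_def q_def)
    define X where "X = Re z * Re a + Im z * Im a"
    define Y where "Y = (cmod z)\<^sup>2"
    have e1: "(cmod (z - a))\<^sup>2 = Y - 2 * X + A"
      unfolding X_def Y_def A_def cmod_power2 by (simp add: power2_eq_square algebra_simps)
    have e2: "(cmod (1 - cnj a * z))\<^sup>2 = 1 - 2 * X + A * Y"
      unfolding X_def Y_def A_def cmod_power2 by (simp add: power2_eq_square algebra_simps)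
    have e3: "(cmod (z - c))\<^sup>2 = Y - 2 * k * X + k\<^sup>2 * A"
      unfolding c X_def Y_def A_def cmod_power2 by (simp add: power2_eq_square algebra_simps)
    \<comment> \<open>Multiplication by a second factor D clears the denominators of both the centre
      and the radius.\<close>
    have "D * (D * ((cmod (z - c))\<^sup>2 - s\<^sup>2)) = D * (D * Y) - 2 * (D * k) * D * X + (D * k)\<^sup>2 * A - q * (1 - A)\<^sup>2"
      unfolding e3 s2 using D by (simp add: field_simps power2_eq_square)
    also have "\<dots> = D * (D * Y) - 2 * (1 - q) * D * X + (1 - q)\<^sup>2 * A - q * (1 - A)\<^sup>2"
      by (simp only: kD)
    also have "\<dots> = D * ((cmod (z - a))\<^sup>2 - q * (cmod (1 - cnj a * z))\<^sup>2)"
      unfolding e1 e2 Deq by (simp add: power2_eq_square algebra_simps)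
    finally show ?thesis using D by simp
  qed
  have mem: "z \<in> ball c s \<longleftrightarrow> (cmod (z - a))\<^sup>2 < q * (cmod (1 - cnj a * z))\<^sup>2" for z
  proof -
    have "z \<in> ball c s \<longleftrightarrow> (cmod (z - c))\<^sup>2 < s\<^sup>2"
      using spos by (subst square_less_iff) (simp_all add: dist_norm norm_minus_commute)
    also have "\<dots> \<longleftrightarrow> D * ((cmod (z - c))\<^sup>2 - s\<^sup>2) < 0" using D by (simp add: mult_less_0_iff)
    also have "\<dots> \<longleftrightarrow> (cmod (z - a))\<^sup>2 < q * (cmod (1 - cnj a * z))\<^sup>2" unfolding id[symmetric] by simp
    finally show ?thesis .
  qed
  show "pdisk R' a = ball c s"
  proof (rule set_eqI)
    fix z
    have "z \<in> ball c s \<longleftrightarrow> (cmod (z - a))\<^sup>2 < (R' * cmod (1 - cnj a * z))\<^sup>2"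
      unfolding mem by (simp add: q_def power_mult_distrib)
    also have "\<dots> \<longleftrightarrow> cmod (z - a) < R' * cmod (1 - cnj a * z)"
      using assms(2) by (intro square_less_iff) simp_all
    also have "\<dots> \<longleftrightarrow> z \<in> pdisk R' a"
    proof
      \<comment> \<open>The condition |z| < 1 is automatic: R' < 1 makes the numerator smaller than
        the denominator, and the identity then makes 1 - |z|^2 positive.\<close>
      assume h: "cmod (z - a) < R' * cmod (1 - cnj a * z)"
      have "(cmod (z - a))\<^sup>2 < q * (cmod (1 - cnj a * z))\<^sup>2"
        using power_strict_mono[OF h norm_ge_zero, of 2] by (simp add: q_def power_mult_distrib)
      also have "\<dots> \<le> 1 * (cmod (1 - cnj a * z))\<^sup>2" using q by (intro mult_right_mono) auto
      finally have "0 < (1 - A) * (1 - (cmod z)\<^sup>2)" using pseudohyperbolic_identity[of a z] by (simp add: A_def)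
      then have "(cmod z)\<^sup>2 < 1" using A by (simp add: zero_less_mult_iff)
      then have "cmod z < 1" by (simp add: abs_square_less_1)
      then show "z \<in> pdisk R' a" using h a by (simp add: pdisk_def)
    qed (simp add: pdisk_def)
    finally show "z \<in> pdisk R' a \<longleftrightarrow> z \<in> ball c s" by simp
  qed
  fix R assume R: "0 < R" "R < R'"
  define p where "p = R\<^sup>2"
  have p: "p < q" unfolding p_def q_def using R by (intro power_strict_mono) auto
  \<comment> \<open>The gap (q - p)((1 - A) / 2)^2 between the two disks, measured against D s^2 = q
    (1 - A)^2 / D, is (q - p) D / (4 q); the bound D \<ge> 1 - q makes it independent of the
    centre.\<close>
  define e where "e = (q - p) * (1 - q) / (4 * q)"
  show "pdisk R a \<subseteq> ball c (sqrt (1 - (R'\<^sup>2 - R\<^sup>2) * (1 - R'\<^sup>2) / (4 * R'\<^sup>2)) * s)"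
  proof
    fix z assume z: "z \<in> pdisk R a"
    have az: "cmod a < 1" "cmod z < 1" using z by (auto simp: pdisk_def)
    have "(cmod (z - a))\<^sup>2 < p * (cmod (1 - cnj a * z))\<^sup>2"
      using power_strict_mono[of "cmod (z - a)" "R * cmod (1 - cnj a * z)" 2] z by (simp add: pdisk_def p_def power_mult_distrib)
    then have "D * ((cmod (z - c))\<^sup>2 - s\<^sup>2) < - ((q - p) * (cmod (1 - cnj a * z))\<^sup>2)"
      unfolding id[symmetric] by (simp add: algebra_simps)
    also have "\<dots> \<le> - ((q - p) * ((1 - A) / 2)\<^sup>2)"
      using denominator_lower_bound[OF az] p A by (intro le_imp_neg_le mult_left_mono power_mono) (auto simp: A_def)
    also have "\<dots> \<le> - (D * (e * s\<^sup>2))"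
    proof -
      have "D * (e * s\<^sup>2) = (q - p) * ((1 - A) / 2)\<^sup>2 * ((1 - q) / D)"
        unfolding e_def s2 using D q by (simp add: field_simps power2_eq_square)
      also have "\<dots> \<le> (q - p) * ((1 - A) / 2)\<^sup>2 * 1"
        using D p by (intro mult_left_mono) auto
      finally show ?thesis by simp
    qed
    finally have "D * ((cmod (z - c))\<^sup>2 - s\<^sup>2) < D * (- (e * s\<^sup>2))" by simp
    then have "(cmod (z - c))\<^sup>2 - s\<^sup>2 < - (e * s\<^sup>2)" using D by (simp only: mult_less_cancel_left_pos)
    then have lt: "(cmod (z - c))\<^sup>2 < (1 - e) * s\<^sup>2" by (simp add: algebra_simps)
    then have "0 < (1 - e) * s\<^sup>2" by (rule le_less_trans[OF zero_le_power2])
    then have e1: "0 < 1 - e" using spos by (simp add: zero_less_mult_iff)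
    have "(cmod (z - c))\<^sup>2 < (sqrt (1 - e) * s)\<^sup>2" using lt e1 by (simp add: power_mult_distrib)
    then have "cmod (z - c) < sqrt (1 - e) * s"
      by (rule power2_less_imp_less) (use e1 spos in auto)
    then show "z \<in> ball c (sqrt (1 - (R'\<^sup>2 - R\<^sup>2) * (1 - R'\<^sup>2) / (4 * R'\<^sup>2)) * s)"
      by (simp add: dist_norm norm_minus_commute e_def p_def q_def)
  qed
qed

section \<open>Weighted and unweighted mass on pseudohyperbolic disks\<close>

lemma powr_comparable:
  fixes x y L \<alpha> :: real
  assumes "x > 0" "y > 0" "x \<le> L * y" "y \<le> L * x" "L \<ge> 1"
  shows "x powr \<alpha> \<le> L powr \<bar>\<alpha>\<bar> * y powr \<alpha>"
proof (cases "\<alpha> \<ge> 0")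
  case True
  have "x powr \<alpha> \<le> (L * y) powr \<alpha>" using assms True by (intro powr_mono2) auto
  then show ?thesis using assms True by (simp add: powr_mult)
next
  case False
  \<comment> \<open>For a negative exponent the power is decreasing and the opposite inequality
    between x and y is used; hence the two-sided comparison.\<close>
  have "(L * x) powr \<alpha> \<le> y powr \<alpha>" using assms False by (intro powr_mono2') auto
  then have "L powr (-\<alpha>) * (L powr \<alpha> * x powr \<alpha>) \<le> L powr (-\<alpha>) * y powr \<alpha>"
    using assms by (intro mult_left_mono) (auto simp: powr_mult)
  moreover have "L powr (-\<alpha>) * (L powr \<alpha> * x powr \<alpha>) = x powr \<alpha>"
    using assms by (simp add: mult.assoc[symmetric] powr_add[symmetric])
  ultimately show ?thesis using False by simp
qed

lemma pdisk_borel[measurable]: "pdisk R a \<in> sets borel"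
  unfolding pdisk_def by measurable

lemma Lh2_borel:
  assumes "f \<in> Lh2 \<alpha>"
  shows "f \<in> borel_measurable borel"
proof -
  have "(\<lambda>z. indicator unit_disk z *\<^sub>R f z) \<in> borel_measurable borel"
    using assms by (intro borel_measurable_continuous_on_indicator harmonic_on_continuous) (auto simp: Lh2_def)
  moreover have "(\<lambda>z. indicator unit_disk z *\<^sub>R f z) = f"
    using assms by (auto simp: Lh2_def indicator_def)
  ultimately show ?thesis by simp
qed

lemma harmonic_on_subset:
  assumes "harmonic_on S f" "convex S" "T \<subseteq> S" "open T"
  shows "harmonic_on T f"
proof -
  obtain u v where uv: "u holomorphic_on S" "v holomorphic_on S" "\<And>z. z \<in> S \<Longrightarrow> f z = u z + cnj (v z)"
    using harmonic_on_imp_holomorphic_parts[OF assms(1,2)] by metis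
  show ?thesis
    by (rule harmonic_on_holomorphic_parts[OF assms(4) holomorphic_on_subset[OF uv(1) assms(3)]
          holomorphic_on_subset[OF uv(2) assms(3)] uv(3)[OF subsetD[OF assms(3)]]])
qed

text \<open>The weight enters as a density over \<open>lborel\<close>, as Tonelli over pairs of
  points requires. It vanishes off the disk, so the set \<open>UNIV\<close> gives the full squared
  norm.\<close>

definition wmass :: "real \<Rightarrow> complex set \<Rightarrow> (complex \<Rightarrow> complex) \<Rightarrow> ennreal" where
  "wmass \<alpha> E f = (\<integral>\<^sup>+z. indicator E z * (ennreal (wdensity \<alpha> z) * ennreal ((cmod (f z))\<^sup>2)) \<partial>lborel)"

text \<open>\<open>W\<close> is the density frozen at the centre; on a disk of fixed
  pseudohyperbolic radius the true density differs from it by a factor \<Lambda> that does not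
  depend on the centre.\<close>

lemma wdensity_pdisk:
  assumes "\<alpha> > -1" "z \<in> pdisk R a" "0 < R" "R < 1"
  defines "\<Lambda> \<equiv> (4 / (1 - R\<^sup>2)) powr \<bar>\<alpha>\<bar>" and "W \<equiv> (1 + \<alpha>) / pi * (1 - (cmod a)\<^sup>2) powr \<alpha>"
  shows "wdensity \<alpha> z \<le> \<Lambda> * W" "W \<le> \<Lambda> * wdensity \<alpha> z" "0 < W"
proof -
  have az: "cmod a < 1" "cmod z < 1" using assms by (auto simp: pdisk_def)
  note t = one_minus_square_pos[OF az(1)] one_minus_square_pos[OF az(2)]
  have q: "0 < 1 - R\<^sup>2" "1 - R\<^sup>2 \<le> 1" using assms by (auto simp: abs_square_less_1)
  have L: "1 \<le> 4 / (1 - R\<^sup>2)" using q by (simp add: field_simps)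
  have c: "1 - (cmod a)\<^sup>2 \<le> 4 / (1 - R\<^sup>2) * (1 - (cmod z)\<^sup>2)" "1 - (cmod z)\<^sup>2 \<le> 4 / (1 - R\<^sup>2) * (1 - (cmod a)\<^sup>2)"
    using pdisk_comparable(1)[OF assms(2-4)] pdisk_comparable(1)[OF assms(2)[unfolded pdisk_sym[of z]] assms(3,4)] by auto
  have w: "wdensity \<alpha> z = (1 + \<alpha>) / pi * (1 - (cmod z)\<^sup>2) powr \<alpha>"
    using az by (simp add: wdensity_def weight_def)
  have c0: "0 \<le> (1 + \<alpha>) / pi" using assms by simp
  show "wdensity \<alpha> z \<le> \<Lambda> * W"
    using mult_left_mono[OF powr_comparable[OF t(2,1) c(2,1) L, of \<alpha>] c0]
    by (simp only: w \<Lambda>_def W_def mult_ac)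
  show "W \<le> \<Lambda> * wdensity \<alpha> z"
    using mult_left_mono[OF powr_comparable[OF t c L, of \<alpha>] c0]
    by (simp only: w \<Lambda>_def W_def mult_ac)
  show "0 < W" unfolding W_def using assms(1) t by simp
qed

lemma wmass_mass_pdisk:
  assumes "\<alpha> > -1" "E \<subseteq> pdisk R a" "0 < R" "R < 1" "cmod a < 1" and [measurable]: "E \<in> sets borel" "f \<in> borel_measurable borel"
  defines "\<Lambda> \<equiv> (4 / (1 - R\<^sup>2)) powr \<bar>\<alpha>\<bar>" and "W \<equiv> (1 + \<alpha>) / pi * (1 - (cmod a)\<^sup>2) powr \<alpha>"
  shows "wmass \<alpha> E f \<le> ennreal (\<Lambda> * W) * mass E f" "ennreal W * mass E f \<le> ennreal \<Lambda> * wmass \<alpha> E f"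
proof -
  have "wmass \<alpha> E f \<le> (\<integral>\<^sup>+z. ennreal (\<Lambda> * W) * (indicator E z * ennreal ((cmod (f z))\<^sup>2)) \<partial>lborel)"
    unfolding wmass_def
  proof (rule nn_integral_mono)
    fix z
    have "ennreal (wdensity \<alpha> z) * ennreal ((cmod (f z))\<^sup>2) \<le> ennreal (\<Lambda> * W) * ennreal ((cmod (f z))\<^sup>2)" if "z \<in> E"
      using wdensity_pdisk(1)[OF assms(1) _ assms(3,4), of z a] that assms(2)
      by (intro mult_right_mono ennreal_leI) (auto simp: \<Lambda>_def W_def)
    then show "indicator E z * (ennreal (wdensity \<alpha> z) * ennreal ((cmod (f z))\<^sup>2))
        \<le> ennreal (\<Lambda> * W) * (indicator E z * ennreal ((cmod (f z))\<^sup>2))"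
      by (cases "z \<in> E") auto
  qed
  also have "\<dots> = ennreal (\<Lambda> * W) * mass E f"
    unfolding mass_def by (intro nn_integral_cmult) measurable
  finally show "wmass \<alpha> E f \<le> ennreal (\<Lambda> * W) * mass E f" .
  have "ennreal W * mass E f = (\<integral>\<^sup>+z. ennreal W * (indicator E z * ennreal ((cmod (f z))\<^sup>2)) \<partial>lborel)"
    unfolding mass_def by (intro nn_integral_cmult[symmetric]) measurable
  also have "\<dots> \<le> (\<integral>\<^sup>+z. ennreal \<Lambda> * (indicator E z * (ennreal (wdensity \<alpha> z) * ennreal ((cmod (f z))\<^sup>2))) \<partial>lborel)"
  proof (rule nn_integral_mono)
    fix z
    have "ennreal W * ennreal ((cmod (f z))\<^sup>2) \<le> ennreal (\<Lambda> * wdensity \<alpha> z) * ennreal ((cmod (f z))\<^sup>2)" if "z \<in> E"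
      using wdensity_pdisk(2)[OF assms(1) _ assms(3,4), of z a] that assms(2)
      by (intro mult_right_mono ennreal_leI) (auto simp: \<Lambda>_def W_def)
    moreover have "ennreal (\<Lambda> * wdensity \<alpha> z) = ennreal \<Lambda> * ennreal (wdensity \<alpha> z)"
      by (rule ennreal_mult'') (rule wdensity_nonneg[OF assms(1)])
    ultimately show "ennreal W * (indicator E z * ennreal ((cmod (f z))\<^sup>2))
        \<le> ennreal \<Lambda> * (indicator E z * (ennreal (wdensity \<alpha> z) * ennreal ((cmod (f z))\<^sup>2)))"
      by (cases "z \<in> E") (auto simp: mult.assoc)
  qed
  also have "\<dots> = ennreal \<Lambda> * wmass \<alpha> E f"
    unfolding wmass_def by (intro nn_integral_cmult) measurable
  finally show "ennreal W * mass E f \<le> ennreal \<Lambda> * wmass \<alpha> E f" .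
qed

text \<open>The Euclidean estimate is transferred with the weight frozen at the centre. The power 2
  + \<alpha> of 1 - |a|^2 is the order of the weighted area of the disk, so the hypothesis says that
  G has positive density in it, and the constants are uniform in a.\<close>

lemma pdisk_estimate:
  assumes \<alpha>: "\<alpha> > -1" and R: "0 < R" "R < R'" "R' < 1" and "\<delta> > 0" "M > 0"
  shows "\<exists>K>0. \<forall>f a G. f \<in> Lh2 \<alpha> \<longrightarrow> cmod a < 1 \<longrightarrow> G \<in> sets borel \<longrightarrow>
    ennreal (\<delta> * (1 - (cmod a)\<^sup>2) powr (2 + \<alpha>)) \<le> wmass \<alpha> (G \<inter> pdisk R a) (\<lambda>_. 1) \<longrightarrow>
    wmass \<alpha> (pdisk R a) f \<le> ennreal (1 / M) * wmass \<alpha> (pdisk R' a) f + ennreal K * wmass \<alpha> (G \<inter> pdisk R' a) f"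
proof -
  have R': "0 < R'" using R by simp
  define \<Lambda> where "\<Lambda> = (4 / (1 - R'\<^sup>2)) powr \<bar>\<alpha>\<bar>"
  have q: "0 < 1 - R'\<^sup>2" "R'\<^sup>2 > 0" using R R' by (auto simp: abs_square_less_1)
  have \<Lambda>: "\<Lambda> > 0" unfolding \<Lambda>_def using q by simp
  define e where "e = (R'\<^sup>2 - R\<^sup>2) * (1 - R'\<^sup>2) / (4 * R'\<^sup>2)"
  have "R\<^sup>2 < R'\<^sup>2" using R by (intro power_strict_mono) auto
  have e: "0 < e" "e < 1"
  proof -
    show "0 < e" unfolding e_def using \<open>R\<^sup>2 < R'\<^sup>2\<close> q by simp
    have "(R'\<^sup>2 - R\<^sup>2) * (1 - R'\<^sup>2) \<le> R'\<^sup>2 * 1"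
      using q \<open>R\<^sup>2 < R'\<^sup>2\<close> by (intro mult_mono) auto
    also have "\<dots> < 4 * R'\<^sup>2" using q by simp
    finally show "e < 1" unfolding e_def using q by simp
  qed
  define \<kappa> where "\<kappa> = sqrt (1 - e)"
  have \<kappa>: "0 < \<kappa>" "\<kappa> < 1" using e by (auto simp: \<kappa>_def)
  define c1 where "c1 = R' / (1 - R'\<^sup>2)"
  have c1: "c1 > 0" using R' q by (simp add: c1_def)
  \<comment> \<open>Dividing the density hypothesis by \<Lambda> W leaves \<delta> pi / (\<Lambda>
    (1 + \<alpha>)) times (1 - |a|^2)^2, and s \<le> c1 (1 - |a|^2) replaces the latter by s^2 /
    c1^2.\<close>
  define \<delta>1 where "\<delta>1 = \<delta> * pi / (\<Lambda> * (1 + \<alpha>)) / c1\<^sup>2"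
  have \<delta>1: "\<delta>1 > 0" unfolding \<delta>1_def using \<open>\<delta> > 0\<close> \<Lambda> \<alpha> c1 by simp
  \<comment> \<open>Removing the weight costs the factor \<Lambda> W and restoring it \<Lambda> / W;
    the extra \<Lambda>^2 in M pays for both.\<close>
  have M1: "M * \<Lambda>\<^sup>2 > 0" using \<open>M > 0\<close> \<Lambda> by simp
  obtain K where K: "K > 0 \<and> (\<forall>f E c s. s > 0 \<longrightarrow> harmonic_on (ball c s) f \<longrightarrow> f \<in> borel_measurable borel \<longrightarrow> E \<in> sets borel \<longrightarrow>
    E \<subseteq> ball c (\<kappa> * s) \<longrightarrow> ennreal (\<delta>1 * s\<^sup>2) \<le> emeasure lborel E \<longrightarrow>
    mass (ball c (\<kappa> * s)) f \<le> ennreal (1 / (M * \<Lambda>\<^sup>2)) * mass (ball c s) f + ennreal K * mass E f)"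
    using harmonic_local_estimate_ball[OF \<kappa> \<delta>1 M1] ..
  have "K * \<Lambda>\<^sup>2 > 0" using K \<Lambda> by simp
  moreover have "wmass \<alpha> (pdisk R a) f \<le> ennreal (1 / M) * wmass \<alpha> (pdisk R' a) f + ennreal (K * \<Lambda>\<^sup>2) * wmass \<alpha> (G \<inter> pdisk R' a) f"
    if f: "f \<in> Lh2 \<alpha>" and a: "cmod a < 1" and G: "G \<in> sets borel"
      and dens: "ennreal (\<delta> * (1 - (cmod a)\<^sup>2) powr (2 + \<alpha>)) \<le> wmass \<alpha> (G \<inter> pdisk R a) (\<lambda>_. 1)" for f a G
  proof -
    define W where "W = (1 + \<alpha>) / pi * (1 - (cmod a)\<^sup>2) powr \<alpha>"
    note ta = one_minus_square_pos[OF a]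
    have W: "W > 0" unfolding W_def using \<alpha> ta by simp
    obtain c s where cs: "pdisk R' a = ball c s" "s > 0" "s \<le> c1 * (1 - (cmod a)\<^sup>2)" "pdisk R a \<subseteq> ball c (\<kappa> * s)"
      using pdisk_euclidean[OF a R' R(3)] R(1,2) by (auto simp: c1_def \<kappa>_def e_def)
    note fm = Lh2_borel[OF f]
    have sub: "pdisk R a \<subseteq> pdisk R' a" using R by (intro pdisk_mono) simp
    define E where "E = G \<inter> pdisk R a"
    have E: "E \<in> sets borel" using G by (auto simp: E_def)
    have ER: "E \<subseteq> pdisk R' a" "E \<subseteq> ball c (\<kappa> * s)" using sub cs(4) by (auto simp: E_def)
    note wm = wmass_mass_pdisk[OF \<alpha> _ R' R(3) a, folded \<Lambda>_def W_def]
    have big: "ennreal (\<delta>1 * s\<^sup>2) \<le> emeasure lborel E"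
    proof -
      have m1: "mass E (\<lambda>_. 1) = emeasure lborel E" using E by (simp add: mass_def)
      have "ennreal (\<delta> * (1 - (cmod a)\<^sup>2) powr (2 + \<alpha>)) \<le> ennreal (\<Lambda> * W) * emeasure lborel E"
        using order_trans[OF dens[folded E_def]] wm(1)[OF ER(1) E, of "\<lambda>_. 1"] m1 by simp
      then have "ennreal (1 / (\<Lambda> * W)) * ennreal (\<delta> * (1 - (cmod a)\<^sup>2) powr (2 + \<alpha>))
          \<le> ennreal (1 / (\<Lambda> * W)) * (ennreal (\<Lambda> * W) * emeasure lborel E)"
        by (rule mult_left_mono) simp
      also have "\<dots> = emeasure lborel E"
        using \<Lambda> W by (simp add: mult.assoc[symmetric] ennreal_mult'[symmetric])
      finally have le: "ennreal (1 / (\<Lambda> * W)) * ennreal (\<delta> * (1 - (cmod a)\<^sup>2) powr (2 + \<alpha>)) \<le> emeasure lborel E" .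
      have "\<delta>1 * s\<^sup>2 \<le> \<delta>1 * (c1 * (1 - (cmod a)\<^sup>2))\<^sup>2"
        using cs(2,3) \<delta>1 by (intro mult_left_mono power_mono) auto
      also have "\<dots> = 1 / (\<Lambda> * W) * (\<delta> * (1 - (cmod a)\<^sup>2) powr (2 + \<alpha>))"
      proof -
        have *: "(1 - (cmod a)\<^sup>2) powr (2 + \<alpha>) = (1 - (cmod a)\<^sup>2)\<^sup>2 * (1 - (cmod a)\<^sup>2) powr \<alpha>"
          using ta powr_realpow[OF ta, of 2] by (simp add: powr_add)
        have "\<delta> * pi / (\<Lambda> * b) / c1\<^sup>2 * (c1 * T)\<^sup>2 = 1 / (\<Lambda> * (b / pi * P)) * (\<delta> * (T\<^sup>2 * P))"
          if "b > 0" "P > 0" for b P T :: real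
          using that c1 \<Lambda> by (simp add: power_mult_distrib)
        from this[of "1 + \<alpha>" "(1 - (cmod a)\<^sup>2) powr \<alpha>"] show ?thesis
          unfolding \<delta>1_def W_def * using \<alpha> ta by simp
      qed
      finally have "ennreal (\<delta>1 * s\<^sup>2) \<le> ennreal (1 / (\<Lambda> * W) * (\<delta> * (1 - (cmod a)\<^sup>2) powr (2 + \<alpha>)))"
        by (rule ennreal_leI)
      also have "\<dots> = ennreal (1 / (\<Lambda> * W)) * ennreal (\<delta> * (1 - (cmod a)\<^sup>2) powr (2 + \<alpha>))"
        using \<Lambda> W by (intro ennreal_mult') simp
      finally show ?thesis using le by (rule order_trans)
    qed
    have harm: "harmonic_on (ball c s) f"
    proof (rule harmonic_on_subset[OF _ convex_ball _ open_ball])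
      show "harmonic_on unit_disk f" using f by (simp add: Lh2_def)
      show "ball c s \<subseteq> unit_disk" unfolding cs(1)[symmetric] by (auto simp: pdisk_def)
    qed
    have loc: "mass (ball c (\<kappa> * s)) f \<le> ennreal (1 / (M * \<Lambda>\<^sup>2)) * mass (pdisk R' a) f + ennreal K * mass E f"
      unfolding cs(1) by (rule conjunct2[OF K, rule_format]) (rule cs(2) harm fm E ER(2) big)+
    have "wmass \<alpha> (pdisk R a) f \<le> ennreal (\<Lambda> * W) * mass (pdisk R a) f"
      by (rule wm(1)[OF sub pdisk_borel fm])
    also have "\<dots> \<le> ennreal (\<Lambda> * W) * (ennreal (1 / (M * \<Lambda>\<^sup>2)) * mass (pdisk R' a) f + ennreal K * mass E f)"
      by (intro mult_left_mono order_trans[OF mass_mono[OF cs(4)] loc]) simp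
    also have "\<dots> = ennreal (1 / (M * \<Lambda>)) * (ennreal W * mass (pdisk R' a) f) + ennreal (K * \<Lambda>) * (ennreal W * mass E f)"
    proof -
      have "ennreal (\<Lambda> * W) * ennreal (1 / (M * \<Lambda>\<^sup>2)) = ennreal (1 / (M * \<Lambda>)) * ennreal W"
        using \<Lambda> W \<open>M > 0\<close> by (simp add: ennreal_mult'[symmetric] power2_eq_square field_simps)
      moreover have "ennreal (\<Lambda> * W) * ennreal K = ennreal (K * \<Lambda>) * ennreal W"
        using \<Lambda> W K by (simp add: ennreal_mult'[symmetric] mult_ac)
      ultimately show ?thesis by (simp add: distrib_left mult.assoc[symmetric])
    qed
    also have "\<dots> \<le> ennreal (1 / (M * \<Lambda>)) * (ennreal \<Lambda> * wmass \<alpha> (pdisk R' a) f) + ennreal (K * \<Lambda>) * (ennreal \<Lambda> * wmass \<alpha> E f)"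
      by (intro add_mono mult_left_mono wm(2)[OF order_refl pdisk_borel fm] wm(2)[OF ER(1) E fm]) simp_all
    also have "\<dots> = ennreal (1 / M) * wmass \<alpha> (pdisk R' a) f + ennreal (K * \<Lambda>\<^sup>2) * wmass \<alpha> E f"
    proof -
      have "ennreal (1 / (M * \<Lambda>)) * ennreal \<Lambda> = ennreal (1 / M)"
        using \<Lambda> \<open>M > 0\<close> by (simp add: ennreal_mult'[symmetric])
      moreover have "ennreal (K * \<Lambda>) * ennreal \<Lambda> = ennreal (K * \<Lambda>\<^sup>2)"
        using \<Lambda> K by (simp add: ennreal_mult'[symmetric] power2_eq_square mult_ac)
      ultimately show ?thesis by (simp add: mult.assoc[symmetric])
    qed
    also have "wmass \<alpha> E f \<le> wmass \<alpha> (G \<inter> pdisk R' a) f"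
      unfolding wmass_def using sub by (intro nn_integral_mono mult_right_mono) (auto simp: E_def indicator_def)
    finally show ?thesis by (simp add: mult_left_mono)
  qed
  ultimately show ?thesis by (intro exI[of _ "K * \<Lambda>\<^sup>2"] conjI allI impI)
qed

section \<open>Averaging over all centres\<close>

lemma invariant_measure_pdisk:
  assumes R: "0 < R" "R < 1" and z: "cmod z < 1"
  defines "L \<equiv> 4 / (1 - R\<^sup>2)"
  shows "(\<integral>\<^sup>+a. indicator (pdisk R z) a * ennreal (1 / (1 - (cmod a)\<^sup>2)\<^sup>2) \<partial>lborel) \<le> ennreal (pi * L ^ 4)"
    and "ennreal (pi * R\<^sup>2 / (4 * L\<^sup>2)) \<le> (\<integral>\<^sup>+a. indicator (pdisk R z) a * ennreal (1 / (1 - (cmod a)\<^sup>2)\<^sup>2) \<partial>lborel)"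
proof -
  \<comment> \<open>The disk contains the ball of radius R t / 2, lies in the ball of radius L t,
    and 1 - |a|^2 is comparable to t on it. All powers of t cancel, so both bounds are free of
    z.\<close>
  define t where "t = 1 - (cmod z)\<^sup>2"
  have t: "t > 0" using one_minus_square_pos[OF z] by (simp add: t_def)
  have q: "0 < 1 - R\<^sup>2" using R by (auto simp: abs_square_less_1)
  have L: "L > 0" using q by (simp add: L_def)
  have vol: "emeasure lborel (ball c r :: complex set) = ennreal (pi * r\<^sup>2)" 
    "emeasure lborel (cball c r :: complex set) = ennreal (pi * r\<^sup>2)" if "r \<ge> 0" for r and c :: complex
    using that unit_ball_vol_even[of 1] by (auto simp: emeasure_ball emeasure_cball)
  have comp: "0 < 1 - (cmod a)\<^sup>2" "1 - (cmod a)\<^sup>2 \<le> L * t" "t \<le> L * (1 - (cmod a)\<^sup>2)" "cmod (a - z) \<le> L * t" if a: "a \<in> pdisk R z" for a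
    using pdisk_comparable[OF a R] pdisk_comparable(1)[OF a[unfolded pdisk_sym[of a]] R] a one_minus_square_pos[of a]
    by (auto simp: t_def L_def pdisk_def)
  have "(\<integral>\<^sup>+a. indicator (pdisk R z) a * ennreal (1 / (1 - (cmod a)\<^sup>2)\<^sup>2) \<partial>lborel)
      \<le> (\<integral>\<^sup>+a. ennreal (L\<^sup>2 / t\<^sup>2) * indicator (cball z (L * t)) a \<partial>lborel)"
  proof (rule nn_integral_mono)
    fix a
    show "indicator (pdisk R z) a * ennreal (1 / (1 - (cmod a)\<^sup>2)\<^sup>2) \<le> ennreal (L\<^sup>2 / t\<^sup>2) * indicator (cball z (L * t)) a"
    proof (cases "a \<in> pdisk R z")
      case True
      note c = comp[OF True]
      have "(t / L)\<^sup>2 \<le> (1 - (cmod a)\<^sup>2)\<^sup>2" using c(3) L t by (intro power_mono) (auto simp: field_simps)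
      then have "1 / (1 - (cmod a)\<^sup>2)\<^sup>2 \<le> 1 / (t / L)\<^sup>2"
        using t L c(1) by (intro divide_left_mono) auto
      then have "ennreal (1 / (1 - (cmod a)\<^sup>2)\<^sup>2) \<le> ennreal (L\<^sup>2 / t\<^sup>2)"
        by (intro ennreal_leI) (simp add: power_divide)
      moreover have "a \<in> cball z (L * t)" using c(4) by (simp add: dist_norm norm_minus_commute)
      ultimately show ?thesis using True by simp
    qed simp
  qed
  also have "\<dots> = ennreal (L\<^sup>2 / t\<^sup>2) * ennreal (pi * (L * t)\<^sup>2)"
    using L t by (subst nn_integral_cmult_indicator) (auto simp: vol)
  also have "\<dots> = ennreal (pi * L ^ 4)"
    using L t by (simp add: ennreal_mult'[symmetric] power_mult_distrib power2_eq_square field_simps)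
      (simp add: power4_eq_xxxx mult_ac)
  finally show "(\<integral>\<^sup>+a. indicator (pdisk R z) a * ennreal (1 / (1 - (cmod a)\<^sup>2)\<^sup>2) \<partial>lborel) \<le> ennreal (pi * L ^ 4)" .
  have "ennreal (pi * R\<^sup>2 / (4 * L\<^sup>2)) = ennreal (1 / (L * t)\<^sup>2) * ennreal (pi * (R / 2 * t)\<^sup>2)"
    using L t by (simp add: ennreal_mult'[symmetric] power_mult_distrib field_simps)
  also have "\<dots> = (\<integral>\<^sup>+a. ennreal (1 / (L * t)\<^sup>2) * indicator (ball z (R / 2 * t)) a \<partial>lborel)"
    using R t by (subst nn_integral_cmult_indicator) (auto simp: vol)
  also have "\<dots> \<le> (\<integral>\<^sup>+a. indicator (pdisk R z) a * ennreal (1 / (1 - (cmod a)\<^sup>2)\<^sup>2) \<partial>lborel)"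
  proof (rule nn_integral_mono)
    fix a
    show "ennreal (1 / (L * t)\<^sup>2) * indicator (ball z (R / 2 * t)) a \<le> indicator (pdisk R z) a * ennreal (1 / (1 - (cmod a)\<^sup>2)\<^sup>2)"
    proof (cases "a \<in> ball z (R / 2 * t)")
      case True
      then have a: "a \<in> pdisk R z" using ball_subset_pdisk[OF z R] unfolding t_def by blast
      have "(1 - (cmod a)\<^sup>2)\<^sup>2 \<le> (L * t)\<^sup>2" using comp[OF a] by (intro power_mono) auto
      then have "1 / (L * t)\<^sup>2 \<le> 1 / (1 - (cmod a)\<^sup>2)\<^sup>2"
        using t L comp(1)[OF a] by (intro divide_left_mono) auto
      then show ?thesis using a by (simp add: indicator_def ennreal_leI)
    qed simp
  qed
  finally show "ennreal (pi * R\<^sup>2 / (4 * L\<^sup>2)) \<le> (\<integral>\<^sup>+a. indicator (pdisk R z) a * ennreal (1 / (1 - (cmod a)\<^sup>2)\<^sup>2) \<partial>lborel)" .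
qed

text \<open>Tonelli and the symmetry of the pseudohyperbolic relation. The indicator is written as a
  function of both variables to exhibit joint measurability.\<close>

lemma invariant_average_swap:
  assumes [measurable]: "h \<in> borel_measurable borel"
  shows "(\<integral>\<^sup>+a. ennreal (1 / (1 - (cmod a)\<^sup>2)\<^sup>2) * (\<integral>\<^sup>+z. indicator (pdisk R a) z * h z \<partial>lborel) \<partial>lborel)
    = (\<integral>\<^sup>+z. h z * (\<integral>\<^sup>+a. indicator (pdisk R z) a * ennreal (1 / (1 - (cmod a)\<^sup>2)\<^sup>2) \<partial>lborel) \<partial>lborel)"
proof -
  define p where "p a z = (if cmod a < 1 \<and> cmod z < 1 \<and> cmod (z - a) < R * cmod (1 - cnj a * z) then 1 else 0 :: ennreal)" for a z
  have p: "indicator (pdisk R a) z = p a z" for a z by (simp add: p_def pdisk_def indicator_def)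
  have p': "indicator (pdisk R z) a = p a z" for a z
    using pdisk_sym[of z R a] by (simp add: p[symmetric] indicator_def)
  have [measurable]: "(\<lambda>x. p (fst x) (snd x)) \<in> borel_measurable (lborel \<Otimes>\<^sub>M lborel)"
    unfolding p_def by measurable
  have [measurable]: "p a \<in> borel_measurable borel" "(\<lambda>a. p a z) \<in> borel_measurable borel" for a z
    unfolding p_def by measurable
  let ?w = "\<lambda>a::complex. ennreal (1 / (1 - (cmod a)\<^sup>2)\<^sup>2)"
  have "(\<integral>\<^sup>+a. ?w a * (\<integral>\<^sup>+z. p a z * h z \<partial>lborel) \<partial>lborel) = (\<integral>\<^sup>+a. (\<integral>\<^sup>+z. ?w a * (p a z * h z) \<partial>lborel) \<partial>lborel)"
    by (intro nn_integral_cong nn_integral_cmult[symmetric]) measurable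
  also have "\<dots> = (\<integral>\<^sup>+z. (\<integral>\<^sup>+a. ?w a * (p a z * h z) \<partial>lborel) \<partial>lborel)"
    by (rule lborel_pair.Fubini'[symmetric]) measurable
  also have "\<dots> = (\<integral>\<^sup>+z. (\<integral>\<^sup>+a. h z * (p a z * ?w a) \<partial>lborel) \<partial>lborel)"
    by (simp add: mult_ac)
  also have "\<dots> = (\<integral>\<^sup>+z. h z * (\<integral>\<^sup>+a. p a z * ?w a \<partial>lborel) \<partial>lborel)"
    by (intro nn_integral_cong nn_integral_cmult) measurable
  finally have "(\<integral>\<^sup>+a. ?w a * (\<integral>\<^sup>+z. p a z * h z \<partial>lborel) \<partial>lborel) = \<dots>" .
  moreover have "(\<integral>\<^sup>+z. h z * (\<integral>\<^sup>+a. indicator (pdisk R z) a * ?w a \<partial>lborel) \<partial>lborel)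
      = (\<integral>\<^sup>+z. h z * (\<integral>\<^sup>+a. p a z * ?w a \<partial>lborel) \<partial>lborel)" by (simp only: p')
  ultimately show ?thesis by (simp only: p)
qed

lemma invariant_average_measurable:
  assumes [measurable]: "h \<in> borel_measurable borel"
  shows "(\<lambda>a. ennreal (1 / (1 - (cmod a)\<^sup>2)\<^sup>2) * (\<integral>\<^sup>+z. indicator (pdisk R a) z * h z \<partial>lborel)) \<in> borel_measurable lborel"
proof -
  define p where "p a z = (if cmod a < 1 \<and> cmod z < 1 \<and> cmod (z - a) < R * cmod (1 - cnj a * z) then 1 else 0 :: ennreal)" for a z
  have p: "indicator (pdisk R a) z = p a z" for a z by (simp add: p_def pdisk_def indicator_def)
  have [measurable]: "(\<lambda>x. p (fst x) (snd x)) \<in> borel_measurable (lborel \<Otimes>\<^sub>M lborel)"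
    unfolding p_def by measurable
  show ?thesis unfolding p by measurable
qed

text \<open>A point z is counted by the centres in its own disk, whose invariant measure lies
  between two positive constants; hence the average of the local masses is comparable to the total
  mass.\<close>

lemma wmass_cover:
  fixes R :: real
  assumes R: "0 < R" "R < 1" and \<alpha>: "\<alpha> > -1" and [measurable]: "f \<in> borel_measurable borel" "G \<in> sets borel"
  defines "L \<equiv> 4 / (1 - R\<^sup>2)"
  defines "I \<equiv> (\<integral>\<^sup>+a. ennreal (1 / (1 - (cmod a)\<^sup>2)\<^sup>2) * wmass \<alpha> (G \<inter> pdisk R a) f \<partial>lborel)"
  shows "I \<le> ennreal (pi * L ^ 4) * wmass \<alpha> G f"
    and "ennreal (pi * R\<^sup>2 / (4 * L\<^sup>2)) * wmass \<alpha> G f \<le> I"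
    and "(\<lambda>a. ennreal (1 / (1 - (cmod a)\<^sup>2)\<^sup>2) * wmass \<alpha> (G \<inter> pdisk R a) f) \<in> borel_measurable lborel"
proof -
  define h where "h z = indicator G z * (ennreal (wdensity \<alpha> z) * ennreal ((cmod (f z))\<^sup>2))" for z
  have hm[measurable]: "h \<in> borel_measurable borel" unfolding h_def by measurable
  have h0: "h z = 0" if "\<not> cmod z < 1" for z using that by (simp add: h_def wdensity_def)
  have w: "wmass \<alpha> (G \<inter> pdisk R a) f = (\<integral>\<^sup>+z. indicator (pdisk R a) z * h z \<partial>lborel)" for a
    unfolding wmass_def h_def by (intro nn_integral_cong) (auto simp: indicator_def)
  have wG: "wmass \<alpha> G f = (\<integral>\<^sup>+z. h z \<partial>lborel)" by (simp add: wmass_def h_def)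
  have I: "I = (\<integral>\<^sup>+z. h z * (\<integral>\<^sup>+a. indicator (pdisk R z) a * ennreal (1 / (1 - (cmod a)\<^sup>2)\<^sup>2) \<partial>lborel) \<partial>lborel)"
    unfolding I_def w by (rule invariant_average_swap) measurable
  have "I \<le> (\<integral>\<^sup>+z. ennreal (pi * L ^ 4) * h z \<partial>lborel)"
    unfolding I
  proof (rule nn_integral_mono)
    fix z
    show "h z * (\<integral>\<^sup>+a. indicator (pdisk R z) a * ennreal (1 / (1 - (cmod a)\<^sup>2)\<^sup>2) \<partial>lborel) \<le> ennreal (pi * L ^ 4) * h z"
    proof (cases "cmod z < 1")
      case True
      show ?thesis using mult_left_mono[OF invariant_measure_pdisk(1)[OF R True], of "h z"]
        by (simp add: L_def mult.commute)
    qed (simp add: h0)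
  qed
  then show "I \<le> ennreal (pi * L ^ 4) * wmass \<alpha> G f"
    unfolding wG by (subst nn_integral_cmult[symmetric]) simp_all
  have "(\<integral>\<^sup>+z. ennreal (pi * R\<^sup>2 / (4 * L\<^sup>2)) * h z \<partial>lborel) \<le> I"
    unfolding I
  proof (rule nn_integral_mono)
    fix z
    show "ennreal (pi * R\<^sup>2 / (4 * L\<^sup>2)) * h z \<le> h z * (\<integral>\<^sup>+a. indicator (pdisk R z) a * ennreal (1 / (1 - (cmod a)\<^sup>2)\<^sup>2) \<partial>lborel)"
    proof (cases "cmod z < 1")
      case True
      show ?thesis using mult_left_mono[OF invariant_measure_pdisk(2)[OF R True], of "h z"]
        by (simp add: L_def mult.commute)
    qed (simp add: h0)
  qed
  then show "ennreal (pi * R\<^sup>2 / (4 * L\<^sup>2)) * wmass \<alpha> G f \<le> I"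
    unfolding wG by (subst nn_integral_cmult[symmetric]) simp_all
  show "(\<lambda>a. ennreal (1 / (1 - (cmod a)\<^sup>2)\<^sup>2) * wmass \<alpha> (G \<inter> pdisk R a) f) \<in> borel_measurable lborel"
    unfolding w by (rule invariant_average_measurable) measurable
qed

text \<open>Integrating the local estimate over all centres against the invariant measure
  \<open>dA(a) / (1 - |a|\<^sup>2)\<^sup>2\<close> replaces a covering argument.\<close>

lemma density_imp_reverse_carleson:
  assumes \<alpha>: "\<alpha> > -1" and G: "G \<in> sets borel" and R: "0 < R" "R < 1" and "\<delta> > 0"
    and dens: "AE a in lborel. cmod a < 1 \<longrightarrow>
      ennreal (\<delta> * (1 - (cmod a)\<^sup>2) powr (2 + \<alpha>)) \<le> wmass \<alpha> (G \<inter> pdisk R a) (\<lambda>_. 1)"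
  shows "\<exists>C>0. \<forall>f\<in>Lh2 \<alpha>. wmass \<alpha> UNIV f \<le> ennreal C * wmass \<alpha> G f"
proof -
  define R' where "R' = (R + 1) / 2"
  have R': "R < R'" "R' < 1" "0 < R'" using R by (auto simp: R'_def)
  define mI where "mI = pi * R\<^sup>2 / (4 * (4 / (1 - R\<^sup>2))\<^sup>2)"
  define mO where "mO = pi * (4 / (1 - R'\<^sup>2)) ^ 4"
  have "R\<^sup>2 < 1" "R'\<^sup>2 < 1" using R R' by (auto simp: abs_square_less_1)
  then have m: "mI > 0" "mO > 0" using R by (auto simp: mI_def mO_def)
  \<comment> \<open>With this M the averaged error on the larger disks is at most mI / 2 times the
    squared norm, half of the left side.\<close>
  define M where "M = 2 * mO / mI"
  have "M > 0" using m by (simp add: M_def)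
  obtain K where K: "K > 0 \<and> (\<forall>f a G. f \<in> Lh2 \<alpha> \<longrightarrow> cmod a < 1 \<longrightarrow> G \<in> sets borel \<longrightarrow>
    ennreal (\<delta> * (1 - (cmod a)\<^sup>2) powr (2 + \<alpha>)) \<le> wmass \<alpha> (G \<inter> pdisk R a) (\<lambda>_. 1) \<longrightarrow>
    wmass \<alpha> (pdisk R a) f \<le> ennreal (1 / M) * wmass \<alpha> (pdisk R' a) f + ennreal K * wmass \<alpha> (G \<inter> pdisk R' a) f)"
    using pdisk_estimate[OF \<alpha> R(1) R'(1,2) \<open>\<delta> > 0\<close> \<open>M > 0\<close>] ..
  define C where "C = 2 * K * mO / mI"
  have "C > 0" using K m by (simp add: C_def)
  moreover have "wmass \<alpha> UNIV f \<le> ennreal C * wmass \<alpha> G f" if f: "f \<in> Lh2 \<alpha>" for f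
  proof -
    note fm = Lh2_borel[OF f]
    let ?w = "\<lambda>a::complex. ennreal (1 / (1 - (cmod a)\<^sup>2)\<^sup>2)"
    define X where "X = wmass \<alpha> UNIV f"
    define Y where "Y = wmass \<alpha> G f"
    \<comment> \<open>Finiteness is what allows the error term to be subtracted.\<close>
    have Xfin: "X < \<infinity>"
    proof -
      have "X = (\<integral>\<^sup>+z. ennreal ((cmod (f z))\<^sup>2) \<partial>weighted_area \<alpha>)"
        unfolding X_def wmass_def using fm by (subst nn_integral_weighted_area[OF \<alpha>]) auto
      also have "\<dots> < \<infinity>"
        using f by (auto simp: Lh2_def integrable_iff_bounded)
      finally show ?thesis .
    qed
    note cI = wmass_cover[OF R \<alpha> fm, of UNIV, unfolded Int_UNIV_left]
      and cO = wmass_cover[OF R'(3,2) \<alpha> fm, of UNIV, unfolded Int_UNIV_left]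
      and cG = wmass_cover[OF R'(3,2) \<alpha> fm G]
    have "ennreal mI * X \<le> (\<integral>\<^sup>+a. ?w a * wmass \<alpha> (pdisk R a) f \<partial>lborel)"
      unfolding X_def mI_def by (rule cI(2)) simp
    also have "\<dots> \<le> (\<integral>\<^sup>+a. ennreal (1 / M) * (?w a * wmass \<alpha> (pdisk R' a) f)
        + ennreal K * (?w a * wmass \<alpha> (G \<inter> pdisk R' a) f) \<partial>lborel)"
    proof (rule nn_integral_mono_AE)
      show "AE a in lborel. ?w a * wmass \<alpha> (pdisk R a) f \<le> ennreal (1 / M) * (?w a * wmass \<alpha> (pdisk R' a) f)
        + ennreal K * (?w a * wmass \<alpha> (G \<inter> pdisk R' a) f)"
        using dens
      proof eventually_elim
        case (elim a)
        show ?case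
        proof (cases "cmod a < 1")
          case True
          have "wmass \<alpha> (pdisk R a) f \<le> ennreal (1 / M) * wmass \<alpha> (pdisk R' a) f + ennreal K * wmass \<alpha> (G \<inter> pdisk R' a) f"
            by (rule conjunct2[OF K, rule_format]) (rule f True G mp[OF elim True])+
          from mult_left_mono[OF this, of "?w a"] show ?thesis by (simp add: distrib_left mult_ac)
        next
          case False
          then have "pdisk R a = {}" by (auto simp: pdisk_def)
          then show ?thesis by (simp add: wmass_def)
        qed
      qed
    qed
    also have "\<dots> = ennreal (1 / M) * (\<integral>\<^sup>+a. ?w a * wmass \<alpha> (pdisk R' a) f \<partial>lborel)
        + ennreal K * (\<integral>\<^sup>+a. ?w a * wmass \<alpha> (G \<inter> pdisk R' a) f \<partial>lborel)"
      using cO(3) cG(3) by (simp add: nn_integral_add nn_integral_cmult)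
    also have "\<dots> \<le> ennreal (1 / M) * (ennreal mO * X) + ennreal K * (ennreal mO * Y)"
      unfolding X_def Y_def mO_def by (intro add_mono mult_left_mono cO(1) cG(1)) simp_all
    finally have main: "ennreal mI * X \<le> ennreal (1 / M) * (ennreal mO * X) + ennreal K * (ennreal mO * Y)" .
    define x where "x = enn2real X"
    have X: "X = ennreal x" "x \<ge> 0" using Xfin by (auto simp: x_def)
    show ?thesis
    proof (cases "Y = \<infinity>")
      case True
      then show ?thesis using \<open>C > 0\<close> by (simp add: Y_def ennreal_mult_top)
    next
      case False
      define y where "y = enn2real Y"
      have Y: "Y = ennreal y" "y \<ge> 0" using False by (auto simp: y_def less_top)
      have "ennreal (mI * x) \<le> ennreal (1 / M * (mO * x) + K * (mO * y))"
        using main m K \<open>M > 0\<close> X(2) Y(2)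
        by (simp add: X(1) Y(1) ennreal_mult'[symmetric] ennreal_plus[symmetric] del: ennreal_plus)
      then have "mI * x \<le> 1 / M * (mO * x) + K * (mO * y)"
        using m K \<open>M > 0\<close> X(2) Y(2) by (subst (asm) ennreal_le_iff) auto
      also have "1 / M * (mO * x) = mI * x / 2" using m by (simp add: M_def field_simps)
      finally have "x \<le> C * y" using m by (simp add: C_def field_simps)
      then show ?thesis
        using \<open>C > 0\<close> unfolding X_def[symmetric] Y_def[symmetric] X(1) Y(1)
        by (simp add: ennreal_mult'[symmetric] ennreal_leI)
    qed
  qed
  ultimately show ?thesis by blast
qed

section \<open>The Berezin transform\<close>

lemma cmod_powr_real:
  assumes "x \<noteq> 0"
  shows "cmod (x powr complex_of_real p) = cmod x powr p"
  using assms by (simp add: powr_def norm_exp_eq_Re)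

lemma AE_weighted_area_iff:
  assumes \<alpha>: "\<alpha> > -1"
  shows "(AE z in weighted_area \<alpha>. P z) \<longleftrightarrow> (AE z in lborel. z \<in> unit_disk \<longrightarrow> P z)"
proof -
  have m: "(\<lambda>z. ennreal (weight \<alpha> z)) \<in> borel_measurable (lebesgue_on unit_disk)"
    by (intro measurable_restrict_space1 measurable_completion) simp
  have "(AE z in weighted_area \<alpha>. P z)
      \<longleftrightarrow> (AE z in lebesgue_on unit_disk. 0 < ennreal (1/pi) \<longrightarrow> 0 < ennreal (weight \<alpha> z) \<longrightarrow> P z)"
    unfolding weighted_area_def disk_area_def using m by (subst AE_density, simp, subst AE_density) simp_all
  also have "\<dots> \<longleftrightarrow> (AE z in lebesgue. z \<in> unit_disk \<longrightarrow> P z)"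
    using weight_pos[OF \<alpha>] by (subst AE_restrict_space_iff) (auto intro!: AE_cong)
  also have "\<dots> \<longleftrightarrow> (AE z in lborel. z \<in> unit_disk \<longrightarrow> P z)" by (rule AE_completion_iff)
  finally show ?thesis .
qed

text \<open>Superlevel sets of the symbol are only Lebesgue measurable, whereas the local estimates
  are stated for Borel sets; a change on a null set bridges the gap.\<close>

lemma borel_representative:
  assumes \<alpha>: "\<alpha> > -1" and G: "G \<in> sets (lebesgue_on unit_disk)"
  obtains S where "S \<in> sets borel" "AE z in weighted_area \<alpha>. z \<in> G \<longleftrightarrow> z \<in> S"
proof -
  have "G \<in> sets lebesgue" using G by (subst (asm) sets_restrict_space_iff) auto
  then obtain S N N' where S: "G = S \<union> N" "N \<subseteq> N'" "N' \<in> null_sets lborel" "S \<in> sets lborel"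
    by (rule sets_completionE)
  have "AE z in lborel. z \<notin> N'" by (rule AE_not_in[OF S(3)])
  then have "AE z in lborel. z \<in> unit_disk \<longrightarrow> (z \<in> G \<longleftrightarrow> z \<in> S)"
    by eventually_elim (use S(1,2) in blast)
  then show thesis using S(4) by (intro that[of S]) (simp_all add: AE_weighted_area_iff[OF \<alpha>])
qed

text \<open>On the disk this is the squared modulus of the Bergman kernel. As a real power of a
  modulus it is Borel on the whole plane, and its exponent can be split when the parameter
  changes.\<close>

definition kernel_square :: "real \<Rightarrow> complex \<Rightarrow> complex \<Rightarrow> real" where
  "kernel_square \<alpha> a w = cmod (1 - cnj a * w) powr (- (2 * (2 + \<alpha>)))"

lemma kernel_square_borel[measurable]: "kernel_square \<alpha> a \<in> borel_measurable borel"
  unfolding kernel_square_def[abs_def] by measurable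

lemma denominator_bounds:
  assumes "cmod a < 1" "cmod w < 1"
  shows "0 < cmod (1 - cnj a * w)" "cmod (1 - cnj a * w) \<le> 2"
proof -
  show "0 < cmod (1 - cnj a * w)"
    using less_le_trans[OF half_gt_zero[OF one_minus_square_pos[OF assms(1)]] denominator_lower_bound[OF assms]] .
  have "cmod a * cmod w \<le> 1" using assms by (intro mult_le_one) auto
  then show "cmod (1 - cnj a * w) \<le> 2"
    using norm_triangle_ineq4[of 1 "cnj a * w"] by (simp add: norm_mult)
qed

lemma bergman_kernel_square:
  assumes "cmod a < 1" "cmod w < 1"
  shows "cmod (bergman_kernel \<alpha> a w) = cmod (1 - cnj a * w) powr (- (2 + \<alpha>))"
    and "(cmod (bergman_kernel \<alpha> a w))\<^sup>2 = kernel_square \<alpha> a w"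
proof -
  have nz: "1 - cnj a * w \<noteq> 0" using denominator_bounds(1)[OF assms] by auto
  show *: "cmod (bergman_kernel \<alpha> a w) = cmod (1 - cnj a * w) powr (- (2 + \<alpha>))"
    unfolding bergman_kernel_def using cmod_powr_real[OF nz, of "- (2 + \<alpha>)"] by simp
  show "(cmod (bergman_kernel \<alpha> a w))\<^sup>2 = kernel_square \<alpha> a w"
    unfolding * kernel_square_def power2_eq_square powr_add[symmetric] by simp
qed

lemma two_plus_powr_pos: "0 < (2 :: real) + 2 powr x"
  by (intro add_pos_pos) simp_all

text \<open>|R| \<le> 2 |K| + 1, and the denominator is at most 2, so 1 \<le> 2^(2 + \<alpha>) |K|;
  the additive constant is thus absorbed.\<close>

lemma harmonic_kernel_le:
  assumes "\<alpha> > -1" "cmod a < 1" "cmod w < 1"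
  shows "(cmod (harmonic_kernel \<alpha> a w))\<^sup>2 \<le> (2 + 2 powr (2 + \<alpha>))\<^sup>2 * kernel_square \<alpha> a w"
proof -
  let ?K = "cmod (bergman_kernel \<alpha> a w)"
  have "2 powr (- (2 + \<alpha>)) \<le> ?K"
    unfolding bergman_kernel_square(1)[OF assms(2,3)]
    using denominator_bounds[OF assms(2,3)] assms(1) by (intro powr_mono2') auto
  then have "2 powr (2 + \<alpha>) * 2 powr (- (2 + \<alpha>)) \<le> 2 powr (2 + \<alpha>) * ?K"
    by (intro mult_left_mono) auto
  then have "1 \<le> 2 powr (2 + \<alpha>) * ?K" by (simp add: powr_add[symmetric])
  moreover have "cmod (harmonic_kernel \<alpha> a w) \<le> ?K + ?K + 1"
    unfolding harmonic_kernel_def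
    by (intro order_trans[OF norm_triangle_ineq4] add_mono order_trans[OF norm_triangle_ineq]) simp_all
  ultimately have "cmod (harmonic_kernel \<alpha> a w) \<le> (2 + 2 powr (2 + \<alpha>)) * ?K"
    by (simp add: algebra_simps)
  then have "(cmod (harmonic_kernel \<alpha> a w))\<^sup>2 \<le> ((2 + 2 powr (2 + \<alpha>)) * ?K)\<^sup>2"
    by (intro power_mono) auto
  then show ?thesis by (simp add: power_mult_distrib bergman_kernel_square(2)[OF assms(2,3)])
qed

lemma kernel_square_le:
  assumes "\<alpha> > -1" "cmod a < 1" "cmod w < 1"
  shows "kernel_square \<alpha> a w \<le> ((1 - (cmod a)\<^sup>2) / 2) powr (- (2 * (2 + \<alpha>)))" "0 \<le> kernel_square \<alpha> a w"
  unfolding kernel_square_def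
  using denominator_lower_bound[OF assms(2,3)] one_minus_square_pos[OF assms(2)] assms(1)
  by (auto intro!: powr_mono2')

lemma kernel_square_integrable:
  assumes "\<alpha> > -1" "cmod a < 1"
  shows "integrable (weighted_area \<alpha>) (kernel_square \<alpha> a)"
  by (rule integrable_weighted_area_bounded[OF assms(1) borel_imp_measurable_weighted_area, where B="((1 - (cmod a)\<^sup>2) / 2) powr (- (2 * (2 + \<alpha>)))"])
    (use kernel_square_le[OF assms] in auto)

lemma integral_kernel_square:
  assumes "\<alpha> > -1" "cmod a < 1"
  shows "(LINT w|weighted_area \<alpha>. kernel_square \<alpha> a w) = (1 - (cmod a)\<^sup>2) powr (- (2 + \<alpha>))"
proof -
  have "(LINT w|weighted_area \<alpha>. kernel_square \<alpha> a w) = (LINT w|weighted_area \<alpha>. (cmod (bergman_kernel \<alpha> a w))\<^sup>2)"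
    by (rule Bochner_Integration.integral_cong) (use bergman_kernel_square(2)[OF assms(2)] in auto)
  also have "\<dots> = (1 - (cmod a)\<^sup>2) powr (- (2 + \<alpha>))"
    using integral_bergman_kernel_square[OF assms] by (simp only: powr_minus_divide)
  finally show ?thesis .
qed

lemma nn_integral_kernel_square:
  assumes "\<alpha> > -1" "cmod a < 1"
  shows "(\<integral>\<^sup>+w. ennreal (wdensity \<alpha> w) * ennreal (kernel_square \<alpha> a w) \<partial>lborel)
    = ennreal ((1 - (cmod a)\<^sup>2) powr (- (2 + \<alpha>)))"
proof -
  have "(\<integral>\<^sup>+w. ennreal (wdensity \<alpha> w) * ennreal (kernel_square \<alpha> a w) \<partial>lborel)
      = (\<integral>\<^sup>+w. ennreal (kernel_square \<alpha> a w) \<partial>weighted_area \<alpha>)"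
    by (rule nn_integral_weighted_area[OF assms(1), symmetric]) measurable
  also have "\<dots> = ennreal (LINT w|weighted_area \<alpha>. kernel_square \<alpha> a w)"
    by (rule nn_integral_eq_integral[OF kernel_square_integrable[OF assms]])
      (simp add: kernel_square_def)
  finally show ?thesis by (simp only: integral_kernel_square[OF assms])
qed

text \<open>Off the pseudohyperbolic disk \<open>(1 - |a|\<^sup>2) (1 - |w|\<^sup>2) / |1 - cnj a w|\<^sup>2 \<le> 1 - R\<^sup>2\<close>; trading the
  power \<open>(1 + \<alpha>) / 2\<close> of this quotient for the small factor leaves the kernel of parameter
  \<open>(\<alpha> - 1) / 2 > -1\<close>, whose norm is known.\<close>

lemma kernel_square_tail:
  assumes \<alpha>: "\<alpha> > -1" and a: "cmod a < 1" and R: "0 < R" "R < 1"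
  shows "(LINT w|weighted_area \<alpha>. indicator (- pdisk R a) w * kernel_square \<alpha> a w)
    \<le> 2 * (1 - R\<^sup>2) powr ((1 + \<alpha>) / 2) * (1 - (cmod a)\<^sup>2) powr (- (2 + \<alpha>))"
proof -
  define \<beta> where "\<beta> = (1 + \<alpha>) / 2"
  define \<alpha>' where "\<alpha>' = \<alpha> - \<beta>"
  have \<beta>: "\<beta> > 0" "\<alpha>' > -1" "1 + \<alpha> = 2 * (1 + \<alpha>')" using \<alpha> by (auto simp: \<beta>_def \<alpha>'_def field_simps)
  define t where "t = 1 - (cmod a)\<^sup>2"
  have t: "t > 0" using one_minus_square_pos[OF a] by (simp add: t_def)
  have r: "0 < 1 - R\<^sup>2" using R by (simp add: abs_square_less_1)
  \<comment> \<open>The powers come from the traded quotient; the factor 2 is (1 + \<alpha>) / (1 +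
    \<alpha>'), the ratio of the normalisations of the two weights.\<close>
  define c where "c = 2 * (1 - R\<^sup>2) powr \<beta> * t powr (- \<beta>)"
  have c0: "c \<ge> 0" using c_def by simp
  have pt: "wdensity \<alpha> w * kernel_square \<alpha> a w \<le> c * (wdensity \<alpha>' w * kernel_square \<alpha>' a w)"
    if w: "cmod w < 1" "w \<notin> pdisk R a" for w
  proof -
    define u where "u = 1 - (cmod w)\<^sup>2"
    define N where "N = cmod (1 - cnj a * w)"
    have u: "u > 0" using one_minus_square_pos[OF w(1)] by (simp add: u_def)
    have N: "N > 0" using denominator_bounds[OF a w(1)] by (simp add: N_def)
    have "R * N \<le> cmod (w - a)" using w a by (simp add: pdisk_def N_def)
    then have "(R * N)\<^sup>2 \<le> (cmod (w - a))\<^sup>2" using R N by (intro power_mono) auto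
    then have "t * u \<le> (1 - R\<^sup>2) * N\<^sup>2"
      unfolding t_def u_def pseudohyperbolic_identity[symmetric] N_def by (simp add: power_mult_distrib algebra_simps)
    then have "(t * u) powr \<beta> \<le> ((1 - R\<^sup>2) * N\<^sup>2) powr \<beta>" using t u \<beta> by (intro powr_mono2) auto
    then have "t powr \<beta> * u powr \<beta> \<le> (1 - R\<^sup>2) powr \<beta> * N powr (2 * \<beta>)"
      using t u r N by (simp add: powr_mult powr_powr[symmetric] powr_realpow)
    then have "t powr (- \<beta>) * (t powr \<beta> * u powr \<beta>) \<le> t powr (- \<beta>) * ((1 - R\<^sup>2) powr \<beta> * N powr (2 * \<beta>))"
      by (intro mult_left_mono) auto
    then have ub: "u powr \<beta> \<le> (1 - R\<^sup>2) powr \<beta> * t powr (- \<beta>) * N powr (2 * \<beta>)"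
      using t by (simp add: mult.assoc[symmetric] powr_add[symmetric]) (simp add: mult_ac)
    have "u powr \<alpha> * N powr (- (2 * (2 + \<alpha>))) = u powr \<beta> * (u powr \<alpha>' * N powr (- (2 * (2 + \<alpha>))))"
      using u by (simp add: \<alpha>'_def powr_add[symmetric] mult.assoc[symmetric])
    also have "\<dots> \<le> ((1 - R\<^sup>2) powr \<beta> * t powr (- \<beta>) * N powr (2 * \<beta>)) * (u powr \<alpha>' * N powr (- (2 * (2 + \<alpha>))))"
      by (intro mult_right_mono ub) auto
    also have "\<dots> = (1 - R\<^sup>2) powr \<beta> * t powr (- \<beta>) * (u powr \<alpha>' * (N powr (2 * \<beta>) * N powr (- (2 * (2 + \<alpha>)))))"
      by (simp only: mult_ac)
    also have "N powr (2 * \<beta>) * N powr (- (2 * (2 + \<alpha>))) = N powr (- (2 * (2 + \<alpha>')))"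
      unfolding powr_add[symmetric] by (rule arg_cong) (simp add: \<alpha>'_def algebra_simps)
    finally have "u powr \<alpha> * N powr (- (2 * (2 + \<alpha>)))
        \<le> (1 - R\<^sup>2) powr \<beta> * t powr (- \<beta>) * (u powr \<alpha>' * N powr (- (2 * (2 + \<alpha>'))))" .
    then have "(1 + \<alpha>) / pi * (u powr \<alpha> * N powr (- (2 * (2 + \<alpha>))))
        \<le> (1 + \<alpha>) / pi * ((1 - R\<^sup>2) powr \<beta> * t powr (- \<beta>) * (u powr \<alpha>' * N powr (- (2 * (2 + \<alpha>')))))"
      using \<alpha> by (intro mult_left_mono) auto
    also have "\<dots> = c * ((1 + \<alpha>') / pi * (u powr \<alpha>' * N powr (- (2 * (2 + \<alpha>')))))"
      unfolding \<beta>(3) c_def by simp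
    finally show ?thesis
      using w(1) by (simp add: wdensity_def weight_def kernel_square_def u_def N_def)
  qed
  have "ennreal (LINT w|weighted_area \<alpha>. indicator (- pdisk R a) w * kernel_square \<alpha> a w)
      = (\<integral>\<^sup>+w. ennreal (indicator (- pdisk R a) w * kernel_square \<alpha> a w) \<partial>weighted_area \<alpha>)"
  proof (rule nn_integral_eq_integral[symmetric])
    have "(\<lambda>w. indicator (- pdisk R a) w * kernel_square \<alpha> a w) \<in> borel_measurable borel" by measurable
    then show "integrable (weighted_area \<alpha>) (\<lambda>w. indicator (- pdisk R a) w * kernel_square \<alpha> a w)"
      by (intro Bochner_Integration.integrable_bound[OF kernel_square_integrable[OF \<alpha> a]] borel_imp_measurable_weighted_area)
        (auto simp: indicator_def)
  qed (simp add: kernel_square_def)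
  also have "\<dots> = (\<integral>\<^sup>+w. ennreal (wdensity \<alpha> w) * ennreal (indicator (- pdisk R a) w * kernel_square \<alpha> a w) \<partial>lborel)"
    by (rule nn_integral_weighted_area[OF \<alpha>]) measurable
  also have "\<dots> \<le> (\<integral>\<^sup>+w. ennreal c * (ennreal (wdensity \<alpha>' w) * ennreal (kernel_square \<alpha>' a w)) \<partial>lborel)"
  proof (rule nn_integral_mono)
    fix w
    show "ennreal (wdensity \<alpha> w) * ennreal (indicator (- pdisk R a) w * kernel_square \<alpha> a w)
        \<le> ennreal c * (ennreal (wdensity \<alpha>' w) * ennreal (kernel_square \<alpha>' a w))"
    proof (cases "cmod w < 1 \<and> w \<notin> pdisk R a")
      case True
      have "ennreal (wdensity \<alpha> w * kernel_square \<alpha> a w) \<le> ennreal (c * (wdensity \<alpha>' w * kernel_square \<alpha>' a w))"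
        using pt True by (intro ennreal_leI) blast
      then show ?thesis
        using True c0 wdensity_nonneg[OF \<alpha>, of w] wdensity_nonneg[OF \<beta>(2), of w]
        by (simp add: ennreal_mult' kernel_square_def)
    next
      case False
      then have "wdensity \<alpha> w = 0 \<or> w \<in> pdisk R a" by (auto simp: wdensity_def)
      then show ?thesis by auto
    qed
  qed
  also have "\<dots> = ennreal c * ennreal (t powr (- (2 + \<alpha>')))"
    unfolding t_def by (subst nn_integral_cmult) (simp_all add: nn_integral_kernel_square[OF \<beta>(2) a])
  also have "\<dots> = ennreal (c * t powr (- (2 + \<alpha>')))" using c0 by (simp add: ennreal_mult')
  finally have "(LINT w|weighted_area \<alpha>. indicator (- pdisk R a) w * kernel_square \<alpha> a w) \<le> c * t powr (- (2 + \<alpha>'))"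
    using c0 by (subst (asm) ennreal_le_iff) auto
  also have "c * t powr (- (2 + \<alpha>')) = 2 * (1 - R\<^sup>2) powr \<beta> * (t powr (- \<beta>) * t powr (- (2 + \<alpha>')))"
    by (simp only: c_def mult.assoc)
  also have "t powr (- \<beta>) * t powr (- (2 + \<alpha>')) = t powr (- (2 + \<alpha>))"
    unfolding powr_add[symmetric] by (rule arg_cong) (simp add: \<alpha>'_def)
  finally show ?thesis by (simp only: \<beta>_def t_def)
qed

lemma harmonic_kernel_measurable:
  assumes "\<alpha> > -1" "cmod z < 1"
  shows "harmonic_kernel \<alpha> z \<in> borel_measurable (weighted_area \<alpha>)"
proof -
  note [measurable] = bergman_kernel_facts(3)[OF assms]
  show ?thesis unfolding harmonic_kernel_def[abs_def] by measurable
qed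

text \<open>With x = (1 - |z|^2)^(-(2 + \<alpha>)) \<ge> 1 the value 2 x - 1 is at least x and at
  least 1, so harmonic and analytic kernels have comparable norms.\<close>

lemma wnorm_harmonic_kernel_real:
  assumes "\<alpha> > -1" "cmod z < 1"
  shows "(wnorm \<alpha> (harmonic_kernel \<alpha> z))\<^sup>2 = 2 * (1 - (cmod z)\<^sup>2) powr (- (2 + \<alpha>)) - 1"
    and "(1 - (cmod z)\<^sup>2) powr (- (2 + \<alpha>)) \<le> (wnorm \<alpha> (harmonic_kernel \<alpha> z))\<^sup>2"
    and "1 \<le> (wnorm \<alpha> (harmonic_kernel \<alpha> z))\<^sup>2"
proof -
  have "complex_of_real ((wnorm \<alpha> (harmonic_kernel \<alpha> z))\<^sup>2)
      = complex_of_real (2 / (1 - (cmod z)\<^sup>2) powr (2 + \<alpha>) - 1)"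
    using wnorm_harmonic_kernel[OF assms] harmonic_kernel_diag[OF assms(2)] by (rule trans)
  then have "(wnorm \<alpha> (harmonic_kernel \<alpha> z))\<^sup>2 = 2 / (1 - (cmod z)\<^sup>2) powr (2 + \<alpha>) - 1"
    by (simp only: of_real_eq_iff)
  then show *: "(wnorm \<alpha> (harmonic_kernel \<alpha> z))\<^sup>2 = 2 * (1 - (cmod z)\<^sup>2) powr (- (2 + \<alpha>)) - 1"
    unfolding powr_minus divide_inverse .
  have "1 powr (- (2 + \<alpha>)) \<le> (1 - (cmod z)\<^sup>2) powr (- (2 + \<alpha>))"
    using one_minus_square_pos[OF assms(2)] assms(1) by (intro powr_mono2') auto
  then show "(1 - (cmod z)\<^sup>2) powr (- (2 + \<alpha>)) \<le> (wnorm \<alpha> (harmonic_kernel \<alpha> z))\<^sup>2"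
    "1 \<le> (wnorm \<alpha> (harmonic_kernel \<alpha> z))\<^sup>2" unfolding * by simp_all
qed

lemma harmonic_kernel_integrable:
  assumes "\<alpha> > -1" "cmod z < 1"
  shows "integrable (weighted_area \<alpha>) (\<lambda>w. (cmod (harmonic_kernel \<alpha> z w))\<^sup>2)"
proof (rule Bochner_Integration.integrable_bound)
  show "integrable (weighted_area \<alpha>) (\<lambda>w. (2 + 2 powr (2 + \<alpha>))\<^sup>2 * kernel_square \<alpha> z w)"
    by (intro integrable_mult_right kernel_square_integrable[OF assms])
  note [measurable] = harmonic_kernel_measurable[OF assms]
  show "(\<lambda>w. (cmod (harmonic_kernel \<alpha> z w))\<^sup>2) \<in> borel_measurable (weighted_area \<alpha>)" by measurable
  show "AE w in weighted_area \<alpha>. norm ((cmod (harmonic_kernel \<alpha> z w))\<^sup>2) \<le> norm ((2 + 2 powr (2 + \<alpha>))\<^sup>2 * kernel_square \<alpha> z w)"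
  proof (rule AE_I2)
    fix w assume "w \<in> space (weighted_area \<alpha>)"
    then have w: "cmod w < 1" by simp
    show "norm ((cmod (harmonic_kernel \<alpha> z w))\<^sup>2) \<le> norm ((2 + 2 powr (2 + \<alpha>))\<^sup>2 * kernel_square \<alpha> z w)"
      using harmonic_kernel_le[OF assms w] kernel_square_le(2)[OF assms w] by (simp add: abs_mult)
  qed
qed

section \<open>The Berezin transform of a real symbol\<close>

definition berezin_real :: "real \<Rightarrow> (complex \<Rightarrow> real) \<Rightarrow> complex \<Rightarrow> real" where
  "berezin_real \<alpha> \<phi> z = (LINT w|weighted_area \<alpha>. \<phi> w * (cmod (harmonic_kernel \<alpha> z w))\<^sup>2) /
     (wnorm \<alpha> (harmonic_kernel \<alpha> z))\<^sup>2"

lemma berezin_eq: "berezin \<alpha> (\<lambda>z. complex_of_real (\<phi> z)) z = complex_of_real (berezin_real \<alpha> \<phi> z)"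
proof -
  have "(LINT w|weighted_area \<alpha>. complex_of_real (\<phi> w) * complex_of_real ((cmod (harmonic_kernel \<alpha> z w))\<^sup>2))
      = complex_of_real (LINT w|weighted_area \<alpha>. \<phi> w * (cmod (harmonic_kernel \<alpha> z w))\<^sup>2)"
    unfolding of_real_mult[symmetric] by (rule integral_complex_of_real)
  then show ?thesis unfolding berezin_def berezin_real_def by (simp only: of_real_divide)
qed

lemma symbol_kernel_integrable:
  assumes \<alpha>: "\<alpha> > -1" and \<phi>: "bounded_symbol \<alpha> \<phi> B" and z: "cmod z < 1"
  shows "integrable (weighted_area \<alpha>) (\<lambda>w. \<phi> w * (cmod (harmonic_kernel \<alpha> z w))\<^sup>2)"
proof (rule Bochner_Integration.integrable_bound)
  show "integrable (weighted_area \<alpha>) (\<lambda>w. B * (cmod (harmonic_kernel \<alpha> z w))\<^sup>2)"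
    by (intro integrable_mult_right harmonic_kernel_integrable[OF \<alpha> z])
  note [measurable] = harmonic_kernel_measurable[OF \<alpha> z]
  have b: "AE w in weighted_area \<alpha>. 0 \<le> \<phi> w \<and> \<phi> w \<le> B" and [measurable]: "\<phi> \<in> borel_measurable (weighted_area \<alpha>)"
    using \<phi> by (simp_all add: bounded_symbol_def)
  show "(\<lambda>w. \<phi> w * (cmod (harmonic_kernel \<alpha> z w))\<^sup>2) \<in> borel_measurable (weighted_area \<alpha>)" by measurable
  show "AE w in weighted_area \<alpha>. norm (\<phi> w * (cmod (harmonic_kernel \<alpha> z w))\<^sup>2) \<le> norm (B * (cmod (harmonic_kernel \<alpha> z w))\<^sup>2)"
    using b by eventually_elim (auto simp: abs_mult intro!: mult_right_mono)
qed

text \<open>Measurability in the parameter requires a jointly measurable integrand; on the disk the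
  kernel is therefore replaced by its power series, a limit of polynomials in w and cnj z.\<close>

lemma berezin_real_measurable:
  assumes \<alpha>: "\<alpha> > -1" and \<phi>: "\<phi> \<in> borel_measurable (weighted_area \<alpha>)"
  shows "berezin_real \<alpha> \<phi> \<in> borel_measurable (weighted_area \<alpha>)"
proof -
  let ?N = "weighted_area \<alpha>"
  interpret finite_measure ?N by (rule finite_measure_weighted_area[OF \<alpha>])
  define K where "K z w = (\<Sum>n. (bergman_coeff \<alpha> n * cnj z ^ n) * w ^ n)" for z w
  define H where "H z w = (cmod (K z w + cnj (K z w) - 1))\<^sup>2" for z w
  have f: "fst \<in> ?N \<Otimes>\<^sub>M ?N \<rightarrow>\<^sub>M borel" "snd \<in> ?N \<Otimes>\<^sub>M ?N \<rightarrow>\<^sub>M borel"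
    by (rule measurable_compose[OF measurable_fst ident_measurable_weighted_area],
        rule measurable_compose[OF measurable_snd ident_measurable_weighted_area])
  have [measurable]: "(\<lambda>p. K (fst p) (snd p)) \<in> borel_measurable (?N \<Otimes>\<^sub>M ?N)"
    unfolding K_def
    by (intro borel_measurable_suminf borel_measurable_times borel_measurable_power borel_measurable_const measurable_cnj f)
  have [measurable]: "(\<lambda>p. \<phi> (snd p)) \<in> borel_measurable (?N \<Otimes>\<^sub>M ?N)"
    by (rule measurable_compose[OF measurable_snd \<phi>])
  have "(\<lambda>p. \<phi> (snd p) * H (fst p) (snd p)) \<in> borel_measurable (?N \<Otimes>\<^sub>M ?N)"
    unfolding H_def by measurable
  then have m1: "(\<lambda>z. LINT w|?N. \<phi> w * H z w) \<in> borel_measurable ?N"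
    by (intro borel_measurable_lebesgue_integral) (simp add: case_prod_beta)
  have m2: "(\<lambda>z. 2 * (1 - (cmod z)\<^sup>2) powr (- (2 + \<alpha>)) - 1) \<in> borel_measurable ?N"
    by (rule borel_imp_measurable_weighted_area) measurable
  have eq: "berezin_real \<alpha> \<phi> z = (LINT w|?N. \<phi> w * H z w) / (2 * (1 - (cmod z)\<^sup>2) powr (- (2 + \<alpha>)) - 1)"
    if "z \<in> space ?N" for z
  proof -
    have z: "cmod z < 1" using that by simp
    have "(LINT w|?N. \<phi> w * (cmod (harmonic_kernel \<alpha> z w))\<^sup>2) = (LINT w|?N. \<phi> w * H z w)"
    proof (rule Bochner_Integration.integral_cong)
      fix w assume "w \<in> space ?N"
      then have "bergman_kernel \<alpha> z w = K z w"
        using bergman_kernel_facts(2)[OF \<alpha> z, of w] by (simp add: K_def)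
      then show "\<phi> w * (cmod (harmonic_kernel \<alpha> z w))\<^sup>2 = \<phi> w * H z w"
        by (simp add: harmonic_kernel_def H_def)
    qed simp
    then show ?thesis unfolding berezin_real_def wnorm_harmonic_kernel_real(1)[OF \<alpha> z] by (simp only:)
  qed
  show ?thesis
    using borel_measurable_divide[OF m1 m2] by (subst measurable_cong[OF eq])
qed

lemma berezin_real_bounds:
  assumes \<alpha>: "\<alpha> > -1" and \<phi>: "bounded_symbol \<alpha> \<phi> B" and z: "cmod z < 1"
  shows "0 \<le> berezin_real \<alpha> \<phi> z" "berezin_real \<alpha> \<phi> z \<le> B"
proof -
  let ?N = "weighted_area \<alpha>"
  note n = wnorm_harmonic_kernel_real(3)[OF \<alpha> z]
  have b: "AE w in ?N. 0 \<le> \<phi> w \<and> \<phi> w \<le> B" using \<phi> by (simp add: bounded_symbol_def)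
  show "0 \<le> berezin_real \<alpha> \<phi> z"
    unfolding berezin_real_def using b by (intro divide_nonneg_nonneg integral_nonneg_AE) auto
  have "(LINT w|?N. \<phi> w * (cmod (harmonic_kernel \<alpha> z w))\<^sup>2) \<le> (LINT w|?N. B * (cmod (harmonic_kernel \<alpha> z w))\<^sup>2)"
  proof (rule integral_mono_AE[OF symbol_kernel_integrable[OF \<alpha> \<phi> z] integrable_mult_right[OF harmonic_kernel_integrable[OF \<alpha> z]]])
    show "AE w in ?N. \<phi> w * (cmod (harmonic_kernel \<alpha> z w))\<^sup>2 \<le> B * (cmod (harmonic_kernel \<alpha> z w))\<^sup>2"
      using b by eventually_elim (intro mult_right_mono, simp_all)
  qed
  also have "\<dots> = B * (wnorm \<alpha> (harmonic_kernel \<alpha> z))\<^sup>2" by (simp add: wnorm_square)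
  finally show "berezin_real \<alpha> \<phi> z \<le> B"
    unfolding berezin_real_def by (simp only: pos_divide_le_eq[OF less_le_trans[OF zero_less_one n]])
qed

text \<open>Makes the kernel available as a test function: its holomorphic half is K - 1, its
  conjugated half is K.\<close>

lemma harmonic_kernel_Lh2:
  assumes \<alpha>: "\<alpha> > -1" and z: "cmod z < 1"
  shows "(\<lambda>w. if w \<in> unit_disk then harmonic_kernel \<alpha> z w else 0) \<in> Lh2 \<alpha>"
proof -
  define a where "a n = complex_of_real (bergman_coeff \<alpha> n) * cnj z ^ n" for n
  note F = bergman_kernel_facts[OF \<alpha> z, folded a_def]
  have "(\<lambda>w. \<Sum>n. a n * w ^ n) holomorphic_on unit_disk"
  proof (rule power_series_holomorphic[of 0 1 a])
    fix w :: complex assume w: "w \<in> unit_disk"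
    have "summable (\<lambda>n. a n * w ^ n)"
      by (rule summable_norm_cancel[OF summable_comparison_test[OF _ F(1)]])
        (use w in \<open>auto simp: norm_mult norm_power intro!: mult_left_le power_le_one exI[of _ 0]\<close>)
    then show "(\<lambda>n. a n * (w - 0) ^ n) sums (\<Sum>n. a n * w ^ n)" by (simp add: summable_sums)
  qed
  then have K: "bergman_kernel \<alpha> z holomorphic_on unit_disk"
    by (rule holomorphic_transform) (simp add: F(2))
  have "harmonic_on unit_disk (\<lambda>w. if w \<in> unit_disk then harmonic_kernel \<alpha> z w else 0)"
    by (rule harmonic_on_holomorphic_parts[OF open_ball holomorphic_on_diff[OF K holomorphic_on_const] K, where f="\<lambda>w. if w \<in> unit_disk then harmonic_kernel \<alpha> z w else 0"])
      (simp add: harmonic_kernel_def)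
  moreover have "integrable (weighted_area \<alpha>) (\<lambda>w. (cmod (if w \<in> unit_disk then harmonic_kernel \<alpha> z w else 0))\<^sup>2)"
    using harmonic_kernel_integrable[OF \<alpha> z]
    by (rule Bochner_Integration.integrable_cong[THEN iffD1, rotated 2]) simp_all
  ultimately show ?thesis by (simp add: Lh2_def)
qed

text \<open>Coercivity tested on the kernel at z bounds the Berezin transform below by C at every
  point of the disk, so its reciprocal is bounded by 1 / C.\<close>

lemma coercive_imp_berezin_invertible:
  assumes \<alpha>: "\<alpha> > -1" and \<phi>: "bounded_symbol \<alpha> \<phi> B" "coercive \<alpha> \<phi> C"
  shows "invertible_in_Linf \<alpha> (berezin \<alpha> (\<lambda>z. complex_of_real (\<phi> z)))"
proof -
  let ?N = "weighted_area \<alpha>"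
  have C: "C > 0" using \<phi> by (simp add: coercive_def)
  have m: "berezin_real \<alpha> \<phi> \<in> borel_measurable ?N"
    using \<phi>(1) by (intro berezin_real_measurable[OF \<alpha>]) (simp add: bounded_symbol_def)
  have low: "C \<le> berezin_real \<alpha> \<phi> z" if z: "cmod z < 1" for z
  proof -
    let ?f = "\<lambda>w. if w \<in> unit_disk then harmonic_kernel \<alpha> z w else 0"
    have "C * (LINT w|?N. (cmod (?f w))\<^sup>2) \<le> (LINT w|?N. (cmod (?f w))\<^sup>2 * \<phi> w)"
      by (rule bspec[OF conjunct2[OF \<phi>(2)[unfolded coercive_def]] harmonic_kernel_Lh2[OF \<alpha> z]])
    also have "(LINT w|?N. (cmod (?f w))\<^sup>2) = (LINT w|?N. (cmod (harmonic_kernel \<alpha> z w))\<^sup>2)"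
      by (rule Bochner_Integration.integral_cong) simp_all
    also have "(LINT w|?N. (cmod (?f w))\<^sup>2 * \<phi> w) = (LINT w|?N. \<phi> w * (cmod (harmonic_kernel \<alpha> z w))\<^sup>2)"
      by (rule Bochner_Integration.integral_cong) (simp_all add: mult.commute)
    finally show ?thesis
      unfolding berezin_real_def wnorm_square[symmetric]
      by (simp only: pos_le_divide_eq[OF less_le_trans[OF zero_less_one wnorm_harmonic_kernel_real(3)[OF \<alpha> z]]])
  qed
  have b: "(\<lambda>z. complex_of_real (berezin_real \<alpha> \<phi> z)) \<in> Linf \<alpha>"
  proof -
    have "AE z in ?N. cmod (complex_of_real (berezin_real \<alpha> \<phi> z)) \<le> B"
      using berezin_real_bounds[OF \<alpha> \<phi>(1)] by (intro AE_I2) simp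
    moreover have "(\<lambda>z. complex_of_real (berezin_real \<alpha> \<phi> z)) \<in> borel_measurable ?N"
      using m by measurable
    ultimately show ?thesis unfolding Linf_def by blast
  qed
  moreover have "(\<lambda>z. complex_of_real (inverse (berezin_real \<alpha> \<phi> z))) \<in> Linf \<alpha>"
  proof -
    have "cmod (complex_of_real (inverse (berezin_real \<alpha> \<phi> z))) \<le> inverse C" if "z \<in> space ?N" for z
    proof -
      have "C \<le> berezin_real \<alpha> \<phi> z" using low that by simp
      moreover from this have "inverse (berezin_real \<alpha> \<phi> z) \<le> inverse C" using C by (rule le_imp_inverse_le)
      ultimately show ?thesis using C by (simp only: norm_of_real) simp
    qed
    then have "AE z in ?N. cmod (complex_of_real (inverse (berezin_real \<alpha> \<phi> z))) \<le> inverse C"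
      by (rule AE_I2)
    moreover have "(\<lambda>z. complex_of_real (inverse (berezin_real \<alpha> \<phi> z))) \<in> borel_measurable ?N"
      using m by measurable
    ultimately show ?thesis unfolding Linf_def by blast
  qed
  moreover have "AE z in ?N. complex_of_real (berezin_real \<alpha> \<phi> z) * complex_of_real (inverse (berezin_real \<alpha> \<phi> z)) = 1"
  proof (rule AE_I2)
    fix z assume "z \<in> space ?N"
    then have "berezin_real \<alpha> \<phi> z \<noteq> 0" using low[of z] C by auto
    then show "complex_of_real (berezin_real \<alpha> \<phi> z) * complex_of_real (inverse (berezin_real \<alpha> \<phi> z)) = 1"
      by simp
  qed
  ultimately show ?thesis
    unfolding invertible_in_Linf_def berezin_eq[abs_def]
    by (intro conjI bexI[of _ "\<lambda>z. complex_of_real (inverse (berezin_real \<alpha> \<phi> z))"])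
qed

text \<open>The transform is nonnegative and its product with an essentially bounded function is 1,
  so it is at least the reciprocal of the bound.\<close>

lemma berezin_invertible_lower_bound:
  assumes \<alpha>: "\<alpha> > -1" and \<phi>: "bounded_symbol \<alpha> \<phi> B"
    and inv: "invertible_in_Linf \<alpha> (berezin \<alpha> (\<lambda>z. complex_of_real (\<phi> z)))"
  obtains \<eta> where "\<eta> > 0" "AE z in weighted_area \<alpha>. \<eta> \<le> berezin_real \<alpha> \<phi> z"
proof -
  let ?N = "weighted_area \<alpha>"
  obtain g where g: "g \<in> Linf \<alpha>" and one: "AE z in ?N. complex_of_real (berezin_real \<alpha> \<phi> z) * g z = 1"
    using inv unfolding invertible_in_Linf_def berezin_eq[abs_def] by blast
  then obtain D where D: "AE z in ?N. cmod (g z) \<le> D" unfolding Linf_def by blast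
  \<comment> \<open>The maximum with 1 ensures a positive divisor.\<close>
  define D' where "D' = max D 1"
  have D': "D' > 0" "D \<le> D'" by (auto simp: D'_def)
  have pos: "AE z in ?N. 0 \<le> berezin_real \<alpha> \<phi> z"
    using berezin_real_bounds(1)[OF \<alpha> \<phi>] by (intro AE_I2) simp
  have "AE z in ?N. 1 / D' \<le> berezin_real \<alpha> \<phi> z"
    using one D pos
  proof eventually_elim
    case (elim z)
    have "1 = cmod (complex_of_real (berezin_real \<alpha> \<phi> z) * g z)" using elim(1) by simp
    also have "\<dots> = berezin_real \<alpha> \<phi> z * cmod (g z)" using elim(3) by (simp add: norm_mult)
    also have "\<dots> \<le> berezin_real \<alpha> \<phi> z * D'" using elim D' by (intro mult_left_mono) auto
    finally show ?case using D' by (simp add: divide_le_eq)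
  qed
  then show thesis using D' by (intro that[of "1 / D'"]) auto
qed

text \<open>In the application x is the squared norm of the harmonic kernel and z that of the
  analytic one. Low values of the symbol and the tail each cost a quarter, so half remains.\<close>

lemma absorb_quarters:
  fixes \<eta> x z K :: real
  assumes "\<eta> * x \<le> K + \<eta> / 4 * x + \<eta> / 4 * z" "\<eta> * z \<le> \<eta> * x"
  shows "\<eta> / 2 * z \<le> K"
proof -
  have "\<eta> / 4 * x = (\<eta> * x) / 4" "\<eta> / 4 * z = (\<eta> * z) / 4" "\<eta> / 2 * z = (\<eta> * z) / 2" by simp_all
  then show ?thesis using assms by linarith
qed

text \<open>The integral of \<phi> |R|^2 is split three ways: off the pseudohyperbolic disk it is
  the small tail; inside, where \<phi> \<le> \<eta> / 4, it is at most \<eta> / 4 times the squared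
  norm; the rest lies in S, where the kernel is bounded. The rest must be large, which forces S to
  have positive density in the disk.\<close>

lemma berezin_imp_density:
  assumes \<alpha>: "\<alpha> > -1" and \<phi>: "bounded_symbol \<alpha> \<phi> B" and "B > 0" and a: "cmod a < 1" and \<eta>: "\<eta> > 0" "\<eta> \<le> berezin_real \<alpha> \<phi> a"
    and S: "S \<in> sets borel" "AE z in weighted_area \<alpha>. (\<eta> / 4 < \<phi> z) \<longleftrightarrow> z \<in> S"
    and R: "0 < R" "R < 1" "B * (2 + 2 powr (2 + \<alpha>))\<^sup>2 * (2 * (1 - R\<^sup>2) powr ((1 + \<alpha>) / 2)) \<le> \<eta> / 4"
  shows "ennreal (\<eta> / (2 * B * (2 + 2 powr (2 + \<alpha>))\<^sup>2 * 2 powr (2 * (2 + \<alpha>))) * (1 - (cmod a)\<^sup>2) powr (2 + \<alpha>))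
    \<le> wmass \<alpha> (S \<inter> pdisk R a) (\<lambda>_. 1)"
proof -
  let ?N = "weighted_area \<alpha>"
  define c where "c = (2 + 2 powr (2 + \<alpha>))\<^sup>2"
  have c: "c > 0" unfolding c_def by (intro zero_less_power two_plus_powr_pos)
  define t where "t = 1 - (cmod a)\<^sup>2"
  have t: "t > 0" using one_minus_square_pos[OF a] by (simp add: t_def)
  define H where "H w = (cmod (harmonic_kernel \<alpha> a w))\<^sup>2" for w
  define k where "k = kernel_square \<alpha> a"
  \<comment> \<open>An upper bound for the squared kernel on the disk, since the denominator is at
    least t / 2.\<close>
  define kb where "kb = (t / 2) powr (- (2 * (2 + \<alpha>)))"
  define E where "E = S \<inter> pdisk R a"
  have E[measurable]: "E \<in> sets borel" using S(1) by (simp add: E_def pdisk_borel)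
  define V where "V = (LINT w|?N. (indicator E w :: real))"
  define T where "T = (LINT w|?N. indicator (- pdisk R a) w * k w)"
  define n where "n = (wnorm \<alpha> (harmonic_kernel \<alpha> a))\<^sup>2"
  have n: "t powr (- (2 + \<alpha>)) \<le> n" "1 \<le> n"
    using wnorm_harmonic_kernel_real(2,3)[OF \<alpha> a] by (auto simp: n_def t_def)
  have b: "AE w in ?N. 0 \<le> \<phi> w \<and> \<phi> w \<le> B" using \<phi> by (simp add: bounded_symbol_def)
  have iE: "integrable ?N (indicator E :: complex \<Rightarrow> real)"
    by (rule integrable_weighted_area_bounded[OF \<alpha>, where B=1])
      (auto simp: indicator_def intro!: borel_imp_measurable_weighted_area borel_measurable_indicator[unfolded indicator_def[abs_def]])
  have iT: "integrable ?N (\<lambda>w. indicator (- pdisk R a) w * k w)"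
  proof (rule Bochner_Integration.integrable_bound[OF kernel_square_integrable[OF \<alpha> a]])
    have "(\<lambda>w. indicator (- pdisk R a) w * k w) \<in> borel_measurable borel" unfolding k_def by measurable
    then show "(\<lambda>w. indicator (- pdisk R a) w * k w) \<in> borel_measurable ?N"
      by (rule borel_imp_measurable_weighted_area)
  qed (auto simp: indicator_def k_def)
  have iH: "integrable ?N H" unfolding H_def[abs_def] by (rule harmonic_kernel_integrable[OF \<alpha> a])
  have "\<eta> * n \<le> (LINT w|?N. \<phi> w * H w)"
    using \<eta>(2) n(2) unfolding berezin_real_def H_def n_def[symmetric] by (simp add: le_divide_eq)
  also have "\<dots> \<le> (LINT w|?N. (B * c * kb) * indicator E w + \<eta> / 4 * H w + (B * c) * (indicator (- pdisk R a) w * k w))"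
  proof (rule integral_mono_AE)
    show "integrable ?N (\<lambda>w. \<phi> w * H w)"
      unfolding H_def by (rule symbol_kernel_integrable[OF \<alpha> \<phi> a])
    show "integrable ?N (\<lambda>w. (B * c * kb) * indicator E w + \<eta> / 4 * H w + (B * c) * (indicator (- pdisk R a) w * k w))"
      by (intro Bochner_Integration.integrable_add integrable_mult_right iE iH iT)
    have sp: "AE w in ?N. cmod w < 1" by (rule AE_I2) simp
    show "AE w in ?N. \<phi> w * H w \<le> (B * c * kb) * indicator E w + \<eta> / 4 * H w + (B * c) * (indicator (- pdisk R a) w * k w)"
      using b S(2) sp
    proof eventually_elim
      case (elim w)
      have H: "0 \<le> H w" "H w \<le> c * k w"
        using harmonic_kernel_le[OF \<alpha> a elim(3)] by (auto simp: H_def c_def k_def)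
      have k: "0 \<le> k w" "k w \<le> kb"
        using kernel_square_le[OF \<alpha> a elim(3)] by (auto simp: k_def kb_def t_def)
      have BH: "\<phi> w * H w \<le> B * (c * k w)"
        using elim(1) H by (intro mult_mono) auto
      have nn: "0 \<le> \<eta> / 4 * H w" "0 \<le> B * (c * k w)" "0 \<le> B * c * kb"
        using \<eta> H k c \<open>B > 0\<close> by (auto intro!: mult_nonneg_nonneg)
      consider "w \<notin> pdisk R a" | "w \<in> pdisk R a" "w \<in> S" | "w \<in> pdisk R a" "w \<notin> S" by blast
      then show ?case
      proof cases
        case 1
        then have "w \<notin> E" by (simp add: E_def)
        then show ?thesis using 1 BH nn by (simp add: mult.assoc)
      next
        case 2
        then have "w \<in> E" by (simp add: E_def)
        have "B * (c * k w) \<le> B * (c * kb)" using k c \<open>B > 0\<close> by (intro mult_left_mono) auto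
        then show ?thesis using 2 \<open>w \<in> E\<close> BH nn by (simp add: mult.assoc)
      next
        case 3
        then have "w \<notin> E" by (simp add: E_def)
        have "\<phi> w * H w \<le> \<eta> / 4 * H w" using elim(2) 3 H by (intro mult_right_mono) auto
        then show ?thesis using 3 \<open>w \<notin> E\<close> by simp
      qed
    qed
  qed
  also have "\<dots> = (B * c * kb) * V + \<eta> / 4 * n + (B * c) * T"
  proof -
    have "n = (LINT w|?N. H w)" by (simp add: n_def wnorm_square H_def)
    then show ?thesis using iE iH iT by (simp add: V_def T_def)
  qed
  finally have main: "\<eta> * n \<le> (B * c * kb) * V + \<eta> / 4 * n + (B * c) * T" .
  have "(B * c) * T \<le> (B * c) * (2 * (1 - R\<^sup>2) powr ((1 + \<alpha>) / 2) * t powr (- (2 + \<alpha>)))"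
    using kernel_square_tail[OF \<alpha> a R(1,2)] \<open>B > 0\<close> c
    by (intro mult_left_mono) (auto simp: T_def k_def t_def)
  also have "\<dots> = (B * c * (2 * (1 - R\<^sup>2) powr ((1 + \<alpha>) / 2))) * t powr (- (2 + \<alpha>))" by simp
  also have "\<dots> \<le> \<eta> / 4 * t powr (- (2 + \<alpha>))"
    using R(3) by (intro mult_right_mono) (auto simp: c_def)
  finally have "\<eta> * n \<le> (B * c * kb) * V + \<eta> / 4 * n + \<eta> / 4 * t powr (- (2 + \<alpha>))" using main by linarith
  moreover have "\<eta> * t powr (- (2 + \<alpha>)) \<le> \<eta> * n" using n \<eta> by (intro mult_left_mono) auto
  ultimately have half: "\<eta> / 2 * t powr (- (2 + \<alpha>)) \<le> (B * c * kb) * V" by (rule absorb_quarters)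
  have kb: "kb = 2 powr (2 * (2 + \<alpha>)) * t powr (- (2 * (2 + \<alpha>)))"
  proof -
    have "(t / 2) powr (- p) = 2 powr p * t powr (- p)" for p
    proof -
      have "(t / 2) powr (- p) = t powr (- p) / 2 powr (- p)" by (rule powr_divide)
      also have "\<dots> = 2 powr p * t powr (- p)" by (simp only: powr_minus[of 2] divide_inverse inverse_inverse_eq mult.commute)
      finally show ?thesis .
    qed
    then show ?thesis by (simp only: kb_def)
  qed
  have tt: "t powr (2 * (2 + \<alpha>)) * t powr (- (2 * (2 + \<alpha>))) = 1" "t powr (2 * (2 + \<alpha>)) * t powr (- (2 + \<alpha>)) = t powr (2 + \<alpha>)"
  proof -
    show "t powr (2 * (2 + \<alpha>)) * t powr (- (2 * (2 + \<alpha>))) = 1"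
      unfolding powr_add[symmetric] right_minus using t by simp
    show "t powr (2 * (2 + \<alpha>)) * t powr (- (2 + \<alpha>)) = t powr (2 + \<alpha>)"
      unfolding powr_add[symmetric] by (rule arg_cong) simp
  qed
  define P where "P = 2 powr (2 * (2 + \<alpha>))"
  have P: "P > 0" by (simp add: P_def)
  \<comment> \<open>Multiplication by t^(2 (2 + \<alpha>)) cancels the bound of the kernel and
    leaves the power 2 + \<alpha>, the order of the weighted area of the disk.\<close>
  have "t powr (2 * (2 + \<alpha>)) * (\<eta> / 2 * t powr (- (2 + \<alpha>))) \<le> t powr (2 * (2 + \<alpha>)) * ((B * c * kb) * V)"
    by (intro mult_left_mono half) simp
  also have "t powr (2 * (2 + \<alpha>)) * (\<eta> / 2 * t powr (- (2 + \<alpha>))) = \<eta> / 2 * t powr (2 + \<alpha>)"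
    by (subst mult.left_commute) (simp only: tt(2))
  also have "t powr (2 * (2 + \<alpha>)) * ((B * c * kb) * V) = B * c * P * V * (t powr (2 * (2 + \<alpha>)) * t powr (- (2 * (2 + \<alpha>))))"
    by (simp only: kb P_def mult_ac)
  also have "\<dots> = B * c * P * V" unfolding tt(1) by simp
  finally have le: "\<eta> / 2 * t powr (2 + \<alpha>) \<le> B * c * P * V" .
  have BcP: "0 < B * c * P" using \<open>B > 0\<close> c P by (intro mult_pos_pos)
  have "\<eta> / (2 * B * c * P) * t powr (2 + \<alpha>) = \<eta> / 2 * t powr (2 + \<alpha>) / (B * c * P)"
    by (simp add: mult.assoc)
  also have "\<dots> \<le> V" using le by (simp only: pos_divide_le_eq[OF BcP] mult.commute[of V])
  finally have "\<eta> / (2 * B * c * P) * t powr (2 + \<alpha>) \<le> V" .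
  then have "ennreal (\<eta> / (2 * B * c * P) * t powr (2 + \<alpha>)) \<le> ennreal V" by (rule ennreal_leI)
  also have "ennreal V = (\<integral>\<^sup>+w. ennreal (indicator E w) \<partial>?N)"
    unfolding V_def by (rule nn_integral_eq_integral[OF iE, symmetric]) simp
  also have "\<dots> = (\<integral>\<^sup>+w. ennreal (wdensity \<alpha> w) * ennreal (indicator E w) \<partial>lborel)"
    by (rule nn_integral_weighted_area[OF \<alpha>]) measurable
  also have "\<dots> = wmass \<alpha> E (\<lambda>_. 1)"
    unfolding wmass_def by (intro nn_integral_cong) (simp add: indicator_def)
  finally show ?thesis by (simp only: c_def P_def t_def E_def)
qed

lemma berezin_invertible_imp_reverse_carleson:
  assumes \<alpha>: "\<alpha> > -1" and \<phi>: "bounded_symbol \<alpha> \<phi> B"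
    and inv: "invertible_in_Linf \<alpha> (berezin \<alpha> (\<lambda>z. complex_of_real (\<phi> z)))"
  shows "\<exists>r>0. reverse_carleson \<alpha> {z \<in> unit_disk. \<phi> z > r}"
proof -
  let ?N = "weighted_area \<alpha>"
  obtain \<eta> where \<eta>: "\<eta> > 0" "AE z in ?N. \<eta> \<le> berezin_real \<alpha> \<phi> z"
    by (rule berezin_invertible_lower_bound[OF \<alpha> \<phi> inv])
  \<comment> \<open>The density constant has the bound of the symbol in its denominator, so the
    bound is made positive.\<close>
  define B' where "B' = max B 1"
  have B': "B' > 0" by (simp add: B'_def)
  have m[measurable]: "\<phi> \<in> borel_measurable ?N" and b: "AE w in ?N. 0 \<le> \<phi> w \<and> \<phi> w \<le> B"
    using \<phi> by (simp_all add: bounded_symbol_def)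
  have \<phi>': "bounded_symbol \<alpha> \<phi> B'"
    unfolding bounded_symbol_def
  proof (intro conjI m)
    show "AE z in ?N. 0 \<le> \<phi> z \<and> \<phi> z \<le> B'" using b by eventually_elim (simp add: B'_def le_max_iff_disj)
  qed
  define G where "G = {z \<in> unit_disk. \<phi> z > \<eta> / 4}"
  have "{z \<in> space ?N. \<phi> z > \<eta> / 4} \<in> sets ?N" by measurable
  then have G: "G \<in> sets (lebesgue_on unit_disk)" by (simp add: G_def)
  obtain S where S: "S \<in> sets borel" "AE z in ?N. z \<in> G \<longleftrightarrow> z \<in> S"
    by (rule borel_representative[OF \<alpha> G])
  have S2: "AE z in ?N. (\<eta> / 4 < \<phi> z) \<longleftrightarrow> z \<in> S"
    using S(2) AE_space by eventually_elim (simp add: G_def)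
  \<comment> \<open>The factor in front of (1 - R^2)^((1 + \<alpha>) / 2) in the tail of the
    integral of \<phi> |R|^2.\<close>
  define c where "c = B' * (2 + 2 powr (2 + \<alpha>))\<^sup>2 * 2"
  have c: "c > 0" unfolding c_def using B' by (intro mult_pos_pos zero_less_power two_plus_powr_pos) simp_all
  \<comment> \<open>This is 1 - R^2 for the radius to be used. The exponent 2 / (1 + \<alpha>)
    inverts the power in the tail bound, so that the tail costs at most \<eta> / 4; the minimum with
    1/2 keeps R strictly between 0 and 1.\<close>
  define x where "x = min (1 / 2) ((\<eta> / (4 * c)) powr (2 / (1 + \<alpha>)))"
  have x: "0 < x" "x < 1" using \<eta>(1) c by (auto simp: x_def)
  define R where "R = sqrt (1 - x)"
  have R: "0 < R" "R < 1" "1 - R\<^sup>2 = x" using x by (auto simp: R_def)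
  have "x powr ((1 + \<alpha>) / 2) \<le> ((\<eta> / (4 * c)) powr (2 / (1 + \<alpha>))) powr ((1 + \<alpha>) / 2)"
    using x \<alpha> by (intro powr_mono2) (auto simp: x_def)
  also have "\<dots> = \<eta> / (4 * c)"
  proof -
    have "2 / (1 + \<alpha>) * ((1 + \<alpha>) / 2) = 1" using \<alpha> by simp
    then show ?thesis unfolding powr_powr using \<eta>(1) c by (simp only:) simp
  qed
  finally have "c * x powr ((1 + \<alpha>) / 2) \<le> c * (\<eta> / (4 * c))" using c by (intro mult_left_mono) auto
  also have "\<dots> = \<eta> / 4" using c by simp
  finally have cx: "c * x powr ((1 + \<alpha>) / 2) \<le> \<eta> / 4" .
  have R3: "B' * (2 + 2 powr (2 + \<alpha>))\<^sup>2 * (2 * (1 - R\<^sup>2) powr ((1 + \<alpha>) / 2)) \<le> \<eta> / 4"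
    using cx unfolding R(3) c_def mult.assoc .
  define \<delta> where "\<delta> = \<eta> / (2 * B' * (2 + 2 powr (2 + \<alpha>))\<^sup>2 * 2 powr (2 * (2 + \<alpha>)))"
  have \<delta>: "\<delta> > 0" unfolding \<delta>_def using \<eta>(1) B'
    by (intro divide_pos_pos mult_pos_pos zero_less_power two_plus_powr_pos) simp_all
  have "AE a in lborel. cmod a < 1 \<longrightarrow>
      ennreal (\<delta> * (1 - (cmod a)\<^sup>2) powr (2 + \<alpha>)) \<le> wmass \<alpha> (S \<inter> pdisk R a) (\<lambda>_. 1)"
    using \<eta>(2)[unfolded AE_weighted_area_iff[OF \<alpha>]]
  proof eventually_elim
    case (elim a)
    show ?case
    proof
      assume a: "cmod a < 1"
      then have "\<eta> \<le> berezin_real \<alpha> \<phi> a" using elim by simp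
      then show "ennreal (\<delta> * (1 - (cmod a)\<^sup>2) powr (2 + \<alpha>)) \<le> wmass \<alpha> (S \<inter> pdisk R a) (\<lambda>_. 1)"
        unfolding \<delta>_def by (intro berezin_imp_density[OF \<alpha> \<phi>' B' a \<eta>(1) _ S(1) S2 R(1,2) R3])
    qed
  qed
  then obtain C where C: "C > 0 \<and> (\<forall>f\<in>Lh2 \<alpha>. wmass \<alpha> UNIV f \<le> ennreal C * wmass \<alpha> S f)"
    using density_imp_reverse_carleson[OF \<alpha> S(1) R(1,2) \<delta>] by blast
  have "(LINT z|?N. (cmod (f z))\<^sup>2) \<le> C * (LINT z:G|?N. (cmod (f z))\<^sup>2)" if f: "f \<in> Lh2 \<alpha>" for f
  proof -
    note int = L2_integrable[OF Lh2_L2[OF f]] and fm = Lh2_borel[OF f]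
    have "G \<in> sets ?N" using G by simp
    then have intG: "integrable ?N (\<lambda>z. indicator G z *\<^sub>R (cmod (f z))\<^sup>2)"
      by (rule integrable_mult_indicator[OF _ int])
    have "ennreal (LINT z|?N. (cmod (f z))\<^sup>2) = wmass \<alpha> UNIV f"
      unfolding wmass_def using fm
      by (subst nn_integral_eq_integral[OF int, symmetric], simp, subst nn_integral_weighted_area[OF \<alpha>]) auto
    also have "\<dots> \<le> ennreal C * wmass \<alpha> S f" using C f by blast
    also have "wmass \<alpha> S f = ennreal (LINT z:G|?N. (cmod (f z))\<^sup>2)"
    proof -
      have ms: "(\<lambda>z. indicator S z * ennreal ((cmod (f z))\<^sup>2)) \<in> borel_measurable borel"
        using S(1) fm by measurable
      have "wmass \<alpha> S f = (\<integral>\<^sup>+z. ennreal (wdensity \<alpha> z) * (indicator S z * ennreal ((cmod (f z))\<^sup>2)) \<partial>lborel)"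
        unfolding wmass_def by (simp only: mult.left_commute)
      also have "\<dots> = (\<integral>\<^sup>+z. indicator S z * ennreal ((cmod (f z))\<^sup>2) \<partial>?N)"
        by (rule nn_integral_weighted_area[OF \<alpha> ms, symmetric])
      also have "\<dots> = (\<integral>\<^sup>+z. ennreal (indicator G z *\<^sub>R (cmod (f z))\<^sup>2) \<partial>?N)"
      proof (rule nn_integral_cong_AE)
        show "AE z in ?N. indicator S z * ennreal ((cmod (f z))\<^sup>2) = ennreal (indicator G z *\<^sub>R (cmod (f z))\<^sup>2)"
          using S(2) by eventually_elim (simp add: indicator_def)
      qed
      also have "\<dots> = ennreal (LINT z:G|?N. (cmod (f z))\<^sup>2)"
        unfolding set_lebesgue_integral_def by (rule nn_integral_eq_integral[OF intG]) simp
      finally show ?thesis .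
    qed
    finally have "ennreal (LINT z|?N. (cmod (f z))\<^sup>2) \<le> ennreal C * ennreal (LINT z:G|?N. (cmod (f z))\<^sup>2)" .
    moreover have "0 \<le> (LINT z:G|?N. (cmod (f z))\<^sup>2)"
      unfolding set_lebesgue_integral_def by (intro integral_nonneg_AE) simp
    ultimately show ?thesis
      using C by (simp add: ennreal_mult'[symmetric])
  qed
  then have "reverse_carleson \<alpha> G" unfolding reverse_carleson_def using G C by blast
  then show ?thesis unfolding G_def using \<eta>(1) by (intro exI[of _ "\<eta> / 4"]) simp
qed

text \<open>Almost everywhere the symbol is at least r on the superlevel set and nonnegative
  elsewhere, so r / C is a coercivity constant.\<close>

lemma reverse_carleson_imp_coercive:
  assumes \<alpha>: "\<alpha> > -1" and \<phi>: "bounded_symbol \<alpha> \<phi> B" and "r > 0"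
    and rc: "reverse_carleson \<alpha> {z \<in> unit_disk. \<phi> z > r}"
  shows "\<exists>C. coercive \<alpha> \<phi> C"
proof -
  let ?N = "weighted_area \<alpha>" and ?G = "{z \<in> unit_disk. \<phi> z > r}"
  have G: "?G \<in> sets ?N" using rc by (simp add: reverse_carleson_def)
  obtain C where C: "C > 0 \<and> (\<forall>f\<in>Lh2 \<alpha>. (LINT z|?N. (cmod (f z))\<^sup>2) \<le> C * (LINT z:?G|?N. (cmod (f z))\<^sup>2))"
    using conjunct2[OF rc[unfolded reverse_carleson_def]] ..
  have m[measurable]: "\<phi> \<in> borel_measurable ?N" and b: "AE w in ?N. 0 \<le> \<phi> w \<and> \<phi> w \<le> B"
    using \<phi> by (simp_all add: bounded_symbol_def)
  have "(r / C) * (LINT z|?N. (cmod (f z))\<^sup>2) \<le> (LINT z|?N. (cmod (f z))\<^sup>2 * \<phi> z)" if f: "f \<in> Lh2 \<alpha>" for f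
  proof -
    note int = L2_integrable[OF Lh2_L2[OF f]]
    note [measurable] = L2_measurable[OF Lh2_L2[OF f]]
    have "(r / C) * (LINT z|?N. (cmod (f z))\<^sup>2) \<le> (r / C) * (C * (LINT z:?G|?N. (cmod (f z))\<^sup>2))"
      using C f \<open>r > 0\<close> by (intro mult_left_mono) auto
    also have "\<dots> = (LINT z|?N. r * (indicator ?G z *\<^sub>R (cmod (f z))\<^sup>2))"
      using C by (simp add: set_lebesgue_integral_def)
    also have "\<dots> \<le> (LINT z|?N. (cmod (f z))\<^sup>2 * \<phi> z)"
    proof (rule integral_mono_AE)
      show "integrable ?N (\<lambda>z. r * (indicator ?G z *\<^sub>R (cmod (f z))\<^sup>2))"
        by (intro integrable_mult_right integrable_mult_indicator[OF G int])
      show "integrable ?N (\<lambda>z. (cmod (f z))\<^sup>2 * \<phi> z)"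
      proof (rule Bochner_Integration.integrable_bound[OF integrable_mult_right[OF int, of B]])
        show "AE z in ?N. norm ((cmod (f z))\<^sup>2 * \<phi> z) \<le> norm (B * (cmod (f z))\<^sup>2)"
          using b
        proof eventually_elim
          case (elim z)
          have "\<phi> z * (cmod (f z))\<^sup>2 \<le> B * (cmod (f z))\<^sup>2"
            using elim by (intro mult_right_mono) simp_all
          then show ?case using elim by (simp add: abs_mult mult.commute)
        qed
      qed measurable
      show "AE z in ?N. r * (indicator ?G z *\<^sub>R (cmod (f z))\<^sup>2) \<le> (cmod (f z))\<^sup>2 * \<phi> z"
        using b
      proof eventually_elim
        case (elim z)
        show ?case
        proof (cases "z \<in> ?G")
          case True
          then have "r \<le> \<phi> z" by simp
          then have "(cmod (f z))\<^sup>2 * r \<le> (cmod (f z))\<^sup>2 * \<phi> z" by (rule mult_left_mono) simp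
          then show ?thesis using True by (simp add: mult.commute)
        next
          case False
          then have "indicator ?G z = (0::real)" by (simp add: indicator_def)
          then show ?thesis using elim by simp
        qed
      qed
    qed
    finally show ?thesis .
  qed
  then have "coercive \<alpha> \<phi> (r / C)" using C \<open>r > 0\<close> by (simp add: coercive_def)
  then show ?thesis ..
qed

section \<open>Equivalence of the four conditions\<close>

theorem theorem4p2:
  fixes \<alpha> :: real and \<phi> :: "complex \<Rightarrow> real"
  defines "\<Phi> \<equiv> (\<lambda>z. complex_of_real (\<phi> z))"
  assumes "\<alpha> > -1"
    and "\<Phi> \<in> Linf \<alpha>"
    and "AE z in weighted_area \<alpha>. \<phi> z \<ge> 0"
  shows "(\<forall>z\<in>unit_disk.
            complex_of_real ((wnorm \<alpha> (harmonic_kernel \<alpha> z))\<^sup>2) = harmonic_kernel \<alpha> z z \<and>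
            harmonic_kernel \<alpha> z z
              = complex_of_real (2 / (1 - (cmod z)\<^sup>2) powr (2 + \<alpha>) - 1)) \<and>
         (invertible_on_Lh2 \<alpha> (toeplitz \<alpha> \<Phi>)
            \<longleftrightarrow> invertible_in_Linf \<alpha> (berezin \<alpha> \<Phi>)) \<and>
         (invertible_in_Linf \<alpha> (berezin \<alpha> \<Phi>)
            \<longleftrightarrow> (\<exists>r>0. reverse_carleson \<alpha> {z \<in> unit_disk. \<phi> z > r})) \<and>
         ((\<exists>r>0. reverse_carleson \<alpha> {z \<in> unit_disk. \<phi> z > r})
            \<longleftrightarrow> (\<exists>C>0. \<forall>f\<in>Lh2 \<alpha>.
                   (LINT z|weighted_area \<alpha>. (cmod (f z))\<^sup>2 * \<phi> z)
                     \<ge> C * (LINT z|weighted_area \<alpha>. (cmod (f z))\<^sup>2)))"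
proof -
  let ?N = "weighted_area \<alpha>"
  note \<alpha> = \<open>\<alpha> > -1\<close>
  obtain B where B: "AE z in ?N. cmod (\<Phi> z) \<le> B" using assms(3) unfolding Linf_def by blast
  have \<Phi>m: "\<Phi> \<in> borel_measurable ?N" using assms(3) unfolding Linf_def by blast
  have "(\<lambda>z. Re (\<Phi> z)) \<in> borel_measurable ?N" using \<Phi>m by measurable
  then have "\<phi> \<in> borel_measurable ?N" by (simp add: \<Phi>_def)
  moreover have "AE z in ?N. 0 \<le> \<phi> z \<and> \<phi> z \<le> B"
    using B assms(4) by eventually_elim (simp add: \<Phi>_def)
  ultimately have \<phi>: "bounded_symbol \<alpha> \<phi> B" by (simp add: bounded_symbol_def)
  have c4: "(\<exists>C>0. \<forall>f\<in>Lh2 \<alpha>. (LINT z|?N. (cmod (f z))\<^sup>2 * \<phi> z) \<ge> C * (LINT z|?N. (cmod (f z))\<^sup>2))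
      \<longleftrightarrow> (\<exists>C. coercive \<alpha> \<phi> C)"
    unfolding coercive_def ..
  \<comment> \<open>Coercivity is the hub: it is equivalent to invertibility of the operator and
    lies on a cycle of three implications with the other two conditions.\<close>
  have "invertible_on_Lh2 \<alpha> (toeplitz \<alpha> \<Phi>) \<longleftrightarrow> (\<exists>C. coercive \<alpha> \<phi> C)"
    unfolding \<Phi>_def using invertible_imp_coercive[OF \<alpha> \<phi>] coercive_imp_invertible[OF \<alpha> \<phi>] by blast
  moreover have "(\<exists>C. coercive \<alpha> \<phi> C) \<Longrightarrow> invertible_in_Linf \<alpha> (berezin \<alpha> \<Phi>)"
    unfolding \<Phi>_def using coercive_imp_berezin_invertible[OF \<alpha> \<phi>] by blast
  moreover have "invertible_in_Linf \<alpha> (berezin \<alpha> \<Phi>) \<Longrightarrow> \<exists>r>0. reverse_carleson \<alpha> {z \<in> unit_disk. \<phi> z > r}"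
    unfolding \<Phi>_def by (rule berezin_invertible_imp_reverse_carleson[OF \<alpha> \<phi>])
  moreover have "\<exists>r>0. reverse_carleson \<alpha> {z \<in> unit_disk. \<phi> z > r} \<Longrightarrow> \<exists>C. coercive \<alpha> \<phi> C"
    using reverse_carleson_imp_coercive[OF \<alpha> \<phi>] by blast
  moreover have "\<forall>z\<in>unit_disk.
            complex_of_real ((wnorm \<alpha> (harmonic_kernel \<alpha> z))\<^sup>2) = harmonic_kernel \<alpha> z z \<and>
            harmonic_kernel \<alpha> z z = complex_of_real (2 / (1 - (cmod z)\<^sup>2) powr (2 + \<alpha>) - 1)"
    using wnorm_harmonic_kernel[OF \<alpha>] harmonic_kernel_diag by simp
  ultimately show ?thesis unfolding c4 by argo
qed

end
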